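(* Let $t\in\mathbb{C}$. The category $\underline{\mathrm{Rep}}(S_t^+)$ is semisimple if and only if $$t\notin\left\{4\cdot\cos\left(\tfrac{j\pi}{l}\right)^2\ \middle|\ l\in\mathbb{N}_{\ge2},\ j\in\{1,\dots,l-1\}\right\}.$$
   Context: For $k,l\in\mathbb{N}_0$ let $P(k,l)$ be the set of set partitions of $\{1,\dots,k,1',\dots,l'\}$ ($k$ upper points, $l$ lower points). For $p\in P(k,l)$, $q\in P(l,m)$, stack $p$ above $q$, identifying the lower points of $p$ with the upper points of $q$; $q\cdot p\in P(k,m)$ is the induced partition of the outer points by connected components, and $\ell(q,p)$ is the number of connected components containing only middle points. $NC(k,l)\subseteq P(k,l)$ denotes the set of non-crossing partitions: with points ordered $1,\dots,k,l',\dots,1'$ there are no $a<b<c<d$ with $a,c$ in one block and $b,d$ in a different block. For $t\in\mathbb{C}$, let $\underline{\mathrm{Rep}}_0(NC,t)$ be the $\mathbb{C}$-linear category with objects $[k]$, $k\in\mathbb{N}_0$, $\mathrm{Hom}([k],[l])=\mathbb{C}\,NC(k,l)$ (vector space with basis $NC(k,l)$), and composition extending $qp:=t^{\ell(q,p)}\,q\cdot p$ bilinearly. $\underline{\mathrm{Rep}}(S_t^+):=\underline{\mathrm{Rep}}(NC,t)$ is its Karoubi envelope (idempotent completion of the additive completion). Semisimple means: abelian, and every object is a finite direct sum of simple objects. *)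

theory Defs
  imports Complex_Main "HOL-Library.Function_Algebras" "HOL-Library.Disjoint_Sets"
begin

section \<open>Complex-linear categories\<close>

text \<open>
  Morphisms live in one additive group type and the hom spaces are subspaces of it; they need not
  be disjoint, so composition takes the three objects as arguments:
  \<open>cmp C X Y Z g f\<close> is the composite of \<open>f : X \<rightarrow> Y\<close> and \<open>g : Y \<rightarrow> Z\<close>.
\<close>

record ('o, 'm) lincat =
  obj :: "'o set"
  hom :: "'o \<Rightarrow> 'o \<Rightarrow> 'm set"
  cmp :: "'o \<Rightarrow> 'o \<Rightarrow> 'o \<Rightarrow> 'm \<Rightarrow> 'm \<Rightarrow> 'm"
  idm :: "'o \<Rightarrow> 'm"
  scl :: "complex \<Rightarrow> 'm \<Rightarrow> 'm"

locale linear_category =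
  fixes C :: "('o, 'm::ab_group_add) lincat"
  assumes vector_space_scl: "vector_space (scl C)"
    and subspace_hom:
      "\<lbrakk>X \<in> obj C; Y \<in> obj C\<rbrakk> \<Longrightarrow> module.subspace (scl C) (hom C X Y)"
    and idm_hom: "X \<in> obj C \<Longrightarrow> idm C X \<in> hom C X X"
    and cmp_hom:
      "\<lbrakk>X \<in> obj C; Y \<in> obj C; Z \<in> obj C; f \<in> hom C X Y; g \<in> hom C Y Z\<rbrakk>
        \<Longrightarrow> cmp C X Y Z g f \<in> hom C X Z"
    and cmp_idm:
      "\<lbrakk>X \<in> obj C; Y \<in> obj C; f \<in> hom C X Y\<rbrakk> \<Longrightarrow> cmp C X X Y f (idm C X) = f"
    and idm_cmp:
      "\<lbrakk>X \<in> obj C; Y \<in> obj C; f \<in> hom C X Y\<rbrakk> \<Longrightarrow> cmp C X Y Y (idm C Y) f = f"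
    and cmp_assoc:
      "\<lbrakk>W \<in> obj C; X \<in> obj C; Y \<in> obj C; Z \<in> obj C;
        f \<in> hom C W X; g \<in> hom C X Y; h \<in> hom C Y Z\<rbrakk>
        \<Longrightarrow> cmp C W X Z (cmp C X Y Z h g) f = cmp C W Y Z h (cmp C W X Y g f)"
    and cmp_add_left:
      "\<lbrakk>X \<in> obj C; Y \<in> obj C; Z \<in> obj C; f \<in> hom C X Y; g \<in> hom C Y Z; g' \<in> hom C Y Z\<rbrakk>
        \<Longrightarrow> cmp C X Y Z (g + g') f = cmp C X Y Z g f + cmp C X Y Z g' f"
    and cmp_add_right:
      "\<lbrakk>X \<in> obj C; Y \<in> obj C; Z \<in> obj C; f \<in> hom C X Y; f' \<in> hom C X Y; g \<in> hom C Y Z\<rbrakk>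
        \<Longrightarrow> cmp C X Y Z g (f + f') = cmp C X Y Z g f + cmp C X Y Z g f'"
    and cmp_scl_left:
      "\<lbrakk>X \<in> obj C; Y \<in> obj C; Z \<in> obj C; f \<in> hom C X Y; g \<in> hom C Y Z\<rbrakk>
        \<Longrightarrow> cmp C X Y Z (scl C c g) f = scl C c (cmp C X Y Z g f)"
    and cmp_scl_right:
      "\<lbrakk>X \<in> obj C; Y \<in> obj C; Z \<in> obj C; f \<in> hom C X Y; g \<in> hom C Y Z\<rbrakk>
        \<Longrightarrow> cmp C X Y Z g (scl C c f) = scl C c (cmp C X Y Z g f)"

definition is_mono :: "('o, 'm::ab_group_add) lincat \<Rightarrow> 'o \<Rightarrow> 'o \<Rightarrow> 'm \<Rightarrow> bool" where
  "is_mono C X Y f \<longleftrightarrow> f \<in> hom C X Y \<and>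
     (\<forall>W\<in>obj C. \<forall>g\<in>hom C W X. \<forall>h\<in>hom C W X. cmp C W X Y f g = cmp C W X Y f h \<longrightarrow> g = h)"

definition is_epi :: "('o, 'm::ab_group_add) lincat \<Rightarrow> 'o \<Rightarrow> 'o \<Rightarrow> 'm \<Rightarrow> bool" where
  "is_epi C X Y f \<longleftrightarrow> f \<in> hom C X Y \<and>
     (\<forall>Z\<in>obj C. \<forall>g\<in>hom C Y Z. \<forall>h\<in>hom C Y Z. cmp C X Y Z g f = cmp C X Y Z h f \<longrightarrow> g = h)"

definition is_iso :: "('o, 'm::ab_group_add) lincat \<Rightarrow> 'o \<Rightarrow> 'o \<Rightarrow> 'm \<Rightarrow> bool" where
  "is_iso C X Y f \<longleftrightarrow> f \<in> hom C X Y \<and>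
     (\<exists>g\<in>hom C Y X. cmp C X Y X g f = idm C X \<and> cmp C Y X Y f g = idm C Y)"

definition is_kernel ::
    "('o, 'm::ab_group_add) lincat \<Rightarrow> 'o \<Rightarrow> 'o \<Rightarrow> 'm \<Rightarrow> 'o \<Rightarrow> 'm \<Rightarrow> bool" where
  "is_kernel C X Y f K k \<longleftrightarrow> K \<in> obj C \<and> k \<in> hom C K X \<and> cmp C K X Y f k = 0 \<and>
     (\<forall>W\<in>obj C. \<forall>g\<in>hom C W X. cmp C W X Y f g = 0 \<longrightarrow>
        (\<exists>!h. h \<in> hom C W K \<and> cmp C W K X k h = g))"

definition is_cokernel ::
    "('o, 'm::ab_group_add) lincat \<Rightarrow> 'o \<Rightarrow> 'o \<Rightarrow> 'm \<Rightarrow> 'o \<Rightarrow> 'm \<Rightarrow> bool" where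
  "is_cokernel C X Y f Q q \<longleftrightarrow> Q \<in> obj C \<and> q \<in> hom C Y Q \<and> cmp C X Y Q q f = 0 \<and>
     (\<forall>Z\<in>obj C. \<forall>g\<in>hom C Y Z. cmp C X Y Z g f = 0 \<longrightarrow>
        (\<exists>!h. h \<in> hom C Q Z \<and> cmp C Y Q Z h q = g))"

text \<open>The empty list is allowed below; an empty direct sum is a zero object.\<close>

definition is_direct_sum :: "('o, 'm::ab_group_add) lincat \<Rightarrow> 'o list \<Rightarrow> 'o \<Rightarrow> bool" where
  "is_direct_sum C Xs S \<longleftrightarrow> set Xs \<subseteq> obj C \<and> S \<in> obj C \<and>
     (\<exists>\<iota> \<pi>.
        (\<forall>i<length Xs. \<iota> i \<in> hom C (Xs ! i) S \<and> \<pi> i \<in> hom C S (Xs ! i)) \<and>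
        (\<forall>i<length Xs. \<forall>j<length Xs.
           cmp C (Xs ! j) S (Xs ! i) (\<pi> i) (\<iota> j) = (if i = j then idm C (Xs ! i) else 0)) \<and>
        (\<Sum>i<length Xs. cmp C S (Xs ! i) S (\<iota> i) (\<pi> i)) = idm C S)"

definition is_zero_object :: "('o, 'm::ab_group_add) lincat \<Rightarrow> 'o \<Rightarrow> bool" where
  "is_zero_object C X \<longleftrightarrow> X \<in> obj C \<and>
     (\<forall>Y\<in>obj C. (\<exists>!f. f \<in> hom C X Y) \<and> (\<exists>!f. f \<in> hom C Y X))"

definition is_simple :: "('o, 'm::ab_group_add) lincat \<Rightarrow> 'o \<Rightarrow> bool" where
  "is_simple C X \<longleftrightarrow> X \<in> obj C \<and> \<not> is_zero_object C X \<and>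
     (\<forall>Y\<in>obj C. \<forall>f. is_mono C Y X f \<longrightarrow> is_zero_object C Y \<or> is_iso C Y X f)"

locale abelian_category = linear_category C for C :: "('o, 'm::ab_group_add) lincat" +
  assumes ex_direct_sum: "set Xs \<subseteq> obj C \<Longrightarrow> \<exists>S. is_direct_sum C Xs S"
    and ex_kernel:
      "\<lbrakk>X \<in> obj C; Y \<in> obj C; f \<in> hom C X Y\<rbrakk> \<Longrightarrow> \<exists>K k. is_kernel C X Y f K k"
    and ex_cokernel:
      "\<lbrakk>X \<in> obj C; Y \<in> obj C; f \<in> hom C X Y\<rbrakk> \<Longrightarrow> \<exists>Q q. is_cokernel C X Y f Q q"
    and mono_is_kernel:
      "\<lbrakk>X \<in> obj C; Y \<in> obj C; is_mono C X Y f\<rbrakk>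
        \<Longrightarrow> \<exists>Z\<in>obj C. \<exists>g\<in>hom C Y Z. is_kernel C Y Z g X f"
    and epi_is_cokernel:
      "\<lbrakk>X \<in> obj C; Y \<in> obj C; is_epi C X Y f\<rbrakk>
        \<Longrightarrow> \<exists>W\<in>obj C. \<exists>g\<in>hom C W X. is_cokernel C W X g Y f"

locale semisimple_category = abelian_category C for C :: "('o, 'm::ab_group_add) lincat" +
  assumes ex_simple_decomposition:
    "X \<in> obj C \<Longrightarrow> \<exists>Xs. (\<forall>S\<in>set Xs. is_simple C S) \<and> is_direct_sum C Xs X"

section \<open>The Karoubi envelope\<close>

text \<open>
  Objects of the additive completion are finite lists, read as formal direct sums. A morphism from
  \<open>Xs\<close> to \<open>Ys\<close> is a matrix whose entry in row \<open>i\<close> and column \<open>j\<close> is a morphism from \<open>Xs ! j\<close> to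
  \<open>Ys ! i\<close>; entries outside the index range are 0, so that each matrix has one representative.
\<close>

definition additive_completion ::
    "('o, 'm::ab_group_add) lincat \<Rightarrow> ('o list, nat \<Rightarrow> nat \<Rightarrow> 'm) lincat" where
  "additive_completion C =
    \<lparr>obj = {Xs. set Xs \<subseteq> obj C},
     hom = (\<lambda>Xs Ys. {f. \<forall>i j. if i < length Ys \<and> j < length Xs
                               then f i j \<in> hom C (Xs ! j) (Ys ! i) else f i j = 0}),
     cmp = (\<lambda>Xs Ys Zs g f i k.
              if i < length Zs \<and> k < length Xs
              then \<Sum>j<length Ys. cmp C (Xs ! k) (Ys ! j) (Zs ! i) (g i j) (f j k) else 0),
     idm = (\<lambda>Xs i j. if i = j \<and> i < length Xs then idm C (Xs ! i) else 0),
     scl = (\<lambda>c f i j. scl C c (f i j))\<rparr>"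

definition idempotent_completion ::
    "('o, 'm::ab_group_add) lincat \<Rightarrow> ('o \<times> 'm, 'm) lincat" where
  "idempotent_completion C =
    \<lparr>obj = {(X, e). X \<in> obj C \<and> e \<in> hom C X X \<and> cmp C X X X e e = e},
     hom = (\<lambda>(X, e) (Y, e'). {f \<in> hom C X Y. cmp C X X Y f e = f \<and> cmp C X Y Y e' f = f}),
     cmp = (\<lambda>(X, _) (Y, _) (Z, _). cmp C X Y Z),
     idm = (\<lambda>(X, e). e),
     scl = scl C\<rparr>"

definition karoubi_envelope ::
    "('o, 'm::ab_group_add) lincat \<Rightarrow>
      ('o list \<times> (nat \<Rightarrow> nat \<Rightarrow> 'm), nat \<Rightarrow> nat \<Rightarrow> 'm) lincat" where
  "karoubi_envelope C = idempotent_completion (additive_completion C)"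

section \<open>Partitions\<close>

datatype point = Upper nat | Lower nat

type_synonym diagram = "point set set"

definition points :: "nat \<Rightarrow> nat \<Rightarrow> point set" where
  "points k l = Upper ` {1..k} \<union> Lower ` {1..l}"

definition partitions :: "nat \<Rightarrow> nat \<Rightarrow> diagram set" where
  "partitions k l = {p. partition_on (points k l) p}"

text \<open>Position in the order \<open>1, \<dots>, k, l', \<dots>, 1'\<close>:\<close>

fun position :: "nat \<Rightarrow> nat \<Rightarrow> point \<Rightarrow> nat" where
  "position k l (Upper i) = i"
| "position k l (Lower j) = k + (l + 1 - j)"

definition noncrossing :: "nat \<Rightarrow> nat \<Rightarrow> diagram \<Rightarrow> bool" where
  "noncrossing k l p \<longleftrightarrow>
     \<not> (\<exists>a b c d. position k l a < position k l b \<and> position k l b < position k l c \<and>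
          position k l c < position k l d \<and>
          (\<exists>A\<in>p. \<exists>B\<in>p. A \<noteq> B \<and> a \<in> A \<and> c \<in> A \<and> b \<in> B \<and> d \<in> B))"

definition NC :: "nat \<Rightarrow> nat \<Rightarrow> diagram set" where
  "NC k l = {p \<in> partitions k l. noncrossing k l p}"

definition id_diagram :: "nat \<Rightarrow> diagram" where
  "id_diagram k = {{Upper i, Lower i} | i. i \<in> {1..k}}"

text \<open>
  Stacking \<open>p\<close> above \<open>q\<close>: lower points of \<open>p\<close> and upper points of \<open>q\<close> become the same middle points.
  The blocks of \<open>p\<close> and \<open>q\<close> cover all points, so the relation below is reflexive on them and its
  transitive closure is the connectedness relation.
\<close>

datatype stack_point = Top nat | Middle nat | Bottom nat

fun above :: "point \<Rightarrow> stack_point" where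
  "above (Upper i) = Top i"
| "above (Lower j) = Middle j"

fun below :: "point \<Rightarrow> stack_point" where
  "below (Upper i) = Middle i"
| "below (Lower j) = Bottom j"

fun outer :: "point \<Rightarrow> stack_point" where
  "outer (Upper i) = Top i"
| "outer (Lower j) = Bottom j"

definition stack_blocks :: "diagram \<Rightarrow> diagram \<Rightarrow> stack_point set set" where
  "stack_blocks q p = (`) above ` p \<union> (`) below ` q"

definition stack_components :: "diagram \<Rightarrow> diagram \<Rightarrow> stack_point set set" where
  "stack_components q p =
     \<Union> (stack_blocks q p) // {(x, y). \<exists>b\<in>stack_blocks q p. x \<in> b \<and> y \<in> b}\<^sup>+"

definition diagram_comp :: "diagram \<Rightarrow> diagram \<Rightarrow> diagram" where
  "diagram_comp q p = (\<lambda>K. outer -` K) ` stack_components q p - {{}}"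

definition loops :: "diagram \<Rightarrow> diagram \<Rightarrow> nat" where
  "loops q p = card {K \<in> stack_components q p. K \<subseteq> range Middle}"

section \<open>The categories of non-crossing partitions\<close>

text \<open>
  A vector of \<open>\<complex> NC(k, l)\<close> is its coefficient function, extended by 0 to all diagrams. Vector
  addition is the pointwise one of \<^theory>\<open>HOL-Library.Function_Algebras\<close>.
\<close>

definition Rep0_NC :: "complex \<Rightarrow> (nat, diagram \<Rightarrow> complex) lincat" where
  "Rep0_NC t =
    \<lparr>obj = UNIV,
     hom = (\<lambda>k l. {f. \<forall>p. p \<notin> NC k l \<longrightarrow> f p = 0}),
     cmp = (\<lambda>k l m g f r. \<Sum>q\<in>NC l m. \<Sum>p\<in>NC k l.
              if diagram_comp q p = r then g q * f p * t ^ loops q p else 0),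
     idm = (\<lambda>k p. if p = id_diagram k then 1 else 0),
     scl = (\<lambda>c f p. c * f p)\<rparr>"

definition Rep_S_plus ::
    "complex \<Rightarrow>
      (nat list \<times> (nat \<Rightarrow> nat \<Rightarrow> diagram \<Rightarrow> complex), nat \<Rightarrow> nat \<Rightarrow> diagram \<Rightarrow> complex) lincat" where
  "Rep_S_plus t = karoubi_envelope (Rep0_NC t)"

end

theory Submission
  imports Defs
begin

text \<open>
  Doubling every point turns non-crossing partitions into Temperley--Lieb diagrams on an even number of
  strands, with loop value \<open>t\<close> for loops around a block and 1 for the others. The Jones--Wenzl recursion
  \<open>p (m + 1) = p m - (1 / r m) p m U m p m\<close> runs as long as the ratios \<open>r (m + 1) = d (m + 1) - 1 / r m\<close> do
  not vanish. If none of them vanishes, the idempotents with an even number of strands have one-dimensional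
  endomorphism algebras, no morphisms between different ones, and every object is a sum of retracts of
  them; a category with such a family is semisimple after Karoubi completion. If \<open>r m = 0\<close>, then \<open>p m\<close> with
  a cup attached is a non-zero morphism \<open>x\<close> with \<open>y x = 0\<close> for all \<open>y\<close> in the opposite direction, which is
  impossible in a semisimple category. Solving the recursion with \<open>t = w + 1/w + 2\<close> shows that a ratio
  vanishes if and only if \<open>w \<noteq> 1\<close> is a root of unity.
\<close>

section \<open>Linear categories\<close>


text \<open>Under the usual normalization every loop has the value sqrt t. Distributing the loop
  values unevenly, as t on the odd and 1 on the even generators, is what stacking partitions
  produces, avoids a choice of root and covers t = 0; the recursion then depends on the parity of
  the index. The object with N points has 2 N strands, so only idempotents with an even number of
  strands become simple objects, but the recursion runs through all numbers of strands, and
  \<open>p m\<close> is taken in any endomorphism algebra with room for m strands. A zero of the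
  ratios can occur at either parity, and the annihilated morphism has to be built from partitions in
  both cases. Two facts about planar diagrams carry the argument. A diagram without caps has its
  upper points in different blocks, each with a lower point of its own; so a diagram with fewer
  lower than upper points has a cap and is killed by the idempotent on all strands. And all terms of
  \<open>p m\<close> except the identity begin with a generator, so one coefficient suffices to show
  that a morphism is not 0.\<close>

context linear_category
begin

sublocale V: vector_space "scl C"
  by (rule vector_space_scl)

lemma hom_zero [simp]: "X \<in> obj C \<Longrightarrow> Y \<in> obj C \<Longrightarrow> 0 \<in> hom C X Y"
  by (rule V.subspace_0[OF subspace_hom])

lemma hom_add:
  "X \<in> obj C \<Longrightarrow> Y \<in> obj C \<Longrightarrow> f \<in> hom C X Y \<Longrightarrow> g \<in> hom C X Y \<Longrightarrow> f + g \<in> hom C X Y"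
  by (rule V.subspace_add[OF subspace_hom])

lemma hom_scl: "X \<in> obj C \<Longrightarrow> Y \<in> obj C \<Longrightarrow> f \<in> hom C X Y \<Longrightarrow> scl C c f \<in> hom C X Y"
  by (rule V.subspace_scale[OF subspace_hom])

lemma hom_diff:
  "X \<in> obj C \<Longrightarrow> Y \<in> obj C \<Longrightarrow> f \<in> hom C X Y \<Longrightarrow> g \<in> hom C X Y \<Longrightarrow> f - g \<in> hom C X Y"
  by (rule V.subspace_diff[OF subspace_hom])

lemma hom_sum:
  assumes "X \<in> obj C" "Y \<in> obj C" "\<And>i. i \<in> I \<Longrightarrow> f i \<in> hom C X Y"
  shows "sum f I \<in> hom C X Y"
  using assms by (induction I rule: infinite_finite_induct) (auto intro: hom_add)

lemma cmp_zero_left [simp]: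
  assumes "X \<in> obj C" "Y \<in> obj C" "Z \<in> obj C" "f \<in> hom C X Y"
  shows "cmp C X Y Z 0 f = 0"
  using cmp_add_left[OF assms, of 0 0] assms by simp

lemma cmp_zero_right [simp]:
  assumes "X \<in> obj C" "Y \<in> obj C" "Z \<in> obj C" "g \<in> hom C Y Z"
  shows "cmp C X Y Z g 0 = 0"
  using cmp_add_right[OF assms(1-3) _ _ assms(4), of 0 0] assms by simp

lemma cmp_diff_left:
  assumes "X \<in> obj C" "Y \<in> obj C" "Z \<in> obj C" "f \<in> hom C X Y" "g \<in> hom C Y Z" "g' \<in> hom C Y Z"
  shows "cmp C X Y Z (g - g') f = cmp C X Y Z g f - cmp C X Y Z g' f"
  using cmp_add_left[OF assms(1-4) hom_diff[OF assms(2,3,5,6)] assms(6)] by (simp add: algebra_simps)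

lemma cmp_diff_right:
  assumes "X \<in> obj C" "Y \<in> obj C" "Z \<in> obj C" "f \<in> hom C X Y" "f' \<in> hom C X Y" "g \<in> hom C Y Z"
  shows "cmp C X Y Z g (f - f') = cmp C X Y Z g f - cmp C X Y Z g f'"
  using cmp_add_right[OF assms(1-3) hom_diff[OF assms(1,2,4,5)] assms(5,6)] by (simp add: algebra_simps)

lemma cmp_sum_left:
  assumes "X \<in> obj C" "Y \<in> obj C" "Z \<in> obj C" "f \<in> hom C X Y" "\<And>i. i \<in> I \<Longrightarrow> g i \<in> hom C Y Z"
  shows "cmp C X Y Z (sum g I) f = (\<Sum>i\<in>I. cmp C X Y Z (g i) f)"
  using assms
  by (induction I rule: infinite_finite_induct) (auto simp: cmp_add_left hom_sum)

lemma cmp_sum_right: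
  assumes "X \<in> obj C" "Y \<in> obj C" "Z \<in> obj C" "g \<in> hom C Y Z" "\<And>i. i \<in> I \<Longrightarrow> f i \<in> hom C X Y"
  shows "cmp C X Y Z g (sum f I) = (\<Sum>i\<in>I. cmp C X Y Z g (f i))"
  using assms
  by (induction I rule: infinite_finite_induct) (auto simp: cmp_add_right hom_sum)

end

section \<open>Additive and idempotent completions of linear categories\<close>

lemma obj_additive: "obj (additive_completion C) = {Xs. set Xs \<subseteq> obj C}"
  by (simp add: additive_completion_def)

lemma vector_space_funs:
  fixes s :: "complex \<Rightarrow> 'm::ab_group_add \<Rightarrow> 'm"
  assumes "vector_space s"
  shows "vector_space (\<lambda>c f (i::'i) (j::'j). s c (f i j))"
  using assms unfolding vector_space_def by (auto simp: fun_eq_iff)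

lemma linear_category_additive_completion:
  assumes "linear_category C"
  shows "linear_category (additive_completion C)"
proof -
  let ?A = "additive_completion C"
  interpret linear_category C by fact
  have o: "X ! i \<in> obj C" if "set X \<subseteq> obj C" "i < length X" for X i
    using that by auto
  show ?thesis
  proof (rule linear_category.intro)
    show vs: "vector_space (scl ?A)"
      unfolding additive_completion_def lincat.simps by (rule vector_space_funs[OF vector_space_scl])
    show "module.subspace (scl ?A) (hom ?A X Y)"
      if "X \<in> obj ?A" "Y \<in> obj ?A" for X Y
    proof -
      interpret W: vector_space "scl ?A" by (rule vs)
      show ?thesis using that
        by (intro W.subspaceI)
          (auto simp: additive_completion_def o hom_add hom_scl split: if_splits)
    qed
  next
    fix X assume "X \<in> obj ?A"
    then show "idm ?A X \<in> hom ?A X X"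
      by (auto simp: additive_completion_def o idm_hom)
  next
    fix X Y Z f g
    assume "X \<in> obj ?A" "Y \<in> obj ?A"
      "Z \<in> obj ?A" "f \<in> hom ?A X Y"
      "g \<in> hom ?A Y Z"
    then show "cmp ?A X Y Z g f \<in> hom ?A X Z"
      by (auto simp: additive_completion_def o intro!: hom_sum cmp_hom)
  next
    fix X Y f
    assume X: "X \<in> obj ?A" "Y \<in> obj ?A"
      "f \<in> hom ?A X Y"
    have *: "(\<Sum>j<length X. cmp C (X ! k) (X ! j) (Y ! i) (f i j)
        (if j = k then idm C (X ! j) else 0)) = f i k"
      if "i < length Y" "k < length X" for i k
    proof -
      have "(\<Sum>j<length X. cmp C (X ! k) (X ! j) (Y ! i) (f i j)
        (if j = k then idm C (X ! j) else 0)) =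
        (\<Sum>j<length X. if j = k then f i k else 0)"
        using X that by (intro sum.cong) (auto simp: additive_completion_def o cmp_idm)
      then show ?thesis using that by simp
    qed
    show "cmp ?A X X Y f (idm ?A X) = f"
      using X by (auto simp: additive_completion_def fun_eq_iff *)
    have *: "(\<Sum>j<length Y. cmp C (X ! k) (Y ! j) (Y ! i)
        (if i = j then idm C (Y ! i) else 0) (f j k)) = f i k"
      if "i < length Y" "k < length X" for i k
    proof -
      have "(\<Sum>j<length Y. cmp C (X ! k) (Y ! j) (Y ! i)
        (if i = j then idm C (Y ! i) else 0) (f j k)) =
        (\<Sum>j<length Y. if i = j then f i k else 0)"
        using X that by (intro sum.cong) (auto simp: additive_completion_def o idm_cmp)
      then show ?thesis using that by simp
    qed
    show "cmp ?A X Y Y (idm ?A Y) f = f"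
      using X by (auto simp: additive_completion_def fun_eq_iff *)
  next
    fix W X Y Z f g h
    assume X: "W \<in> obj ?A" "X \<in> obj ?A"
      "Y \<in> obj ?A" "Z \<in> obj ?A"
      "f \<in> hom ?A W X" "g \<in> hom ?A X Y"
      "h \<in> hom ?A Y Z"
    have *: "(\<Sum>j<length X. cmp C (W ! k) (X ! j) (Z ! i)
          (\<Sum>l<length Y. cmp C (X ! j) (Y ! l) (Z ! i) (h i l) (g l j)) (f j k)) =
        (\<Sum>l<length Y. cmp C (W ! k) (Y ! l) (Z ! i) (h i l)
          (\<Sum>j<length X. cmp C (W ! k) (X ! j) (Y ! l) (g l j) (f j k)))" (is "?l = ?r")
      if "i < length Z" "k < length W" for i k
    proof -
      have "?l = (\<Sum>j<length X. \<Sum>l<length Y. cmp C (W ! k) (X ! j) (Z ! i)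
          (cmp C (X ! j) (Y ! l) (Z ! i) (h i l) (g l j)) (f j k))"
        using X that
        by (intro sum.cong cmp_sum_left) (auto simp: additive_completion_def o intro!: cmp_hom)
      also have "\<dots> = (\<Sum>j<length X. \<Sum>l<length Y. cmp C (W ! k) (Y ! l) (Z ! i) (h i l)
          (cmp C (W ! k) (X ! j) (Y ! l) (g l j) (f j k)))"
        using X that by (intro sum.cong refl cmp_assoc) (auto simp: additive_completion_def o)
      also have "\<dots> = (\<Sum>l<length Y. \<Sum>j<length X. cmp C (W ! k) (Y ! l) (Z ! i) (h i l)
          (cmp C (W ! k) (X ! j) (Y ! l) (g l j) (f j k)))"
        by (rule sum.swap)
      also have "\<dots> = ?r"
        using X that
        by (intro sum.cong cmp_sum_right[symmetric])
          (auto simp: additive_completion_def o intro!: cmp_hom)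
      finally show ?thesis .
    qed
    show "cmp ?A W X Z (cmp ?A X Y Z h g) f =
      cmp ?A W Y Z h (cmp ?A W X Y g f)"
      using X by (auto simp: additive_completion_def fun_eq_iff *)
  next
    fix X Y Z f g g'
    assume X: "X \<in> obj ?A" "Y \<in> obj ?A"
      "Z \<in> obj ?A" "f \<in> hom ?A X Y"
      "g \<in> hom ?A Y Z" "g' \<in> hom ?A Y Z"
    then show "cmp ?A X Y Z (g + g') f =
        cmp ?A X Y Z g f + cmp ?A X Y Z g' f"
      by (auto simp: additive_completion_def fun_eq_iff o sum.distrib[symmetric]
          intro!: sum.cong cmp_add_left)
  next
    fix X Y Z f f' g
    assume X: "X \<in> obj ?A" "Y \<in> obj ?A"
      "Z \<in> obj ?A" "f \<in> hom ?A X Y"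
      "f' \<in> hom ?A X Y" "g \<in> hom ?A Y Z"
    then show "cmp ?A X Y Z g (f + f') =
        cmp ?A X Y Z g f + cmp ?A X Y Z g f'"
      by (auto simp: additive_completion_def fun_eq_iff o sum.distrib[symmetric]
          intro!: sum.cong cmp_add_right)
  next
    fix X Y Z f g c
    assume X: "X \<in> obj ?A" "Y \<in> obj ?A"
      "Z \<in> obj ?A" "f \<in> hom ?A X Y"
      "g \<in> hom ?A Y Z"
    show "cmp ?A X Y Z (scl ?A c g) f =
        scl ?A c (cmp ?A X Y Z g f)"
      using X by (auto simp: additive_completion_def fun_eq_iff o V.scale_sum_right
          intro!: sum.cong cmp_scl_left)
    show "cmp ?A X Y Z g (scl ?A c f) =
        scl ?A c (cmp ?A X Y Z g f)"
      using X by (auto simp: additive_completion_def fun_eq_iff o V.scale_sum_right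
          intro!: sum.cong cmp_scl_right)
  qed
qed

lemma linear_category_idempotent_completion:
  assumes "linear_category C"
  shows "linear_category (idempotent_completion C)"
proof -
  let ?I = "idempotent_completion C"
  interpret linear_category C by fact
  show ?thesis
  proof (rule linear_category.intro)
    show vs: "vector_space (scl ?I)"
      using vector_space_scl by (simp add: idempotent_completion_def)
  next
    fix X Y assume X: "X \<in> obj ?I" "Y \<in> obj ?I"
    show "module.subspace (scl ?I) (hom ?I X Y)"
      using X
      by (auto intro!: V.subspaceI simp: idempotent_completion_def hom_add hom_scl cmp_add_left cmp_add_right
          cmp_scl_left cmp_scl_right)
  next
    fix X Y Z f g
    assume X: "X \<in> obj ?I" "Y \<in> obj ?I"
      "Z \<in> obj ?I" "f \<in> hom ?I X Y"
      "g \<in> hom ?I Y Z"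
    obtain X' e Y' e' Z' e'' where eq: "X = (X', e)" "Y = (Y', e')" "Z = (Z', e'')"
      by (cases X, cases Y, cases Z) auto
    show "cmp ?I X Y Z g f \<in> hom ?I X Z"
      using X unfolding eq
      by (auto simp: idempotent_completion_def cmp_hom cmp_assoc)
        (metis cmp_assoc)
  qed (auto simp: idempotent_completion_def cmp_assoc cmp_add_left cmp_add_right
          cmp_scl_left cmp_scl_right)
qed

section \<open>Biproducts and direct sums\<close>

definition is_biproduct ::
    "('o, 'm::ab_group_add) lincat \<Rightarrow> 'o \<Rightarrow> 'o \<Rightarrow> 'o \<Rightarrow> 'm \<Rightarrow> 'm \<Rightarrow> 'm \<Rightarrow> 'm \<Rightarrow> bool" where
  "is_biproduct C X Y S i1 p1 i2 p2 \<longleftrightarrow> X \<in> obj C \<and> Y \<in> obj C \<and> S \<in> obj C \<and>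
     i1 \<in> hom C X S \<and> p1 \<in> hom C S X \<and> i2 \<in> hom C Y S \<and> p2 \<in> hom C S Y \<and>
     cmp C X S X p1 i1 = idm C X \<and> cmp C Y S Y p2 i2 = idm C Y \<and>
     cmp C Y S X p1 i2 = 0 \<and> cmp C X S Y p2 i1 = 0 \<and>
     cmp C S X S i1 p1 + cmp C S Y S i2 p2 = idm C S"

context linear_category
begin

lemma is_direct_sum_Nil: "Z \<in> obj C \<Longrightarrow> idm C Z = 0 \<Longrightarrow> is_direct_sum C [] Z"
  by (simp add: is_direct_sum_def)

text \<open>A direct sum is extended one summand at a time: the structure maps of the old summands
  pass through \<open>S\<close>, and the idempotent of the new summand completes their sum to the
  identity of \<open>T\<close>.\<close>

lemma is_direct_sum_Cons:
  assumes S: "is_direct_sum C Xs S" and b: "is_biproduct C X S T i1 p1 i2 p2"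
  shows "is_direct_sum C (X # Xs) T"
proof -
  from S obtain \<iota> \<pi> where Xs: "set Xs \<subseteq> obj C" and S: "S \<in> obj C"
    and hom: "\<And>i. i < length Xs \<Longrightarrow> \<iota> i \<in> hom C (Xs ! i) S"
      "\<And>i. i < length Xs \<Longrightarrow> \<pi> i \<in> hom C S (Xs ! i)"
    and orth: "\<And>i j. i < length Xs \<Longrightarrow> j < length Xs \<Longrightarrow>
      cmp C (Xs ! j) S (Xs ! i) (\<pi> i) (\<iota> j) = (if i = j then idm C (Xs ! i) else 0)"
    and sum: "(\<Sum>i<length Xs. cmp C S (Xs ! i) S (\<iota> i) (\<pi> i)) = idm C S"
    unfolding is_direct_sum_def by blast
  from b have X: "X \<in> obj C" "T \<in> obj C" and bh: "i1 \<in> hom C X T" "p1 \<in> hom C T X"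
    "i2 \<in> hom C S T" "p2 \<in> hom C T S"
    and be: "cmp C X T X p1 i1 = idm C X" "cmp C S T S p2 i2 = idm C S"
      "cmp C S T X p1 i2 = 0" "cmp C X T S p2 i1 = 0"
      "cmp C T X T i1 p1 + cmp C T S T i2 p2 = idm C T"
    unfolding is_biproduct_def by auto
  have o: "Xs ! i \<in> obj C" if "i < length Xs" for i using Xs that by auto
  define \<iota>' where "\<iota>' i = (case i of 0 \<Rightarrow> i1 | Suc i \<Rightarrow> cmp C (Xs ! i) S T i2 (\<iota> i))" for i
  define \<pi>' where "\<pi>' i = (case i of 0 \<Rightarrow> p1 | Suc i \<Rightarrow> cmp C T S (Xs ! i) (\<pi> i) p2)" for i
  have h': "\<iota>' i \<in> hom C ((X # Xs) ! i) T \<and> \<pi>' i \<in> hom C T ((X # Xs) ! i)"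
    if "i < length (X # Xs)" for i
    using that X S bh hom o by (cases i) (auto simp: \<iota>'_def \<pi>'_def intro!: cmp_hom)
  have e1: "cmp C (Xs ! j) T S p2 (cmp C (Xs ! j) S T i2 (\<iota> j)) = \<iota> j" if "j < length Xs" for j
    using that X S bh hom o by (simp add: cmp_assoc[symmetric] be idm_cmp)
  have e2: "cmp C (Xs ! j) T X p1 (cmp C (Xs ! j) S T i2 (\<iota> j)) = 0" if "j < length Xs" for j
    using that X S bh hom o by (simp add: cmp_assoc[symmetric] be)
  have orth': "cmp C ((X # Xs) ! j) T ((X # Xs) ! i) (\<pi>' i) (\<iota>' j) =
      (if i = j then idm C ((X # Xs) ! i) else 0)"
    if "i < length (X # Xs)" "j < length (X # Xs)" for i j
    using that X S bh hom o
    by (cases i; cases j) (auto simp: \<iota>'_def \<pi>'_def be e1 e2 orth cmp_assoc cmp_hom)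
  have "cmp C T (Xs ! i) T (cmp C (Xs ! i) S T i2 (\<iota> i)) (cmp C T S (Xs ! i) (\<pi> i) p2) =
     cmp C T S T i2 (cmp C T S S (cmp C S (Xs ! i) S (\<iota> i) (\<pi> i)) p2)" if "i < length Xs" for i
    using that X S bh hom o by (simp add: cmp_assoc cmp_hom)
  then have "(\<Sum>i<length Xs. cmp C T (Xs ! i) T (cmp C (Xs ! i) S T i2 (\<iota> i)) (cmp C T S (Xs ! i) (\<pi> i) p2))
     = (\<Sum>i<length Xs. cmp C T S T i2 (cmp C T S S (cmp C S (Xs ! i) S (\<iota> i) (\<pi> i)) p2))"
    by simp
  also have "\<dots> = cmp C T S T i2 (cmp C T S S (\<Sum>i<length Xs. cmp C S (Xs ! i) S (\<iota> i) (\<pi> i)) p2)"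
    using X S bh hom o
    by (subst cmp_sum_left, auto intro!: cmp_hom, subst cmp_sum_right, auto intro!: cmp_hom)
  also have "\<dots> = cmp C T S T i2 p2"
    using X S bh by (simp add: sum idm_cmp)
  finally have "(\<Sum>i<length (X # Xs). cmp C T ((X # Xs) ! i) T (\<iota>' i) (\<pi>' i)) = idm C T"
    by (simp add: sum.lessThan_Suc_shift \<iota>'_def \<pi>'_def be[symmetric] del: sum.lessThan_Suc)
  then show ?thesis
    using h' orth' X Xs unfolding is_direct_sum_def by (intro conjI exI[of _ \<iota>'] exI[of _ \<pi>']) auto
qed

lemma is_zero_object_iff: "X \<in> obj C \<Longrightarrow> is_zero_object C X \<longleftrightarrow> idm C X = 0"
proof
  assume X: "X \<in> obj C" "is_zero_object C X"
  then show "idm C X = 0"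
    unfolding is_zero_object_def using idm_hom[of X] hom_zero[of X X] by blast
next
  assume X: "X \<in> obj C" "idm C X = 0"
  have "f = 0" if "f \<in> hom C X Y" "Y \<in> obj C" for f Y
    using cmp_idm[OF X(1) that(2,1)] X that by simp
  moreover have "f = 0" if "f \<in> hom C Y X" "Y \<in> obj C" for f Y
    using idm_cmp[OF that(2) X(1) that(1)] X that by simp
  ultimately show "is_zero_object C X"
    unfolding is_zero_object_def using X by (metis hom_zero)
qed

text \<open>Only \<open>h u\<close>, \<open>r i\<close> and the sum of \<open>u h\<close> and
  \<open>i r\<close> are prescribed; the vanishing of \<open>h i\<close> and \<open>r u\<close>
  follows. Since \<open>i r = 1 - u h\<close> fixes \<open>i\<close>, one gets
  \<open>u h i = 0\<close>, and \<open>u\<close> cancels against its left inverse; the other case is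
  dual.\<close>

lemma biproduct_split:
  assumes X: "X \<in> obj C" "A \<in> obj C" "Z \<in> obj C"
    and u: "u \<in> hom C A X" "h \<in> hom C X A" "cmp C A X A h u = idm C A"
    and z: "i \<in> hom C Z X" "r \<in> hom C X Z" "cmp C Z X Z r i = idm C Z"
      "cmp C X Z X i r = idm C X - cmp C X A X u h"
  shows "is_biproduct C A Z X u h i r"
proof -
  have "cmp C Z X X (cmp C X Z X i r) i = i"
    using X u z(1-3) by (simp add: cmp_assoc cmp_idm)
  then have "cmp C Z A X u (cmp C Z X A h i) = 0"
    using X u z(1,2) by (simp add: z(4) cmp_diff_left cmp_hom idm_hom idm_cmp cmp_assoc)
  then have "cmp C Z X A h (cmp C Z A X u (cmp C Z X A h i)) = 0"
    using X u by simp
  then have 1: "cmp C Z X A h i = 0"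
    using X u z by (simp add: cmp_assoc[symmetric] cmp_hom idm_cmp)
  have "cmp C X X Z r (cmp C X Z X i r) = r"
    using X u z(1-3) by (simp add: cmp_assoc[symmetric] idm_cmp)
  then have "cmp C X A Z (cmp C A X Z r u) h = 0"
    using X u z(1,2) by (simp add: z(4) cmp_diff_right cmp_hom idm_hom cmp_idm cmp_assoc)
  then have "cmp C A X Z (cmp C X A Z (cmp C A X Z r u) h) u = 0"
    using X u by simp
  then have 2: "cmp C A X Z r u = 0"
    using X u z by (simp add: cmp_assoc cmp_hom cmp_idm)
  show ?thesis
    unfolding is_biproduct_def using X u z 1 2 by simp
qed

end

section \<open>The ideal of morphisms generated by a family of objects\<close>

inductive factors ::
    "('o, 'm::ab_group_add) lincat \<Rightarrow> ('i \<Rightarrow> 'o) \<Rightarrow> 'o \<Rightarrow> 'o \<Rightarrow> 'm \<Rightarrow> bool" for C V X Y where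
  zero: "factors C V X Y 0"
| step: "factors C V X Y h \<Longrightarrow> x \<in> hom C (V n) Y \<Longrightarrow> y \<in> hom C X (V n) \<Longrightarrow>
    factors C V X Y (h + cmp C X (V n) Y x y)"

context linear_category
begin

lemma factors_add:
  assumes "factors C V X Y g" "factors C V X Y h"
  shows "factors C V X Y (g + h)"
  using assms(2,1) by (induction) (auto simp: add.assoc[symmetric] intro: factors.intros)

lemma factors_hom:
  assumes "factors C V X Y h" "X \<in> obj C" "Y \<in> obj C" "range V \<subseteq> obj C"
  shows "h \<in> hom C X Y"
  using assms by (induction) (auto intro!: hom_add cmp_hom)

lemma factors_cmp:
  assumes "factors C V X Y h" and X: "W \<in> obj C" "X \<in> obj C" "Y \<in> obj C" "Z \<in> obj C"
    and V: "range V \<subseteq> obj C"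
    and f: "f \<in> hom C W X" "g \<in> hom C Y Z"
  shows "factors C V W Z (cmp C W Y Z g (cmp C W X Y h f))"
  using assms(1)
proof (induction)
  case zero
  show ?case using X f by (simp add: factors.zero)
next
  case (step h x n y)
  have V: "V n \<in> obj C" using V by auto
  have h: "h \<in> hom C X Y" using factors_hom step.hyps(1) X assms(6) by blast
  have "cmp C W Y Z g (cmp C W X Y (h + cmp C X (V n) Y x y) f) =
    cmp C W Y Z g (cmp C W X Y h f) + cmp C W (V n) Z (cmp C (V n) Y Z g x) (cmp C W X (V n) y f)"
    using V X f h step by (simp add: cmp_add_left cmp_add_right cmp_hom cmp_assoc)
  then show ?case
    using step V X f by (auto intro!: factors.step cmp_hom)
qed

lemma factors_sumD:
  assumes "factors C V X Y h"
  shows "\<exists>r n x y. (\<forall>i<r. x i \<in> hom C (V (n i)) Y \<and> y i \<in> hom C X (V (n i))) \<and>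
    h = (\<Sum>i<(r::nat). cmp C X (V (n i)) Y (x i) (y i))"
  using assms
proof (induction)
  case zero
  show ?case by (intro exI[of _ 0]) auto
next
  case (step h x0 n0 y0)
  then obtain r n x y where *: "\<forall>i<r. x i \<in> hom C (V (n i)) Y \<and> y i \<in> hom C X (V (n i))"
    "h = (\<Sum>i<(r::nat). cmp C X (V (n i)) Y (x i) (y i))" by blast
  show ?case
    using * step.hyps
    by (intro exI[of _ "Suc r"] exI[of _ "n(r := n0)"] exI[of _ "x(r := x0)"] exI[of _ "y(r := y0)"])
      (auto simp: less_Suc_eq)
qed

end

text \<open>A Karoubian additive category with objects \<open>V n\<close> that behave like pairwise
  non-isomorphic simple objects with scalar endomorphisms. Schur's lemma is assumed in the form of
  \<open>V_orth\<close> and \<open>V_end\<close>, and \<open>idm_factors\<close> says that every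
  object is a retract of a finite sum of objects \<open>V n\<close>. Diagrams do not enter.\<close>

locale split_category = linear_category C for C :: "('o, 'm::ab_group_add) lincat" +
  fixes V :: "'i \<Rightarrow> 'o"
  assumes split: "\<And>X e. X \<in> obj C \<Longrightarrow> e \<in> hom C X X \<Longrightarrow> cmp C X X X e e = e \<Longrightarrow>
      \<exists>Z\<in>obj C. \<exists>i\<in>hom C Z X. \<exists>r\<in>hom C X Z. cmp C Z X Z r i = idm C Z \<and> cmp C X Z X i r = e"
    and zero_obj: "\<exists>Z\<in>obj C. idm C Z = 0"
    and biproduct: "\<And>X Y. X \<in> obj C \<Longrightarrow> Y \<in> obj C \<Longrightarrow>
      \<exists>S i1 p1 i2 p2. is_biproduct C X Y S i1 p1 i2 p2"
    and V_obj: "V n \<in> obj C"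
    and V_nonzero: "idm C (V n) \<noteq> 0"
    and V_orth: "m \<noteq> n \<Longrightarrow> f \<in> hom C (V m) (V n) \<Longrightarrow> f = 0"
    and V_end: "f \<in> hom C (V n) (V n) \<Longrightarrow> \<exists>c. f = scl C c (idm C (V n))"
    and idm_factors: "X \<in> obj C \<Longrightarrow> factors C V X X (idm C X)"
begin

text \<open>The presentation of \<open>idm C X\<close> is indexed by an arbitrary finite set, since
  the inductions below delete one index and keep the names of the others.\<close>

definition fin where
  "fin X I n x y \<longleftrightarrow> finite (I::nat set) \<and> (\<forall>i\<in>I. x i \<in> hom C (V (n i)) X \<and> y i \<in> hom C X (V (n i))) \<and>
    idm C X = (\<Sum>i\<in>I. cmp C X (V (n i)) X (x i) (y i))"

lemma ex_fin: "X \<in> obj C \<Longrightarrow> \<exists>I n x y. fin X I n x y"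
proof -
  assume "X \<in> obj C"
  then obtain r n x y where "\<forall>i<r. x i \<in> hom C (V (n i)) X \<and> y i \<in> hom C X (V (n i))"
    "idm C X = (\<Sum>i<(r::nat). cmp C X (V (n i)) X (x i) (y i))"
    using factors_sumD[OF idm_factors] by blast
  then have "fin X {..<r} n x y" by (auto simp: fin_def)
  then show ?thesis by blast
qed

text \<open>When \<open>idm C X\<close> is expanded as a sum of composites of \<open>x i\<close> and
  \<open>y i\<close>, some \<open>y i u\<close> is non-zero. By \<open>V_orth\<close> it is an
  endomorphism of \<open>V n\<close> and by \<open>V_end\<close> a non-zero scalar, so a multiple of
  \<open>y i\<close> inverts \<open>u\<close> from the left.\<close>

lemma left_inverse:
  assumes X: "X \<in> obj C" and u: "u \<in> hom C (V n) X" "u \<noteq> 0"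
  shows "\<exists>h\<in>hom C X (V n). cmp C (V n) X (V n) h u = idm C (V n)"
proof -
  obtain I m x y where f: "fin X I m x y" using ex_fin X by blast
  have "u = cmp C (V n) X X (idm C X) u"
    using X u V_obj by (simp add: idm_cmp)
  also have "\<dots> = (\<Sum>i\<in>I. cmp C (V n) X X (cmp C X (V (m i)) X (x i) (y i)) u)"
    using X u V_obj f by (auto simp: fin_def intro!: cmp_sum_left cmp_hom)
  also have "\<dots> = (\<Sum>i\<in>I. cmp C (V n) (V (m i)) X (x i) (cmp C (V n) X (V (m i)) (y i) u))"
    using X u V_obj f by (auto simp: fin_def cmp_assoc intro!: sum.cong)
  finally obtain i where i: "i \<in> I" "cmp C (V n) (V (m i)) X (x i) (cmp C (V n) X (V (m i)) (y i) u) \<noteq> 0"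
    using u(2) by (metis (no_types, lifting) sum.neutral)
  let ?w = "cmp C (V n) X (V (m i)) (y i) u"
  have w0: "?w \<noteq> 0" using i f X V_obj by (auto simp: fin_def)
  have w: "?w \<in> hom C (V n) (V (m i))" using i f X u V_obj by (auto simp: fin_def intro: cmp_hom)
  have n: "m i = n" using V_orth w w0 by metis
  obtain c where c: "?w = scl C c (idm C (V n))" using w n V_end by metis
  have "c \<noteq> 0" using c w0 by auto
  have y: "y i \<in> hom C X (V n)" using f i n by (auto simp: fin_def)
  have "cmp C (V n) X (V n) (scl C (1 / c) (y i)) u = scl C (1/c) (cmp C (V n) X (V n) (y i) u)"
    using X y u V_obj by (simp add: cmp_scl_left)
  also have "\<dots> = idm C (V n)" using c n \<open>c \<noteq> 0\<close> by simp
  finally show ?thesis using hom_scl[OF X V_obj y] by blast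
qed

text \<open>Compressing the presentation of \<open>idm C X\<close> to the complement
  \<open>Z\<close> replaces each \<open>x k\<close> by its composite with \<open>r\<close>. The term
  of index \<open>i\<close> disappears because \<open>r\<close> kills \<open>x i\<close>, so
  \<open>Z\<close> has one term less and is accessible to induction.\<close>

lemma split_off:
  assumes X: "X \<in> obj C" and f: "fin X I n x y" and i: "i \<in> I"
    and h: "h \<in> hom C X (V (n i))" "cmp C (V (n i)) X (V (n i)) h (x i) = idm C (V (n i))"
  obtains Z j r where "is_biproduct C (V (n i)) Z X (x i) h j r"
    "\<exists>x y. fin Z (I - {i}) n x y"
proof -
  let ?A = "V (n i)" and ?p = "idm C X - cmp C X (V (n i)) X (x i) h"
  have xi: "x i \<in> hom C ?A X" using f i by (auto simp: fin_def)
  have A: "?A \<in> obj C" by (rule V_obj)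
  have xh: "cmp C X ?A X (x i) h \<in> hom C X X" using X A xi h cmp_hom by blast
  have e: "cmp C X X X (cmp C X ?A X (x i) h) (cmp C X ?A X (x i) h) = cmp C X ?A X (x i) h"
  proof -
    have "cmp C X X X (cmp C X ?A X (x i) h) (cmp C X ?A X (x i) h) =
      cmp C X ?A X (x i) (cmp C X ?A ?A (cmp C ?A X ?A h (x i)) h)"
      using X A xi h(1) by (simp add: cmp_assoc cmp_hom)
    then show ?thesis using X A xi h by (simp add: idm_cmp)
  qed
  have p: "?p \<in> hom C X X" "cmp C X X X ?p ?p = ?p"
    using X xh e by (auto simp: hom_diff idm_hom cmp_diff_left cmp_diff_right idm_cmp cmp_idm)
  then obtain Z j r where Z: "Z \<in> obj C" "j \<in> hom C Z X" "r \<in> hom C X Z"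
    "cmp C Z X Z r j = idm C Z" "cmp C X Z X j r = ?p" using split[OF X p] by blast
  have b: "is_biproduct C ?A Z X (x i) h j r"
    using X A Z xi h by (intro biproduct_split) auto
  have rx: "cmp C ?A X Z r (x i) = 0" using b by (simp add: is_biproduct_def)
  define x' where "x' k = cmp C (V (n k)) X Z r (x k)" for k
  define y' where "y' k = cmp C Z X (V (n k)) (y k) j" for k
  have "cmp C Z X Z r (cmp C Z X X (idm C X) j) = idm C Z"
    using Z X by (simp add: idm_cmp)
  moreover have "cmp C Z X Z r (cmp C Z X X (idm C X) j) =
    (\<Sum>k\<in>I. cmp C Z X Z r (cmp C Z X X (cmp C X (V (n k)) X (x k) (y k)) j))"
  proof -
    have "cmp C Z X X (idm C X) j = (\<Sum>k\<in>I. cmp C Z X X (cmp C X (V (n k)) X (x k) (y k)) j)"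
      using f Z X V_obj by (auto simp: fin_def intro!: cmp_sum_left cmp_hom)
    then show ?thesis using f Z X V_obj by (auto simp: fin_def intro!: cmp_sum_right cmp_hom)
  qed
  moreover have "\<dots> = (\<Sum>k\<in>I. cmp C Z (V (n k)) Z (x' k) (y' k))"
    using f Z X V_obj by (auto simp: fin_def x'_def y'_def cmp_assoc cmp_hom intro!: sum.cong)
  moreover have "cmp C Z (V (n i)) Z (x' i) (y' i) = 0"
    using f i Z X V_obj by (auto simp: x'_def y'_def rx fin_def cmp_hom)
  ultimately have "idm C Z = (\<Sum>k\<in>I - {i}. cmp C Z (V (n k)) Z (x' k) (y' k))"
    using f i by (simp add: fin_def sum.remove)
  then have "fin Z (I - {i}) n x' y'"
    using f Z X V_obj by (auto simp: fin_def x'_def y'_def intro!: cmp_hom)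
  then show ?thesis using that b by blast
qed

lemma fin_remove_zero:
  assumes "fin X I n x y" "i \<in> I" "x i = 0" "X \<in> obj C"
  shows "fin X (I - {i}) n x y"
  using assms V_obj by (auto simp: fin_def sum.remove)

lemma decompose:
  assumes "X \<in> obj C"
  shows "\<exists>ns. is_direct_sum C (map V ns) X"
proof -
  have "\<exists>ns. is_direct_sum C (map V ns) X" if "fin X I n x y" "X \<in> obj C" for X I n x y
    using that
  proof (induction "card I" arbitrary: X I n x y)
    case 0
    then have "idm C X = 0" by (auto simp: fin_def)
    then show ?case using is_direct_sum_Nil[of X] 0 by (intro exI[of _ "[]"]) auto
  next
    case (Suc c)
    then obtain i where i: "i \<in> I" by fastforce
    have c: "c = card (I - {i})" using Suc i by (auto simp: fin_def)
    show ?case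
    proof (cases "x i = 0")
      case True
      then show ?thesis using Suc.hyps(1)[OF c fin_remove_zero[OF Suc.prems(1) i True]] Suc.prems by auto
    next
      case False
      have "x i \<in> hom C (V (n i)) X" using Suc.prems i by (auto simp: fin_def)
      then obtain h where "h \<in> hom C X (V (n i))" "cmp C (V (n i)) X (V (n i)) h (x i) = idm C (V (n i))"
        using left_inverse False Suc.prems by blast
      then obtain Z j r x' y' where b: "is_biproduct C (V (n i)) Z X (x i) h j r"
        and "fin Z (I - {i}) n x' y'"
        using split_off[OF Suc.prems(2,1) i] by metis
      then obtain ns where "is_direct_sum C (map V ns) Z"
        using Suc.hyps(1)[OF c] unfolding is_biproduct_def by blast
      from is_direct_sum_Cons[OF this b] show ?thesis by (metis list.simps(9))
    qed
  qed
  then show ?thesis using ex_fin assms by blast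
qed

text \<open>A non-zero \<open>Y\<close> has some \<open>x i\<close> different from 0, and a
  monomorphism \<open>f\<close> does not kill it. The composite is then a non-zero scalar, so
  \<open>f\<close> has a right inverse, and a monomorphism with a right inverse is
  invertible.\<close>

lemma V_simple: "is_simple C (V n)"
  unfolding is_simple_def
proof (intro conjI ballI allI impI)
  show "V n \<in> obj C" by (rule V_obj)
  show "\<not> is_zero_object C (V n)" using is_zero_object_iff V_obj V_nonzero by blast
  fix Y f assume Y: "Y \<in> obj C" and f: "is_mono C Y (V n) f"
  have fh: "f \<in> hom C Y (V n)" using f by (simp add: is_mono_def)
  show "is_zero_object C Y \<or> is_iso C Y (V n) f"
  proof (cases "idm C Y = 0")
    case True then show ?thesis using is_zero_object_iff Y by blast
  next
    case False
    obtain I m x y where fin: "fin Y I m x y" using ex_fin Y by blast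
    have "\<exists>i\<in>I. x i \<noteq> 0"
    proof (rule ccontr)
      assume "\<not> (\<exists>i\<in>I. x i \<noteq> 0)"
      then have "idm C Y = (\<Sum>i\<in>I. 0)"
        using fin Y V_obj unfolding fin_def by (auto intro!: sum.neutral)
      then show False using False by simp
    qed
    then obtain i where i: "i \<in> I" "x i \<noteq> 0" by blast
    have xi: "x i \<in> hom C (V (m i)) Y" using fin i by (auto simp: fin_def)
    have "cmp C (V (m i)) Y (V n) f (x i) \<noteq> 0"
    proof
      assume "cmp C (V (m i)) Y (V n) f (x i) = 0"
      then have "cmp C (V (m i)) Y (V n) f (x i) = cmp C (V (m i)) Y (V n) f 0"
        using V_obj Y fh by simp
      then show False using f V_obj xi i Y unfolding is_mono_def by (metis hom_zero)
    qed
    moreover have h: "cmp C (V (m i)) Y (V n) f (x i) \<in> hom C (V (m i)) (V n)"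
      using xi fh Y V_obj cmp_hom by blast
    ultimately have m: "m i = n" using V_orth by metis
    obtain c where c: "cmp C (V n) Y (V n) f (x i) = scl C c (idm C (V n))" using h m V_end by metis
    have "c \<noteq> 0" using c m \<open>cmp C (V (m i)) Y (V n) f (x i) \<noteq> 0\<close> by auto
    define g where "g = scl C (1/c) (x i)"
    have g: "g \<in> hom C (V n) Y" using xi m V_obj Y by (auto simp: g_def hom_scl)
    have fg: "cmp C (V n) Y (V n) f g = idm C (V n)"
      using c \<open>c \<noteq> 0\<close> xi m V_obj Y fh by (simp add: g_def cmp_scl_right)
    have "cmp C Y Y (V n) f (cmp C Y (V n) Y g f) = cmp C Y Y (V n) f (idm C Y)"
      using fg fh g V_obj Y by (simp add: cmp_assoc[symmetric] idm_cmp cmp_idm)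
    then have "cmp C Y (V n) Y g f = idm C Y"
      using f Y g fh V_obj unfolding is_mono_def by (meson cmp_hom idm_hom)
    then show ?thesis unfolding is_iso_def using fh g fg by blast
  qed
qed

text \<open>Von Neumann regularity. Together with the splitting of idempotents it yields the abelian
  structure: \<open>1 - g f\<close> projects to the kernel of \<open>f\<close>, and
  \<open>1 - f g\<close> to its cokernel. The morphism \<open>g\<close> is assembled by splitting
  off, one at a time, copies of some \<open>V n\<close> on which \<open>f\<close> has a left
  inverse.\<close>

lemma regular:
  assumes "X \<in> obj C" "Y \<in> obj C" "f \<in> hom C X Y"
  shows "\<exists>g\<in>hom C Y X. cmp C X X Y f (cmp C X Y X g f) = f"
proof -
  have "\<exists>g\<in>hom C Y X. cmp C X X Y f (cmp C X Y X g f) = f"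
    if "fin X I n x y" "X \<in> obj C" "f \<in> hom C X Y" for X I n x y f
    using that
  proof (induction "card I" arbitrary: X I n x y f)
    case 0
    then have "idm C X = 0" by (auto simp: fin_def)
    then have "f = 0" using cmp_idm[of X Y f] 0 assms(2) by simp
    then show ?case using 0 assms(2) by (intro bexI[of _ 0]) auto
  next
    case (Suc k)
    note X = Suc.prems(2) and f = Suc.prems(3) and fin = Suc.prems(1) and Y = assms(2)
    show ?case
    proof (cases "f = 0")
      case True then show ?thesis using X Y by (intro bexI[of _ 0]) auto
    next
      case False
      have "f = cmp C X X Y f (idm C X)" using X Y f by (simp add: cmp_idm)
      also have "\<dots> = (\<Sum>i\<in>I. cmp C X X Y f (cmp C X (V (n i)) X (x i) (y i)))"
        using X Y V_obj f fin by (auto simp: fin_def intro!: cmp_sum_right cmp_hom)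
      also have "\<dots> = (\<Sum>i\<in>I. cmp C X (V (n i)) Y (cmp C (V (n i)) X Y f (x i)) (y i))"
        using X Y V_obj f fin by (auto simp: fin_def cmp_assoc intro!: sum.cong)
      finally obtain i where i: "i \<in> I" "cmp C X (V (n i)) Y (cmp C (V (n i)) X Y f (x i)) (y i) \<noteq> 0"
        using False by (metis (no_types, lifting) sum.neutral)
      let ?A = "V (n i)" and ?u = "cmp C (V (n i)) X Y f (x i)"
      have A: "?A \<in> obj C" by (rule V_obj)
      have xy: "x i \<in> hom C ?A X" "y i \<in> hom C X ?A" using fin i by (auto simp: fin_def)
      have "?u \<noteq> 0" using i X Y A xy by auto
      moreover have u: "?u \<in> hom C ?A Y" using X Y A xy f cmp_hom by blast
      ultimately obtain h where h: "h \<in> hom C Y ?A" "cmp C ?A Y ?A h ?u = idm C ?A"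
        using left_inverse Y by blast
      \<comment> \<open>With \<open>h f\<close> as the projection to the summand, \<open>f\<close>
        becomes block diagonal: the complement \<open>Z\<close> is mapped into the kernel of
        \<open>h\<close>.\<close>
      define hf where "hf = cmp C X Y ?A h f"
      have hf: "hf \<in> hom C X ?A" "cmp C ?A X ?A hf (x i) = idm C ?A"
        using X Y A h xy f by (auto simp: hf_def cmp_hom cmp_assoc)
      obtain Z j r x' y' where b: "is_biproduct C ?A Z X (x i) hf j r"
        and "fin Z (I - {i}) n x' y'"
        using split_off[OF X fin i(1) hf] by metis
      moreover have "k = card (I - {i})" using Suc i by (auto simp: fin_def)
      ultimately have IH: "\<exists>g\<in>hom C Y Z. cmp C Z Z Y f' (cmp C Z Y Z g f') = f'"
        if "f' \<in> hom C Z Y" for f' using Suc.hyps(1)[of "I - {i}" Z] that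
        unfolding is_biproduct_def by blast
      have Z: "Z \<in> obj C" "j \<in> hom C Z X" "r \<in> hom C X Z"
        "cmp C Z X Z r j = idm C Z" "cmp C ?A X Z r (x i) = 0" "cmp C Z X ?A hf j = 0"
        and id: "cmp C X ?A X (x i) hf + cmp C X Z X j r = idm C X"
        using b by (auto simp: is_biproduct_def)
      define f' where "f' = cmp C Z X Y f j"
      have f': "f' \<in> hom C Z Y" using X Y Z f by (auto simp: f'_def cmp_hom)
      obtain g' where g': "g' \<in> hom C Y Z" "cmp C Z Z Y f' (cmp C Z Y Z g' f') = f'"
        using IH[OF f'] by blast
      have hf': "cmp C Z Y ?A h f' = 0"
        using Z X Y A h f by (simp add: f'_def cmp_assoc[symmetric] hf_def[symmetric])
      have fdec: "f = cmp C X ?A Y ?u hf + cmp C X Z Y f' r"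
      proof -
        have "f = cmp C X X Y f (cmp C X ?A X (x i) hf + cmp C X Z X j r)"
          using X Y f by (simp add: id cmp_idm)
        then show ?thesis
          using X Y A f Z hf xy by (simp add: cmp_add_right cmp_hom cmp_assoc f'_def)
      qed
      \<comment> \<open>This projection annihilates the block \<open>?u\<close> and fixes
        \<open>f'\<close>, so inserting it before \<open>g'\<close> lets \<open>g'\<close> act on
        the remaining block only.\<close>
      define w where "w = idm C Y - cmp C Y ?A Y ?u h"
      have w: "w \<in> hom C Y Y" using Y A u h by (auto simp: w_def hom_diff idm_hom cmp_hom)
      have wf': "cmp C Z Y Y w f' = f'"
        using Y A u h f' Z hf' by (simp add: w_def cmp_diff_left idm_hom cmp_hom idm_cmp cmp_assoc)
      have "cmp C ?A Y Y (cmp C Y ?A Y ?u h) ?u = ?u"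
        using Y A u h by (simp add: cmp_assoc cmp_idm)
      then have wu: "cmp C ?A Y Y w ?u = 0"
        using Y A u h by (simp add: w_def cmp_diff_left idm_hom cmp_hom idm_cmp)
      have wf: "cmp C X Y Y w f = cmp C X Z Y f' r"
      proof -
        have "cmp C X Y Y w f = cmp C X ?A Y (cmp C ?A Y Y w ?u) hf + cmp C X Z Y (cmp C Z Y Y w f') r"
          using X Y A f Z hf f' u w by (subst fdec) (simp add: cmp_add_right cmp_hom cmp_assoc)
        then show ?thesis using X Y A hf by (simp add: wu wf')
      qed
      define g where "g = cmp C Y ?A X (x i) h + cmp C Y Z X j (cmp C Y Y Z g' w)"
      have g: "g \<in> hom C Y X" using X Y Z A xy h g' w by (auto simp: g_def intro!: hom_add cmp_hom)
      have "cmp C X Y X g f = cmp C X ?A X (x i) hf + cmp C X Z X j (cmp C X Y Z g' (cmp C X Z Y f' r))"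
        using X Y Z A xy h g' w f by (simp add: g_def cmp_add_left cmp_hom cmp_assoc hf_def wf)
      then have "cmp C X X Y f (cmp C X Y X g f) =
        cmp C X ?A Y ?u hf + cmp C X Z Y (cmp C Z Z Y f' (cmp C Z Y Z g' f')) r"
      proof -
        have k: "cmp C X Y Z g' (cmp C X Z Y f' r) \<in> hom C X Z"
          using X Y Z g' f' by (auto intro!: cmp_hom)
        have "cmp C X X Y f (cmp C X ?A X (x i) hf) = cmp C X ?A Y ?u hf"
          using X Y A xy hf f by (simp add: cmp_assoc)
        moreover have "cmp C X X Y f (cmp C X Z X j (cmp C X Y Z g' (cmp C X Z Y f' r))) =
            cmp C X Z Y f' (cmp C X Y Z g' (cmp C X Z Y f' r))"
          using X Y Z f k by (simp add: cmp_assoc[symmetric] f'_def)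
        moreover have "cmp C X Z Y f' (cmp C X Y Z g' (cmp C X Z Y f' r)) =
            cmp C X Z Y (cmp C Z Z Y f' (cmp C Z Y Z g' f')) r"
          using X Y Z f' g'(1) by (simp add: cmp_assoc cmp_hom)
        moreover have "cmp C X X Y f (cmp C X ?A X (x i) hf + cmp C X Z X j (cmp C X Y Z g' (cmp C X Z Y f' r))) =
            cmp C X X Y f (cmp C X ?A X (x i) hf) +
            cmp C X X Y f (cmp C X Z X j (cmp C X Y Z g' (cmp C X Z Y f' r)))"
          using X Y A Z xy hf f k by (intro cmp_add_right) (auto intro!: cmp_hom)
        ultimately show ?thesis using \<open>cmp C X Y X g f = _\<close> by simp
      qed
      then show ?thesis using g g' fdec by (intro bexI[of _ g]) auto
    qed
  qed
  then show ?thesis using ex_fin assms by blast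
qed

section \<open>Kernels, cokernels and normality\<close>

lemma has_kernel:
  assumes X: "X \<in> obj C" "Y \<in> obj C" "f \<in> hom C X Y"
  shows "\<exists>K k. is_kernel C X Y f K k"
proof -
  obtain g where g: "g \<in> hom C Y X" "cmp C X X Y f (cmp C X Y X g f) = f" using regular assms by blast
  define e where "e = idm C X - cmp C X Y X g f"
  have e: "e \<in> hom C X X" using X g by (auto simp: e_def hom_diff idm_hom cmp_hom)
  have fe: "cmp C X X Y f e = 0"
    using X g by (simp add: e_def cmp_diff_right idm_hom cmp_hom cmp_idm)
  have ef: "cmp C W X X e h = h" if "W \<in> obj C" "h \<in> hom C W X" "cmp C W X Y f h = 0" for W h
    using X g that by (simp add: e_def cmp_diff_left idm_hom cmp_hom idm_cmp cmp_assoc)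
  obtain K k r where K: "K \<in> obj C" "k \<in> hom C K X" "r \<in> hom C X K"
    "cmp C K X K r k = idm C K" "cmp C X K X k r = e"
    using split[OF X(1) e] ef[OF X(1) e fe] by blast
  have "cmp C K X X e k = k" using K X by (auto simp: K(5)[symmetric] cmp_assoc cmp_idm simp del: K(5))
  then have fk: "cmp C K X Y f k = 0"
    using X K e fe by (metis cmp_assoc cmp_zero_left)
  have "is_kernel C X Y f K k"
    unfolding is_kernel_def
  proof (intro conjI ballI impI)
    fix W h assume h: "W \<in> obj C" "h \<in> hom C W X" "cmp C W X Y f h = 0"
    show "\<exists>!l. l \<in> hom C W K \<and> cmp C W K X k l = h"
    proof (rule ex1I[of _ "cmp C W X K r h"])
      show "cmp C W X K r h \<in> hom C W K \<and> cmp C W K X k (cmp C W X K r h) = h"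
        using K X h ef[OF h] by (simp add: cmp_hom cmp_assoc[symmetric])
      fix l assume "l \<in> hom C W K \<and> cmp C W K X k l = h"
      then show "l = cmp C W X K r h"
        using K X h by (auto simp: cmp_assoc[symmetric] idm_cmp)
    qed
  qed (use K fk in auto)
  then show ?thesis by blast
qed

lemma has_cokernel:
  assumes X: "X \<in> obj C" "Y \<in> obj C" "f \<in> hom C X Y"
  shows "\<exists>Q q. is_cokernel C X Y f Q q"
proof -
  obtain g where g: "g \<in> hom C Y X" "cmp C X X Y f (cmp C X Y X g f) = f" using regular assms by blast
  define e where "e = idm C Y - cmp C Y X Y f g"
  have e: "e \<in> hom C Y Y" using X g by (auto simp: e_def hom_diff idm_hom cmp_hom)
  have fe: "cmp C X Y Y e f = 0"
    using X g by (simp add: e_def cmp_diff_left idm_hom cmp_hom idm_cmp cmp_assoc)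
  have ef: "cmp C Y Y Z h e = h" if "Z \<in> obj C" "h \<in> hom C Y Z" "cmp C X Y Z h f = 0" for Z h
    using X g that by (simp add: e_def cmp_diff_right idm_hom cmp_hom cmp_idm cmp_assoc[symmetric])
  obtain Q k r where K: "Q \<in> obj C" "k \<in> hom C Q Y" "r \<in> hom C Y Q"
    "cmp C Q Y Q r k = idm C Q" "cmp C Y Q Y k r = e"
    using split[OF X(2) e] ef[OF X(2) e fe] by blast
  have "cmp C Y Y Q r e = r" using K X by (auto simp: K(5)[symmetric] cmp_assoc[symmetric] idm_cmp simp del: K(5))
  then have fk: "cmp C X Y Q r f = 0"
    using X K e fe by (metis cmp_assoc cmp_zero_right)
  have "is_cokernel C X Y f Q r"
    unfolding is_cokernel_def
  proof (intro conjI ballI impI)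
    fix Z h assume h: "Z \<in> obj C" "h \<in> hom C Y Z" "cmp C X Y Z h f = 0"
    show "\<exists>!l. l \<in> hom C Q Z \<and> cmp C Y Q Z l r = h"
    proof (rule ex1I[of _ "cmp C Q Y Z h k"])
      show "cmp C Q Y Z h k \<in> hom C Q Z \<and> cmp C Y Q Z (cmp C Q Y Z h k) r = h"
        using K X h ef[OF h] by (simp add: cmp_hom cmp_assoc)
      fix l assume "l \<in> hom C Q Z \<and> cmp C Y Q Z l r = h"
      then show "l = cmp C Q Y Z h k"
        using K X h by (auto simp: cmp_assoc cmp_idm)
    qed
  qed (use K fk in auto)
  then show ?thesis by blast
qed

text \<open>For a monomorphism regularity gives \<open>g f = 1\<close>, and then \<open>f\<close> is
  a kernel of \<open>1 - f g\<close>.\<close>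

lemma mono_kernel:
  assumes X: "X \<in> obj C" "Y \<in> obj C" "is_mono C X Y f"
  shows "\<exists>Z\<in>obj C. \<exists>g\<in>hom C Y Z. is_kernel C Y Z g X f"
proof -
  have f: "f \<in> hom C X Y" using X by (simp add: is_mono_def)
  obtain g where g: "g \<in> hom C Y X" "cmp C X X Y f (cmp C X Y X g f) = f" using regular X f by blast
  have "cmp C X X Y f (cmp C X Y X g f) = cmp C X X Y f (idm C X)" using g X f by (simp add: cmp_idm)
  then have gf: "cmp C X Y X g f = idm C X"
    using X g f unfolding is_mono_def by (meson cmp_hom idm_hom)
  define e where "e = idm C Y - cmp C Y X Y f g"
  have e: "e \<in> hom C Y Y" using X f g by (auto simp: e_def hom_diff idm_hom cmp_hom)
  have ef: "cmp C X Y Y e f = 0"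
    using X f g by (simp add: e_def cmp_diff_left idm_hom cmp_hom idm_cmp cmp_assoc)
  have "is_kernel C Y Y e X f"
    unfolding is_kernel_def
  proof (intro conjI ballI impI)
    fix W h assume h: "W \<in> obj C" "h \<in> hom C W Y" "cmp C W Y Y e h = 0"
    show "\<exists>!l. l \<in> hom C W X \<and> cmp C W X Y f l = h"
    proof (rule ex1I[of _ "cmp C W Y X g h"])
      show "cmp C W Y X g h \<in> hom C W X \<and> cmp C W X Y f (cmp C W Y X g h) = h"
        using h X f g by (simp add: e_def cmp_diff_left idm_hom cmp_hom idm_cmp cmp_assoc)
      fix l assume "l \<in> hom C W X \<and> cmp C W X Y f l = h"
      then show "l = cmp C W Y X g h"
        using X f g h gf by (auto simp: cmp_assoc[symmetric] idm_cmp)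
    qed
  qed (use X f ef in auto)
  then show ?thesis using X e by blast
qed

lemma epi_cokernel:
  assumes X: "X \<in> obj C" "Y \<in> obj C" "is_epi C X Y f"
  shows "\<exists>W\<in>obj C. \<exists>g\<in>hom C W X. is_cokernel C W X g Y f"
proof -
  have f: "f \<in> hom C X Y" using X by (simp add: is_epi_def)
  obtain g where g: "g \<in> hom C Y X" "cmp C X X Y f (cmp C X Y X g f) = f" using regular X f by blast
  have "cmp C X Y Y (cmp C Y X Y f g) f = cmp C X Y Y (idm C Y) f" using g X f by (simp add: idm_cmp cmp_assoc)
  then have gf: "cmp C Y X Y f g = idm C Y"
    using X g f unfolding is_epi_def by (meson cmp_hom idm_hom)
  define e where "e = idm C X - cmp C X Y X g f"
  have e: "e \<in> hom C X X" using X f g by (auto simp: e_def hom_diff idm_hom cmp_hom)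
  have ef: "cmp C X X Y f e = 0"
    using X f g by (simp add: e_def cmp_diff_right idm_hom cmp_hom cmp_idm)
  have "is_cokernel C X X e Y f"
    unfolding is_cokernel_def
  proof (intro conjI ballI impI)
    fix Z h assume h: "Z \<in> obj C" "h \<in> hom C X Z" "cmp C X X Z h e = 0"
    show "\<exists>!l. l \<in> hom C Y Z \<and> cmp C X Y Z l f = h"
    proof (rule ex1I[of _ "cmp C Y X Z h g"])
      show "cmp C Y X Z h g \<in> hom C Y Z \<and> cmp C X Y Z (cmp C Y X Z h g) f = h"
        using h X f g by (simp add: e_def cmp_diff_right idm_hom cmp_hom cmp_idm cmp_assoc)
      fix l assume "l \<in> hom C Y Z \<and> cmp C X Y Z l f = h"
      then show "l = cmp C Y X Z h g"
        using X f g h gf by (auto simp: cmp_assoc cmp_idm)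
    qed
  qed (use X f ef in auto)
  then show ?thesis using X e by blast
qed

lemma has_direct_sum: "set Xs \<subseteq> obj C \<Longrightarrow> \<exists>S. is_direct_sum C Xs S"
proof (induction Xs)
  case Nil
  then show ?case using zero_obj is_direct_sum_Nil by blast
next
  case (Cons X Xs)
  then obtain S where S: "is_direct_sum C Xs S" by auto
  then have "S \<in> obj C" by (simp add: is_direct_sum_def)
  then show ?case using biproduct[of X S] is_direct_sum_Cons[OF S] Cons.prems by fastforce
qed

theorem semisimple: "semisimple_category C"
proof (intro semisimple_category.intro abelian_category.intro abelian_category_axioms.intro
    semisimple_category_axioms.intro)
  show "linear_category C" by (rule linear_category_axioms)
  fix X assume "X \<in> obj C"
  then obtain ns where "is_direct_sum C (map V ns) X" using decompose by blast
  then show "\<exists>Xs. (\<forall>S\<in>set Xs. is_simple C S) \<and> is_direct_sum C Xs X"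
    using V_simple by (intro exI[of _ "map V ns"]) auto
qed (rule has_direct_sum has_kernel has_cokernel mono_kernel epi_cokernel; assumption)+

end

section \<open>Semisimplicity of Karoubi envelopes\<close>


lemma is_direct_sumE:
  assumes "is_direct_sum C Xs S"
  obtains \<iota> \<pi> where
    "\<And>i. i < length Xs \<Longrightarrow> \<iota> i \<in> hom C (Xs ! i) S"
    "\<And>i. i < length Xs \<Longrightarrow> \<pi> i \<in> hom C S (Xs ! i)"
    "\<And>i. i < length Xs \<Longrightarrow> cmp C (Xs ! i) S (Xs ! i) (\<pi> i) (\<iota> i) = idm C (Xs ! i)"
    "(\<Sum>i<length Xs. cmp C S (Xs ! i) S (\<iota> i) (\<pi> i)) = idm C S"
proof -
  from assms obtain \<iota> \<pi> where
    h: "\<forall>i<length Xs. \<iota> i \<in> hom C (Xs ! i) S \<and> \<pi> i \<in> hom C S (Xs ! i)"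
    and o: "\<forall>i<length Xs. \<forall>j<length Xs.
           cmp C (Xs ! j) S (Xs ! i) (\<pi> i) (\<iota> j) = (if i = j then idm C (Xs ! i) else 0)"
    and s: "(\<Sum>i<length Xs. cmp C S (Xs ! i) S (\<iota> i) (\<pi> i)) = idm C S"
    unfolding is_direct_sum_def by (elim conjE exE)
  have "cmp C (Xs ! i) S (Xs ! i) (\<pi> i) (\<iota> i) = idm C (Xs ! i)" if "i < length Xs" for i
    using o that by simp
  then show ?thesis using that[of \<iota> \<pi>] h s by simp
qed

section \<open>Schur's lemma and non-degenerate composition\<close>

context semisimple_category
begin

lemma kernel_is_mono:
  assumes "is_kernel C X Y f K k" "X \<in> obj C" "Y \<in> obj C" "f \<in> hom C X Y"
  shows "is_mono C K X k"
  unfolding is_mono_def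
proof (intro conjI ballI impI)
  show k: "k \<in> hom C K X" using assms by (simp add: is_kernel_def)
  fix W g h assume W: "W \<in> obj C" "g \<in> hom C W K" "h \<in> hom C W K"
    and eq: "cmp C W K X k g = cmp C W K X k h"
  have K: "K \<in> obj C" "cmp C K X Y f k = 0" using assms by (auto simp: is_kernel_def)
  have "cmp C W X Y f (cmp C W K X k g) = 0"
    using K k W assms by (simp add: cmp_assoc[symmetric])
  moreover have "cmp C W K X k g \<in> hom C W X" using K k W assms cmp_hom by blast
  ultimately have "\<exists>!l. l \<in> hom C W K \<and> cmp C W K X k l = cmp C W K X k g"
    using assms(1) W(1) unfolding is_kernel_def by blast
  then show "g = h" using W eq by metis
qed

lemma schur:
  assumes S: "is_simple C S" and T: "is_simple C T" and u: "u \<in> hom C S T" "u \<noteq> 0"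
  shows "is_iso C S T u"
proof -
  have o: "S \<in> obj C" "T \<in> obj C" using S T by (auto simp: is_simple_def)
  obtain K k where K: "is_kernel C S T u K k" using ex_kernel o u by blast
  have k: "K \<in> obj C" "k \<in> hom C K S" "cmp C K S T u k = 0" using K by (auto simp: is_kernel_def)
  have "is_zero_object C K \<or> is_iso C K S k"
    using kernel_is_mono[OF K o u(1)] S k by (simp add: is_simple_def)
  moreover have "\<not> is_iso C K S k"
  proof
    assume "is_iso C K S k"
    then obtain g where g: "g \<in> hom C S K" "cmp C S K S k g = idm C S" by (auto simp: is_iso_def)
    have "u = cmp C S S T u (cmp C S K S k g)" using u o g by (simp add: cmp_idm)
    also have "\<dots> = 0" using u o g(1) k by (simp add: cmp_assoc[symmetric])
    finally show False using u by simp
  qed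
  ultimately have z: "is_zero_object C K" by blast
  have "is_mono C S T u"
    unfolding is_mono_def
  proof (intro conjI ballI impI)
    fix W g h assume W: "W \<in> obj C" "g \<in> hom C W S" "h \<in> hom C W S"
      and eq: "cmp C W S T u g = cmp C W S T u h"
    then have "cmp C W S T u (g - h) = 0" using o u by (simp add: cmp_diff_right)
    moreover have "g - h \<in> hom C W S" using W o hom_diff by blast
    ultimately obtain l where l: "l \<in> hom C W K" "cmp C W K S k l = g - h"
      using K W unfolding is_kernel_def by blast
    have "l = 0" using z l W k unfolding is_zero_object_def using hom_zero by blast
    then show "g = h" using l(2) W k o by simp
  qed (rule u)
  then have "is_zero_object C S \<or> is_iso C S T u" using T o by (simp add: is_simple_def)
  then show ?thesis using S by (simp add: is_simple_def)
qed

text \<open>With respect to decompositions into simple objects some entry of the matrix of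
  \<open>f\<close> is non-zero and hence invertible by \<open>schur\<close>. Its inverse, extended
  to a morphism \<open>g\<close>, satisfies \<open>g f i k = i k\<close>, so \<open>g f\<close>
  cannot vanish. This is the obstruction used at the exceptional parameters.\<close>

lemma nonzero_not_annihilated:
  assumes o: "X \<in> obj C" "Y \<in> obj C" and f: "f \<in> hom C X Y" "f \<noteq> 0"
  shows "\<exists>g\<in>hom C Y X. cmp C X Y X g f \<noteq> 0"
proof -
  obtain Xs where Xs: "\<forall>S\<in>set Xs. is_simple C S" "is_direct_sum C Xs X"
    using ex_simple_decomposition[OF o(1)] by blast
  obtain Ys where Ys: "\<forall>S\<in>set Ys. is_simple C S" "is_direct_sum C Ys Y"
    using ex_simple_decomposition[OF o(2)] by blast
  obtain i p where
        i: "\<And>j. j < length Xs \<Longrightarrow> i j \<in> hom C (Xs ! j) X"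
    and p: "\<And>j. j < length Xs \<Longrightarrow> p j \<in> hom C X (Xs ! j)"
    and pi: "\<And>j. j < length Xs \<Longrightarrow> cmp C (Xs ! j) X (Xs ! j) (p j) (i j) = idm C (Xs ! j)"
    and ip: "(\<Sum>j<length Xs. cmp C X (Xs ! j) X (i j) (p j)) = idm C X"
    by (rule is_direct_sumE[OF Xs(2)]) blast
  obtain i' p' where
        i': "\<And>j. j < length Ys \<Longrightarrow> i' j \<in> hom C (Ys ! j) Y"
    and p': "\<And>j. j < length Ys \<Longrightarrow> p' j \<in> hom C Y (Ys ! j)"
    and "\<And>j. j < length Ys \<Longrightarrow> cmp C (Ys ! j) Y (Ys ! j) (p' j) (i' j) = idm C (Ys ! j)"
    and ip': "(\<Sum>j<length Ys. cmp C Y (Ys ! j) Y (i' j) (p' j)) = idm C Y"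
    by (rule is_direct_sumE[OF Ys(2)]) blast
  have oX: "Xs ! j \<in> obj C" "is_simple C (Xs ! j)" if "j < length Xs" for j
    using Xs that by (auto simp: is_direct_sum_def)
  have oY: "Ys ! j \<in> obj C" "is_simple C (Ys ! j)" if "j < length Ys" for j
    using Ys that by (auto simp: is_direct_sum_def)
  have "\<exists>k<length Xs. \<exists>j<length Ys. cmp C (Xs ! k) Y (Ys ! j) (p' j) (cmp C (Xs ! k) X Y f (i k)) \<noteq> 0"
  proof (rule ccontr)
    assume "\<not> ?thesis"
    then have z: "cmp C (Xs ! k) Y (Ys ! j) (p' j) (cmp C (Xs ! k) X Y f (i k)) = 0"
      if "k < length Xs" "j < length Ys" for k j using that by blast
    have fi: "cmp C (Xs ! k) X Y f (i k) = 0" if k: "k < length Xs" for k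
    proof -
      have h: "cmp C (Xs ! k) X Y f (i k) \<in> hom C (Xs ! k) Y" using o f oX i k cmp_hom by blast
      then have "cmp C (Xs ! k) X Y f (i k) = cmp C (Xs ! k) Y Y (idm C Y) (cmp C (Xs ! k) X Y f (i k))"
        using o oX[OF k] idm_cmp by metis
      also have "\<dots> = (\<Sum>j<length Ys. cmp C (Xs ! k) Y Y (cmp C Y (Ys ! j) Y (i' j) (p' j))
          (cmp C (Xs ! k) X Y f (i k)))"
        unfolding ip'[symmetric] using o h oX k oY i' p' by (intro cmp_sum_left) (auto intro!: cmp_hom)
      also have "\<dots> = 0"
        using o h oX k oY i' p' by (intro sum.neutral ballI) (simp add: cmp_assoc z)
      finally show ?thesis .
    qed
    have "f = cmp C X X Y f (idm C X)" using o f by (simp add: cmp_idm)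
    also have "\<dots> = (\<Sum>k<length Xs. cmp C X X Y f (cmp C X (Xs ! k) X (i k) (p k)))"
      unfolding ip[symmetric] using o f oX i p by (intro cmp_sum_right) (auto intro!: cmp_hom)
    also have "\<dots> = 0"
      using o f oX i p by (intro sum.neutral ballI) (simp add: cmp_assoc[symmetric] fi)
    finally show False using f by simp
  qed
  then obtain k j where kj: "k < length Xs" "j < length Ys"
    and nz: "cmp C (Xs ! k) Y (Ys ! j) (p' j) (cmp C (Xs ! k) X Y f (i k)) \<noteq> 0" by blast
  note hyps = o f oX[OF kj(1)] oY[OF kj(2)] i[OF kj(1)] p[OF kj(1)] i'[OF kj(2)] p'[OF kj(2)]
  let ?S = "Xs ! k" and ?T = "Ys ! j"
  let ?u = "cmp C ?S Y ?T (p' j) (cmp C ?S X Y f (i k))"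
  have "is_iso C ?S ?T ?u" using hyps nz by (intro schur) (auto intro!: cmp_hom)
  then obtain v where v: "v \<in> hom C ?T ?S" "cmp C ?S ?T ?S v ?u = idm C ?S"
    by (auto simp: is_iso_def)
  define g where "g = cmp C Y ?S X (i k) (cmp C Y ?T ?S v (p' j))"
  have g: "g \<in> hom C Y X" using hyps v by (auto simp: g_def intro!: cmp_hom)
  have "cmp C ?S X X (cmp C X Y X g f) (i k) = i k"
    using hyps v by (simp add: g_def cmp_assoc cmp_hom cmp_idm)
  then have "cmp C X Y X g f \<noteq> 0"
  proof (intro notI)
    assume "cmp C X Y X g f = 0"
    then have "i k = 0" using hyps \<open>cmp C ?S X X (cmp C X Y X g f) (i k) = i k\<close> by simp
    then have "idm C ?S = 0" using pi[OF kj(1)] hyps by simp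
    then show False using hyps is_zero_object_iff by (auto simp: is_simple_def)
  qed
  then show ?thesis using g by blast
qed

end

section \<open>Passage to the Karoubi envelope\<close>

context linear_category
begin

lemma additive_biproduct:
  assumes X: "set Xs \<subseteq> obj C" "set Ys \<subseteq> obj C"
  shows "\<exists>i1 p1 i2 p2. is_biproduct (additive_completion C) Xs Ys (Xs @ Ys) i1 p1 i2 p2"
proof -
  define a where "a = length Xs"
  \<comment> \<open>An identity block in the upper left corner. As entries outside the index range
    are 0, the same function serves as inclusion of \<open>Xs\<close> and as projection to
    \<open>Xs\<close>; for \<open>Ys\<close> the two maps \<open>i2\<close> and \<open>p2\<close>
    are transposed to each other.\<close>
  define i1 where "i1 i j = (if i = j \<and> j < a then idm C (Xs ! j) else 0)" for i j
  define i2 where "i2 i j = (if i = j + a \<and> j < length Ys then idm C (Ys ! j) else 0)" for i j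
  define p2 where "p2 i j = (if j = i + a \<and> i < length Ys then idm C (Ys ! i) else 0)" for i j
  have oX: "Xs ! i \<in> obj C" if "i < a" for i using X that by (auto simp: a_def)
  have oY: "Ys ! i \<in> obj C" if "i < length Ys" for i using X that by auto
  have oXY: "(Xs @ Ys) ! i \<in> obj C" if "i < a + length Ys" for i
    using oX oY that by (auto simp: nth_append a_def)
  note nth = nth_append a_def[symmetric]
  have delta: "(\<Sum>j<n. if P \<and> j = k then h else 0) = (if P \<and> k < n then h else 0)"
    for n k :: nat and P and h :: 'm
    by (cases P) auto
  let ?A = "additive_completion C"
  have 1: "cmp ?A Xs (Xs @ Ys) Xs i1 i1 = idm ?A Xs"
  proof (intro ext)
    fix i k
    have "(\<Sum>j<length (Xs @ Ys). cmp C (Xs ! k) ((Xs @ Ys) ! j) (Xs ! i) (i1 i j) (i1 j k)) =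
        (\<Sum>j<length (Xs @ Ys). if i = k \<and> j = k then idm C (Xs ! k) else 0)" if "i < a" "k < a"
      using that oX oXY by (intro sum.cong) (auto simp: i1_def nth cmp_idm idm_hom)
    then show "cmp ?A Xs (Xs @ Ys) Xs i1 i1 i k = idm ?A Xs i k"
      by (auto simp: additive_completion_def a_def[symmetric] delta)
  qed
  have 2: "cmp ?A Ys (Xs @ Ys) Ys p2 i2 = idm ?A Ys"
  proof (intro ext)
    fix i k
    have "(\<Sum>j<length (Xs @ Ys). cmp C (Ys ! k) ((Xs @ Ys) ! j) (Ys ! i) (p2 i j) (i2 j k)) =
        (\<Sum>j<length (Xs @ Ys). if i = k \<and> j = k + a then idm C (Ys ! k) else 0)"
      if "i < length Ys" "k < length Ys"
      using that oY oXY by (intro sum.cong) (auto simp: i2_def p2_def nth cmp_idm idm_hom)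
    then show "cmp ?A Ys (Xs @ Ys) Ys p2 i2 i k = idm ?A Ys i k"
      by (auto simp: additive_completion_def a_def[symmetric] delta)
  qed
  have 3: "cmp ?A Ys (Xs @ Ys) Xs i1 i2 = 0"
  proof (intro ext)
    fix i k
    have "(\<Sum>j<length (Xs @ Ys). cmp C (Ys ! k) ((Xs @ Ys) ! j) (Xs ! i) (i1 i j) (i2 j k)) = 0"
      if "i < a" "k < length Ys"
      using that oX oY oXY by (intro sum.neutral) (auto simp: i1_def i2_def nth idm_hom)
    then show "cmp ?A Ys (Xs @ Ys) Xs i1 i2 i k = 0 i k"
      by (auto simp: additive_completion_def a_def[symmetric])
  qed
  have 4: "cmp ?A Xs (Xs @ Ys) Ys p2 i1 = 0"
  proof (intro ext)
    fix i k
    have "(\<Sum>j<length (Xs @ Ys). cmp C (Xs ! k) ((Xs @ Ys) ! j) (Ys ! i) (p2 i j) (i1 j k)) = 0"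
      if "i < length Ys" "k < a"
      using that oX oY oXY by (intro sum.neutral) (auto simp: i1_def p2_def nth idm_hom)
    then show "cmp ?A Xs (Xs @ Ys) Ys p2 i1 i k = 0 i k"
      by (auto simp: additive_completion_def a_def[symmetric])
  qed
  have 5: "cmp ?A (Xs @ Ys) Xs (Xs @ Ys) i1 i1 + cmp ?A (Xs @ Ys) Ys (Xs @ Ys) i2 p2 = idm ?A (Xs @ Ys)"
  proof (intro ext)
    fix i k
    have "(\<Sum>j<length Xs. cmp C ((Xs @ Ys) ! k) (Xs ! j) ((Xs @ Ys) ! i) (i1 i j) (i1 j k)) =
        (\<Sum>j<length Xs. if i = k \<and> j = k then idm C (Xs ! k) else 0)"
      if "i < length (Xs @ Ys)" "k < length (Xs @ Ys)"
      using that oX oXY by (intro sum.cong) (auto simp: i1_def nth cmp_idm idm_hom)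
    moreover have "(\<Sum>j<length Ys. cmp C ((Xs @ Ys) ! k) (Ys ! j) ((Xs @ Ys) ! i) (i2 i j) (p2 j k)) =
        (\<Sum>j<length Ys. if (i = k \<and> a \<le> k) \<and> j = k - a then idm C ((Xs @ Ys) ! k) else 0)"
      if "i < length (Xs @ Ys)" "k < length (Xs @ Ys)"
      using that oY oXY by (intro sum.cong) (auto simp: i2_def p2_def nth cmp_idm idm_hom)
    ultimately show "(cmp ?A (Xs @ Ys) Xs (Xs @ Ys) i1 i1 + cmp ?A (Xs @ Ys) Ys (Xs @ Ys) i2 p2) i k =
        idm ?A (Xs @ Ys) i k"
      by (auto simp: additive_completion_def a_def[symmetric] delta nth)
  qed
  have "is_biproduct ?A Xs Ys (Xs @ Ys) i1 i1 i2 p2"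
    unfolding is_biproduct_def using 1 2 3 4 5 X oX oY oXY
    by (auto simp: additive_completion_def i1_def i2_def p2_def nth idm_hom)
  then show ?thesis by blast
qed

lemma idempotent_completion_split:
  assumes "X \<in> obj (idempotent_completion C)" "e \<in> hom (idempotent_completion C) X X"
    "cmp (idempotent_completion C) X X X e e = e"
  shows "\<exists>Z\<in>obj (idempotent_completion C). \<exists>i\<in>hom (idempotent_completion C) Z X.
    \<exists>r\<in>hom (idempotent_completion C) X Z.
      cmp (idempotent_completion C) Z X Z r i = idm (idempotent_completion C) Z \<and>
      cmp (idempotent_completion C) X Z X i r = e"
  using assms
  by (intro bexI[of _ "(fst X, e)"] bexI[of _ e]) (auto simp: idempotent_completion_def)

text \<open>The inclusions and projections are truncated by \<open>e\<close> and \<open>e'\<close>,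
  and the idempotent on \<open>S\<close> is the resulting block diagonal one.\<close>

lemma idempotent_completion_biproduct:
  assumes b: "is_biproduct C X Y S i1 p1 i2 p2"
    and e: "(X, e) \<in> obj (idempotent_completion C)" "(Y, e') \<in> obj (idempotent_completion C)"
  shows "\<exists>i1' p1' i2' p2'. is_biproduct (idempotent_completion C) (X, e) (Y, e')
    (S, cmp C S X S i1 (cmp C S X X e p1) + cmp C S Y S i2 (cmp C S Y Y e' p2)) i1' p1' i2' p2'"
proof -
  have o: "X \<in> obj C" "Y \<in> obj C" "S \<in> obj C"
    and h: "i1 \<in> hom C X S" "p1 \<in> hom C S X" "i2 \<in> hom C Y S" "p2 \<in> hom C S Y"
    and r: "cmp C X S X p1 i1 = idm C X" "cmp C Y S Y p2 i2 = idm C Y"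
      "cmp C Y S X p1 i2 = 0" "cmp C X S Y p2 i1 = 0"
    using b by (auto simp: is_biproduct_def)
  have e: "e \<in> hom C X X" "cmp C X X X e e = e" "e' \<in> hom C Y Y" "cmp C Y Y Y e' e' = e'"
    using e by (auto simp: idempotent_completion_def)
  have ee: "cmp C W X X e (cmp C W X X e f) = cmp C W X X e f" if "W \<in> obj C" "f \<in> hom C W X" for W f
    using that o e by (simp add: cmp_assoc[symmetric])
  have ee': "cmp C W Y Y e' (cmp C W Y Y e' f) = cmp C W Y Y e' f" if "W \<in> obj C" "f \<in> hom C W Y" for W f
    using that o e by (simp add: cmp_assoc[symmetric])
  have r': "cmp C W S X p1 (cmp C W X S i1 f) = f" "cmp C W S Y p2 (cmp C W X S i1 f) = 0"
    if "W \<in> obj C" "f \<in> hom C W X" for W f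
    using that o h r by (simp_all add: cmp_assoc[symmetric] idm_cmp)
  have r'': "cmp C W S Y p2 (cmp C W Y S i2 f) = f" "cmp C W S X p1 (cmp C W Y S i2 f) = 0"
    if "W \<in> obj C" "f \<in> hom C W Y" for W f
    using that o h r by (simp_all add: cmp_assoc[symmetric] idm_cmp)
  show ?thesis
    unfolding is_biproduct_def
    by (intro exI[of _ "cmp C X X S i1 e"] exI[of _ "cmp C S X X e p1"]
        exI[of _ "cmp C Y Y S i2 e'"] exI[of _ "cmp C S Y Y e' p2"])
      (use o h r r' r'' e ee ee' in \<open>simp add: idempotent_completion_def cmp_hom hom_add
        cmp_add_left cmp_add_right cmp_assoc cmp_idm idm_cmp\<close>)
qed

lemma factors_biproduct:
  assumes b: "is_biproduct C X Y S i1 p1 i2 p2" and V: "range V \<subseteq> obj C"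
    and f: "factors C V X X (idm C X)" "factors C V Y Y (idm C Y)"
  shows "factors C V S S (idm C S)"
proof -
  have o: "X \<in> obj C" "Y \<in> obj C" "S \<in> obj C"
    and h: "i1 \<in> hom C X S" "p1 \<in> hom C S X" "i2 \<in> hom C Y S" "p2 \<in> hom C S Y"
    and eq: "cmp C S X S i1 p1 + cmp C S Y S i2 p2 = idm C S"
    using b by (auto simp: is_biproduct_def)
  have "factors C V S S (cmp C S X S i1 p1)"
    using factors_cmp[OF f(1) o(3,1,1,3) V h(2,1)] o h by (simp add: idm_cmp)
  moreover have "factors C V S S (cmp C S Y S i2 p2)"
    using factors_cmp[OF f(2) o(3,2,2,3) V h(4,3)] o h by (simp add: idm_cmp)
  ultimately show ?thesis using factors_add eq by metis
qed

end

text \<open>Embedding of a category into its additive completion: the 1 x 1 matrix with entry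
  \<open>h\<close>, regarded as a morphism between lists of length one.\<close>

definition single :: "'m::zero \<Rightarrow> nat \<Rightarrow> nat \<Rightarrow> 'm" where
  "single h i j = (if i = 0 \<and> j = 0 then h else 0)"

lemma single_add: "single (g + h) = single g + single (h :: 'm::ab_group_add)"
  by (auto simp: single_def fun_eq_iff)

lemma single_zero: "single 0 = 0"
  by (auto simp: single_def fun_eq_iff)

lemma single_apply [simp]: "single h 0 0 = h"
  by (simp add: single_def)

lemma single_inj: "single g = single h \<longleftrightarrow> g = h"
  by (metis single_apply)

lemma single_eq_0: "single (g :: 'm::ab_group_add) = 0 \<longleftrightarrow> g = 0"
  by (metis single_inj single_zero)

lemma single_cmp: "cmp (additive_completion C) [X] [Y] [Z] (single g) (single f) = single (cmp C X Y Z g f)"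
  by (auto simp: additive_completion_def single_def fun_eq_iff)

lemma single_idm: "idm (additive_completion C) [X] = single (idm C X)"
  by (auto simp: additive_completion_def single_def fun_eq_iff)

lemma hom_single: "hom (additive_completion C) [X] [Y] = single ` hom C X Y"
proof (intro set_eqI iffI)
  fix f assume "f \<in> hom (additive_completion C) [X] [Y]"
  then have *: "\<forall>i j. if i = 0 \<and> j = 0 then f i j \<in> hom C ([X] ! j) ([Y] ! i) else f i j = 0"
    by (simp add: additive_completion_def)
  have "f = single (f 0 0)" using * by (auto simp: single_def fun_eq_iff)
  moreover have "f 0 0 \<in> hom C X Y" using *[rule_format, of 0 0] by simp
  ultimately show "f \<in> single ` hom C X Y" by blast
qed (auto simp: additive_completion_def single_def)

lemma karoubi_single:
  fixes C :: "('o, 'm::ab_group_add) lincat"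
  shows "([X], single e) \<in> obj (karoubi_envelope C) \<longleftrightarrow> (X, e) \<in> obj (idempotent_completion C)"
    and "hom (karoubi_envelope C) ([X], single e) ([Y], single e') =
      single ` hom (idempotent_completion C) (X, e) (Y, e')"
    and "cmp (karoubi_envelope C) ([X], single e) ([Y], single e') ([Z], single e'') (single g) (single f) =
      single (cmp (idempotent_completion C) (X, e) (Y, e') (Z, e'') g f)"
  unfolding karoubi_envelope_def idempotent_completion_def
  by (auto simp: obj_additive hom_single single_cmp single_inj)

text \<open>The hypotheses concern the idempotent completion of \<open>C\<close> alone. The family
  is moved into the envelope by 1 x 1 matrices, which identify the hom spaces and so preserve
  orthogonality and scalar endomorphisms; the ideal condition spreads from single objects to lists
  through biproducts.\<close>

theorem semisimple_karoubi_envelopeI: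
  fixes C :: "('o, 'm::ab_group_add) lincat" and V :: "'i \<Rightarrow> 'o \<times> 'm"
  assumes lin: "linear_category C"
    and V: "range V \<subseteq> obj (idempotent_completion C)" "\<And>n. snd (V n) \<noteq> 0"
    and orth: "\<And>m n f. m \<noteq> n \<Longrightarrow> f \<in> hom (idempotent_completion C) (V m) (V n) \<Longrightarrow> f = 0"
    and endo: "\<And>n f. f \<in> hom (idempotent_completion C) (V n) (V n) \<Longrightarrow> \<exists>c. f = scl C c (snd (V n))"
    and fac: "\<And>X. X \<in> obj C \<Longrightarrow>
      factors (idempotent_completion C) V (X, idm C X) (X, idm C X) (idm C X)"
  shows "semisimple_category (karoubi_envelope C)"
proof -
  let ?A = "additive_completion C" and ?I = "idempotent_completion C" and ?K = "karoubi_envelope C"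
  interpret C: linear_category C by fact
  interpret I: linear_category ?I by (rule linear_category_idempotent_completion[OF lin])
  interpret A: linear_category ?A by (rule linear_category_additive_completion[OF lin])
  interpret K: linear_category ?K
    unfolding karoubi_envelope_def by (rule linear_category_idempotent_completion[OF A.linear_category_axioms])
  define W where "W n = ([fst (V n)], single (snd (V n)))" for n
  have WV: "W n \<in> obj ?K" for n
    unfolding W_def karoubi_single using V(1) by (cases "V n") (metis prod.collapse rangeI subset_iff)
  have hW: "hom ?K (W m) (W n) = single ` hom ?I (V m) (V n)" for m n
    unfolding W_def karoubi_single by simp
  have idK: "idm ?K Z = snd Z" for Z
    by (cases Z) (simp add: karoubi_envelope_def idempotent_completion_def)
  have sclK: "scl ?K c (single f) = single (scl C c f)" for c f
    by (auto simp: karoubi_envelope_def idempotent_completion_def additive_completion_def single_def fun_eq_iff)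
  have fac1: "factors ?K W ([X], single e) ([Y], single e') (single h)"
    if "factors ?I V (X, e) (Y, e') h" for X e Y e' h
    using that
  proof (induction)
    case zero then show ?case unfolding single_zero by (rule factors.zero)
  next
    case (step h x n y)
    have "factors ?K W ([X], single e) ([Y], single e')
      (single h + cmp ?K ([X], single e) (W n) ([Y], single e') (single x) (single y))"
      using step.hyps by (intro factors.step step.IH) (auto simp: W_def karoubi_single)
    moreover have "cmp ?K ([X], single e) (W n) ([Y], single e') (single x) (single y) =
        single (cmp ?I (X, e) (V n) (Y, e') x y)"
      by (simp add: W_def karoubi_single)
    ultimately show ?case by (simp only: single_add)
  qed
  have idobj: "(Xs, idm ?A Xs) \<in> obj ?K" if "set Xs \<subseteq> obj C" for Xs
    using that A.idm_hom A.idm_cmp by (auto simp: karoubi_envelope_def idempotent_completion_def obj_additive)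
  have bip: "\<exists>i1' p1' i2' p2'. is_biproduct ?K (Xs, e) (Ys, e') (Xs @ Ys,
      cmp ?A (Xs @ Ys) Xs (Xs @ Ys) i1 (cmp ?A (Xs @ Ys) Xs Xs e p1) +
      cmp ?A (Xs @ Ys) Ys (Xs @ Ys) i2 (cmp ?A (Xs @ Ys) Ys Ys e' p2)) i1' p1' i2' p2'"
    if "(Xs, e) \<in> obj ?K" "(Ys, e') \<in> obj ?K" "is_biproduct ?A Xs Ys (Xs @ Ys) i1 p1 i2 p2"
    for Xs e Ys e' i1 p1 i2 p2
    using A.idempotent_completion_biproduct[OF that(3)] that(1,2) unfolding karoubi_envelope_def by blast
  have Kobj: "Xs \<in> obj ?A" "set Xs \<subseteq> obj C" if "(Xs, e) \<in> obj ?K" for Xs e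
    using that by (auto simp: karoubi_envelope_def idempotent_completion_def obj_additive)
  have fac2: "factors ?K W (Xs, idm ?A Xs) (Xs, idm ?A Xs) (idm ?A Xs)" if "set Xs \<subseteq> obj C" for Xs
    using that
  proof (induction Xs)
    case Nil
    have "idm ?A [] = 0" by (auto simp: additive_completion_def fun_eq_iff)
    then show ?case by (simp only: factors.zero)
  next
    case (Cons X Xs)
    then obtain i1 p1 i2 p2 where b: "is_biproduct ?A [X] Xs ([X] @ Xs) i1 p1 i2 p2"
      using C.additive_biproduct[of "[X]" Xs] by auto
    note b' = b[unfolded is_biproduct_def]
    obtain i1' p1' i2' p2' where "is_biproduct ?K ([X], idm ?A [X]) (Xs, idm ?A Xs) ([X] @ Xs,
      cmp ?A ([X] @ Xs) [X] ([X] @ Xs) i1 (cmp ?A ([X] @ Xs) [X] [X] (idm ?A [X]) p1) +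
      cmp ?A ([X] @ Xs) Xs ([X] @ Xs) i2 (cmp ?A ([X] @ Xs) Xs Xs (idm ?A Xs) p2)) i1' p1' i2' p2'"
      using bip[OF idobj idobj b] Cons.prems by auto
    then have b2: "is_biproduct ?K ([X], idm ?A [X]) (Xs, idm ?A Xs) (X # Xs, idm ?A (X # Xs)) i1' p1' i2' p2'"
      using b' A.idm_cmp by simp
    show ?case
      using K.factors_biproduct[OF b2, of W] WV Cons fac1[OF fac[of X]] by (auto simp: idK single_idm)
  qed
  have "split_category ?K W"
  proof
    fix X e assume "X \<in> obj ?K" "e \<in> hom ?K X X" "cmp ?K X X X e e = e"
    then show "\<exists>Z\<in>obj ?K. \<exists>i\<in>hom ?K Z X. \<exists>r\<in>hom ?K X Z. cmp ?K Z X Z r i = idm ?K Z \<and> cmp ?K X Z X i r = e"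
      unfolding karoubi_envelope_def by (rule A.idempotent_completion_split)
  next
    show "\<exists>Z\<in>obj ?K. idm ?K Z = 0"
      using idobj[of "[]"] by (intro bexI[of _ "([], idm ?A [])"]) (auto simp: idK additive_completion_def fun_eq_iff)
  next
    fix X Y assume "X \<in> obj ?K" "Y \<in> obj ?K"
    then show "\<exists>S i1 p1 i2 p2. is_biproduct ?K X Y S i1 p1 i2 p2"
      using bip C.additive_biproduct Kobj by (metis prod.collapse)
  next
    \<comment> \<open>The morphism \<open>e\<close> leads from \<open>(Xs, e)\<close> to
      \<open>(Xs, 1)\<close> and back, and the composite is \<open>e\<close>, the identity of
      \<open>(Xs, e)\<close>. Thus the ideal condition passes from \<open>(Xs, 1)\<close> to its
      retracts.\<close>
    fix X assume X: "X \<in> obj ?K"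
    obtain Xs e where Xs: "X = (Xs, e)" by (cases X)
    have e: "e \<in> hom ?K (Xs, idm ?A Xs) X" "e \<in> hom ?K X (Xs, idm ?A Xs)" "Xs \<in> obj ?A"
      "cmp ?K X (Xs, idm ?A Xs) X e e = e"
      using X A.idm_cmp A.cmp_idm unfolding Xs by (auto simp: karoubi_envelope_def idempotent_completion_def)
    have "cmp ?K X (Xs, idm ?A Xs) (Xs, idm ?A Xs) (idm ?A Xs) e = e"
      using K.idm_cmp[OF X idobj e(2)] Kobj X Xs by (simp add: idK)
    moreover have "factors ?K W X X (cmp ?K X (Xs, idm ?A Xs) X e
        (cmp ?K X (Xs, idm ?A Xs) (Xs, idm ?A Xs) (idm ?A Xs) e))"
      using fac2[of Xs] idobj[of Xs] X Kobj[of Xs e] e WV unfolding Xs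
      by (intro K.factors_cmp) auto
    ultimately show "factors ?K W X X (idm ?K X)" using e(4) by (simp add: idK Xs)
  next
    fix n f assume "f \<in> hom ?K (W n) (W n)"
    then show "\<exists>c. f = scl ?K c (idm ?K (W n))"
      using endo unfolding hW by (force simp: idK W_def sclK)
  next
    fix m n f assume "m \<noteq> n" "f \<in> hom ?K (W m) (W n)"
    then show "f = 0" using orth[of m n] unfolding hW by (auto simp: single_eq_0)
  next
    show "idm ?K (W n) \<noteq> 0" for n using V(2) by (simp add: idK W_def single_eq_0)
  qed (rule WV)
  then show ?thesis by (rule split_category.semisimple)
qed

text \<open>\<open>C\<close> is fully embedded in its envelope as the objects with a one-element
  list and the identity as idempotent, so the morphism provided by
  \<open>nonzero_not_annihilated\<close> is a 1 x 1 matrix and comes from \<open>C\<close>.\<close>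

theorem semisimple_karoubi_envelopeD:
  assumes ss: "semisimple_category (karoubi_envelope C)" and lin: "linear_category C"
    and X: "X \<in> obj C" "Y \<in> obj C" "f \<in> hom C X Y" "f \<noteq> 0"
  shows "\<exists>g\<in>hom C Y X. cmp C X Y X g f \<noteq> 0"
proof -
  interpret C: linear_category C by fact
  interpret K: semisimple_category "karoubi_envelope C" by fact
  have h: "hom (idempotent_completion C) (X, idm C X) (Y, idm C Y) = hom C X Y"
    if "X \<in> obj C" "Y \<in> obj C" for X Y
    using that C.idm_cmp C.cmp_idm by (auto simp: idempotent_completion_def)
  have o: "([X], single (idm C X)) \<in> obj (karoubi_envelope C)" if "X \<in> obj C" for X
    using that C.idm_cmp C.idm_hom unfolding karoubi_single by (auto simp: idempotent_completion_def)
  have "\<exists>g\<in>single ` hom C Y X. cmp (karoubi_envelope C) ([X], single (idm C X))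
      ([Y], single (idm C Y)) ([X], single (idm C X)) g (single f) \<noteq> 0"
    using K.nonzero_not_annihilated[OF o[OF X(1)] o[OF X(2)], of "single f"] X
    unfolding karoubi_single h[OF X(2,1)] h[OF X(1,2)] single_eq_0 by blast
  then show ?thesis
    by (auto simp: karoubi_single idempotent_completion_def single_eq_0)
qed

section \<open>Saturated sets of a diagram\<close>

text \<open>A pair \<open>(X, Y)\<close> is a labelling of the upper and lower points by two labels, and the saturated pairs
  are the labellings which are constant on blocks. They determine the diagram, and stacking diagrams
  becomes a product of 0-1-matrices, up to a power of 2 which counts the loops. Associativity and all
  relations between diagrams are read off from these matrices.\<close>


definition saturated :: "diagram \<Rightarrow> nat set \<Rightarrow> nat set \<Rightarrow> bool" where
  "saturated p X Y \<longleftrightarrow>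
     (\<forall>B\<in>p. B \<subseteq> Upper ` X \<union> Lower ` Y \<or> B \<inter> (Upper ` X \<union> Lower ` Y) = {})"

lemma saturated_empty [simp]: "saturated p {} {}"
  by (simp add: saturated_def)

text \<open>The block of a point is the least saturated set that contains it: each block is itself
  saturated, so blocks of \<open>p\<close> and \<open>q\<close> with a common point contain one
  another.\<close>

lemma partitions_eqI:
  assumes p: "p \<in> partitions k l" "q \<in> partitions k l"
    and eq: "\<And>X Y. X \<subseteq> {1..k} \<Longrightarrow> Y \<subseteq> {1..l} \<Longrightarrow> saturated p X Y \<longleftrightarrow> saturated q X Y"
  shows "p = q"
proof -
  have "B \<in> q"
    if p: "p \<in> partitions k l" "q \<in> partitions k l"
    and eq: "\<And>X Y. X \<subseteq> {1..k} \<Longrightarrow> Y \<subseteq> {1..l} \<Longrightarrow> saturated p X Y \<longleftrightarrow> saturated q X Y"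
    and B: "B \<in> p" for p q B
  proof -
    have part: "partition_on (points k l) p" "partition_on (points k l) q"
      using p by (auto simp: partitions_def)
    have own: "saturated r (Upper -` B) (Lower -` B)" if "B \<in> r" "partition_on (points k l) r" for r B
    proof -
      have "Upper ` (Upper -` B) \<union> Lower ` (Lower -` B) = B"
        by (auto simp: image_iff) (metis point.exhaust)
      then show ?thesis
        using that partition_onD2[OF that(2)] unfolding saturated_def disjoint_def by (metis order_refl)
    qed
    have trace: "Upper ` (Upper -` B) \<union> Lower ` (Lower -` B) = B" for B
      by (auto simp: image_iff) (metis point.exhaust)
    have sub: "Upper -` B \<subseteq> {1..k}" "Lower -` B \<subseteq> {1..l}"
      if "B \<in> r" "partition_on (points k l) r" for r B
      using that partition_onD1[OF that(2)] by (auto simp: points_def)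
    have "B \<noteq> {}" using B part(1) partition_onD3 by metis
    then obtain b where b: "b \<in> B" by blast
    then have "b \<in> points k l" using B partition_onD1[OF part(1)] by auto
    then obtain B' where B': "B' \<in> q" "b \<in> B'" using partition_onD1[OF part(2)] by auto
    have "saturated q (Upper -` B) (Lower -` B)"
      using eq[OF sub[OF B part(1)]] own[OF B part(1)] by simp
    then have "B' \<subseteq> B" using B' b unfolding saturated_def trace by blast
    moreover have "saturated p (Upper -` B') (Lower -` B')"
      using eq[OF sub[OF B'(1) part(2)]] own[OF B'(1) part(2)] by simp
    then have "B \<subseteq> B'" using B B' b unfolding saturated_def trace by blast
    ultimately show ?thesis using B' by simp
  qed
  from this[of p q] this[of q p] show ?thesis using p eq by blast
qed

section \<open>Stacking as a product of 0-1-matrices\<close>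

lemma Union_stack_blocks:
  assumes "p \<in> partitions k l" "q \<in> partitions l m"
  shows "\<Union> (stack_blocks q p) = Top ` {1..k} \<union> Middle ` {1..l} \<union> Bottom ` {1..m}"
proof -
  have "\<Union> (stack_blocks q p) = above ` (\<Union> p) \<union> below ` (\<Union> q)"
    by (auto simp: stack_blocks_def)
  moreover have "\<Union> p = points k l" "\<Union> q = points l m"
    using assms partition_onD1 by (auto simp: partitions_def)
  ultimately show ?thesis by (auto simp: points_def image_Un image_image)
qed

abbreviation block_rel :: "'a set set \<Rightarrow> ('a \<times> 'a) set" where
  "block_rel S \<equiv> {(x, y). \<exists>b\<in>S. x \<in> b \<and> y \<in> b}"

lemma equiv_block_rel: "equiv (\<Union> S) ((block_rel S)\<^sup>+)"
proof (rule equivI)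
  have sub: "block_rel S \<subseteq> \<Union> S \<times> \<Union> S" by auto
  then show "(block_rel S)\<^sup>+ \<subseteq> \<Union> S \<times> \<Union> S" by (rule trancl_subset_Sigma)
  show "refl_on (\<Union> S) ((block_rel S)\<^sup>+)"
    by (auto intro!: refl_onI r_into_trancl)
  have "sym (block_rel S)" by (auto simp: sym_def)
  then show "sym ((block_rel S)\<^sup>+)" by (rule sym_trancl)
  show "trans ((block_rel S)\<^sup>+)" by (rule trans_trancl)
qed

lemma partition_on_stack_components:
  "partition_on (\<Union> (stack_blocks q p)) (stack_components q p)"
  unfolding stack_components_def by (rule partition_on_quotient[OF equiv_block_rel])

text \<open>A set that respects the blocks is invariant under the generating relation, hence under
  its transitive closure; conversely each non-empty block lies in one component.\<close>

lemma stack_components_saturated: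
  "(\<forall>K\<in>stack_components q p. K \<subseteq> S \<or> K \<inter> S = {}) \<longleftrightarrow>
    (\<forall>b\<in>stack_blocks q p. b \<subseteq> S \<or> b \<inter> S = {})" (is "?l \<longleftrightarrow> ?r")
proof
  let ?R = "block_rel (stack_blocks q p)"
  assume l: ?l
  show ?r
  proof
    fix b assume b: "b \<in> stack_blocks q p"
    show "b \<subseteq> S \<or> b \<inter> S = {}"
    proof (cases "b = {}")
      case False
      then obtain x where x: "x \<in> b" by blast
      have "?R\<^sup>+ `` {x} \<in> stack_components q p"
        unfolding stack_components_def using b x by (auto intro: quotientI)
      moreover have "b \<subseteq> ?R\<^sup>+ `` {x}" using b x by (auto intro!: r_into_trancl)
      ultimately show ?thesis using l by blast
    qed auto
  qed
next
  let ?R = "block_rel (stack_blocks q p)"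
  assume r: ?r
  have step: "x \<in> S \<longleftrightarrow> y \<in> S" if "(x, y) \<in> ?R" for x y using that r by blast
  have "x \<in> S \<longleftrightarrow> y \<in> S" if "(x, y) \<in> ?R\<^sup>+" for x y
    using that by (induction rule: trancl_induct) (use step in blast)+
  then show ?l
    by (auto simp: stack_components_def elim!: quotientE)
qed

text \<open>A labelling of the stack consists of labels \<open>X\<close>, \<open>Z\<close>,
  \<open>Y\<close> of its three rows. Each block lies in two adjacent rows, so the condition splits
  into one for \<open>p\<close> and one for \<open>q\<close>.\<close>

lemma stack_blocks_saturated:
  "(\<forall>b\<in>stack_blocks q p. b \<subseteq> Top ` X \<union> Middle ` Z \<union> Bottom ` Y \<or>
      b \<inter> (Top ` X \<union> Middle ` Z \<union> Bottom ` Y) = {}) \<longleftrightarrow> saturated p X Z \<and> saturated q Z Y"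
proof -
  let ?S = "Top ` X \<union> Middle ` Z \<union> Bottom ` Y"
  have a: "above b \<in> ?S \<longleftrightarrow> b \<in> Upper ` X \<union> Lower ` Z" for b by (cases b) auto
  have b: "below b \<in> ?S \<longleftrightarrow> b \<in> Upper ` Z \<union> Lower ` Y" for b by (cases b) auto
  have gen: "(f ` B \<subseteq> S \<or> f ` B \<inter> S = {}) \<longleftrightarrow> (B \<subseteq> T \<or> B \<inter> T = {})"
    if "\<And>b. f b \<in> S \<longleftrightarrow> b \<in> T" for f :: "point \<Rightarrow> stack_point" and B S T
    using that by blast
  have "(above ` B \<subseteq> ?S \<or> above ` B \<inter> ?S = {}) \<longleftrightarrow>
      (B \<subseteq> Upper ` X \<union> Lower ` Z \<or> B \<inter> (Upper ` X \<union> Lower ` Z) = {})" for B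
    by (rule gen[OF a])
  moreover have "(below ` B \<subseteq> ?S \<or> below ` B \<inter> ?S = {}) \<longleftrightarrow>
      (B \<subseteq> Upper ` Z \<union> Lower ` Y \<or> B \<inter> (Upper ` Z \<union> Lower ` Y) = {})" for B
    by (rule gen[OF b])
  ultimately show ?thesis
    unfolding saturated_def stack_blocks_def by (simp add: ball_Un)
qed

lemma diagram_comp_partitions:
  assumes "p \<in> partitions k l" "q \<in> partitions l m"
  shows "diagram_comp q p \<in> partitions k m"
proof -
  have "outer -` (\<Union> (stack_blocks q p)) = points k m"
    unfolding Union_stack_blocks[OF assms]
  proof (intro set_eqI iffI)
    fix x assume "x \<in> outer -` (Top ` {1..k} \<union> Middle ` {1..l} \<union> Bottom ` {1..m})"
    then show "x \<in> points k m" by (cases x) (auto simp: points_def)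
  qed (auto simp: points_def)
  then show ?thesis
    using partition_on_vimage[OF partition_on_stack_components, of outer q p]
    by (simp add: partitions_def diagram_comp_def)
qed

text \<open>The entry of the matrix product counts the labellings \<open>Z\<close> of the middle
  row. On a component that reaches an outer point the label is forced, and it is consistent exactly
  if the outer points of the component have equal labels; the components of middle points alone are
  labelled freely, which gives the power of 2.\<close>

lemma card_middle:
  assumes p: "p \<in> partitions k l" and q: "q \<in> partitions l m"
    and XY: "X \<subseteq> {1..k}" "Y \<subseteq> {1..m}"
  shows "card {Z. Z \<subseteq> {1..l} \<and> saturated p X Z \<and> saturated q Z Y} =
    (if saturated (diagram_comp q p) X Y then 2 ^ loops q p else 0)"
proof -
  let ?C = "stack_components q p"
  define S where "S Z = Top ` X \<union> Middle ` Z \<union> Bottom ` Y" for Z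
  define Zs where "Zs = {Z. Z \<subseteq> {1..l} \<and> (\<forall>K\<in>?C. K \<subseteq> S Z \<or> K \<inter> S Z = {})}"
  define I where "I = {K \<in> ?C. K \<subseteq> range Middle}"
  define T where "T = Top ` X \<union> Bottom ` Y"
  define U where "U = Upper ` X \<union> Lower ` Y"
  have Zs: "{Z. Z \<subseteq> {1..l} \<and> saturated p X Z \<and> saturated q Z Y} = Zs"
    unfolding Zs_def stack_components_saturated S_def stack_blocks_saturated by simp
  have part: "partition_on (Top ` {1..k} \<union> Middle ` {1..l} \<union> Bottom ` {1..m}) ?C"
    using partition_on_stack_components[of q p] Union_stack_blocks[OF p q] by simp
  have disj: "K = K'" if "K \<in> ?C" "K' \<in> ?C" "x \<in> K" "x \<in> K'" for K K' x
    using that partition_onD2[OF part] unfolding disjoint_def by blast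
  have ne: "K \<noteq> {}" if "K \<in> ?C" for K using that partition_onD3[OF part] by blast
  have sat: "saturated (diagram_comp q p) X Y \<longleftrightarrow>
      (\<forall>K\<in>?C. outer -` K \<subseteq> U \<or> outer -` K \<inter> U = {})"
  proof -
    have "(\<forall>B\<in>F ` A - {{}}. P B) \<longleftrightarrow> (\<forall>K\<in>A. P (F K))" if "P {}"
      for P and F :: "stack_point set \<Rightarrow> point set" and A using that by (auto; metis)
    then show ?thesis unfolding saturated_def diagram_comp_def U_def by simp
  qed
  have outer: "outer x \<in> S Z \<longleftrightarrow> x \<in> U" "outer x \<in> T \<longleftrightarrow> x \<in> U" for x Z
    by (cases x; auto simp: S_def T_def U_def)+
  have nonmid: "x \<in> range Middle \<or> x \<in> range outer" for x
    by (cases x) (auto intro: image_eqI[of _ _ "Upper _"] image_eqI[of _ _ "Lower _"])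
  have mid: "Middle z \<in> S Z \<longleftrightarrow> z \<in> Z" for z Z by (auto simp: S_def)
  show ?thesis
  proof (cases "saturated (diagram_comp q p) X Y")
    case False
    then obtain K a b where "K \<in> ?C" "outer a \<in> K" "outer b \<in> K"
      "a \<in> U" "b \<notin> U"
      unfolding sat by blast
    then have "Zs = {}" unfolding Zs_def using outer(1) by blast
    then show ?thesis using False unfolding Zs by simp
  next
    case True
    have out: "x \<in> T \<longleftrightarrow> y \<in> T" if "K \<in> ?C" "x \<in> K" "y \<in> K" "x \<notin> range Middle" "y \<notin> range Middle" for K x y
    proof -
      have "x \<in> range outer" "y \<in> range outer" using nonmid[of x] nonmid[of y] that by simp_all
      then obtain x' y' where "x = outer x'" "y = outer y'" by blast
      then show ?thesis using that True outer(2) unfolding sat by blast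
    qed
    \<comment> \<open>\<open>J\<close> selects the inner components that lie in the labelled set. To
      their points \<open>f J\<close> adds the middle points of those outer components that meet
      \<open>T\<close>, where the outer labels leave no choice.\<close>
    define f where "f J = {z. Middle z \<in> \<Union>J \<or> (\<exists>K\<in>?C - I. Middle z \<in> K \<and> K \<inter> T \<noteq> {})}" for J
    define g where "g Z = {K\<in>I. K \<subseteq> S Z}" for Z
    have fK: "Middle z \<in> K \<Longrightarrow> z \<in> f J \<longleftrightarrow> (if K \<in> I then K \<in> J else K \<inter> T \<noteq> {})"
      if "J \<subseteq> I" "K \<in> ?C" for z J K
    proof -
      assume z: "Middle z \<in> K"
      have uniq: "K' = K" if "K' \<in> ?C" "Middle z \<in> K'" for K'
        using disj[OF that(1) \<open>K \<in> ?C\<close> that(2) z] .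
      have "J \<subseteq> ?C" using that(1) unfolding I_def by blast
      then have "Middle z \<in> \<Union>J \<longleftrightarrow> K \<in> J" using uniq z by blast
      moreover have "(\<exists>K'\<in>?C - I. Middle z \<in> K' \<and> K' \<inter> T \<noteq> {}) \<longleftrightarrow> K \<notin> I \<and> K \<inter> T \<noteq> {}"
        using uniq z that(2) by blast
      ultimately show ?thesis using that(1) unfolding f_def by (cases "K \<in> I") auto
    qed
    have SK: "x \<in> S Z \<longleftrightarrow> x \<in> T" if "x \<notin> range Middle" for x Z
      using that by (auto simp: S_def T_def)
    have KI: "K \<subseteq> S (f J) \<longleftrightarrow> K \<in> J" "K \<notin> J \<longrightarrow> K \<inter> S (f J) = {}" if "J \<subseteq> I" "K \<in> I" for K J
    proof -
      have m: "x \<in> S (f J) \<longleftrightarrow> K \<in> J" if x: "x \<in> K" for x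
      proof -
        obtain z where "x = Middle z" using \<open>K \<in> I\<close> x by (auto simp: I_def)
        then show ?thesis using fK[of J K z] x \<open>J \<subseteq> I\<close> \<open>K \<in> I\<close> by (auto simp: mid I_def)
      qed
      then show "K \<subseteq> S (f J) \<longleftrightarrow> K \<in> J" using ne \<open>K \<in> I\<close> unfolding I_def by blast
      show "K \<notin> J \<longrightarrow> K \<inter> S (f J) = {}" using m by blast
    qed
    have KO: "K \<subseteq> S (f J) \<or> K \<inter> S (f J) = {}" if "J \<subseteq> I" "K \<in> ?C" "K \<notin> I" for J K
    proof -
      have "x \<in> S (f J) \<longleftrightarrow> K \<inter> T \<noteq> {}" if x: "x \<in> K" for x
      proof (cases "x \<in> range Middle")
        case True
        then show ?thesis using fK[OF \<open>J \<subseteq> I\<close> \<open>K \<in> ?C\<close>] x \<open>K \<notin> I\<close> by (auto simp: mid)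
      next
        case False
        have "y \<in> T \<Longrightarrow> y \<in> K \<Longrightarrow> x \<in> T" for y
          using out[OF \<open>K \<in> ?C\<close> x _ False, of y] by (auto simp: T_def)
        then show ?thesis using SK[OF False] x by blast
      qed
      then show ?thesis by blast
    qed
    have fZ: "f J \<in> Zs" if J: "J \<subseteq> I" for J
    proof -
      have "f J \<subseteq> {1..l}"
        using J partition_onD1[OF part] unfolding f_def I_def by blast
      moreover have "K \<subseteq> S (f J) \<or> K \<inter> S (f J) = {}" if "K \<in> ?C" for K
        using KI[OF J] KO[OF J that] by blast
      ultimately show ?thesis unfolding Zs_def by blast
    qed
    have gf: "g (f J) = J" if J: "J \<subseteq> I" for J
      using J KI(1)[OF J] unfolding g_def by blast
    have fg: "f (g Z) = Z" if Z: "Z \<in> Zs" for Z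
    proof (intro set_eqI)
      fix z
      show "z \<in> f (g Z) \<longleftrightarrow> z \<in> Z"
      proof (cases "z \<in> {1..l}")
        case False
        have "f (g Z) \<subseteq> {1..l}" using fZ[of "g Z"] unfolding Zs_def g_def by blast
        moreover have "Z \<subseteq> {1..l}" using Z unfolding Zs_def by blast
        ultimately show ?thesis using False by blast
      next
        case True
        then have "Middle z \<in> \<Union> ?C" using partition_onD1[OF part] by blast
        then obtain K where K: "K \<in> ?C" "Middle z \<in> K" by blast
        have zK: "z \<in> Z \<longleftrightarrow> K \<subseteq> S Z" "z \<in> Z \<longleftrightarrow> K \<inter> S Z \<noteq> {}" using K Z mid unfolding Zs_def by blast+
        have "z \<in> f (g Z) \<longleftrightarrow> (if K \<in> I then K \<in> g Z else K \<inter> T \<noteq> {})"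
          using fK[of "g Z" K z] K by (auto simp: g_def)
        also have "\<dots> \<longleftrightarrow> z \<in> Z"
        proof (cases "K \<in> I")
          case True then show ?thesis using zK by (simp add: g_def)
        next
          case False
          then obtain x where x: "x \<in> K" "x \<notin> range Middle" using K unfolding I_def by blast
          have "K \<inter> T \<noteq> {} \<Longrightarrow> K \<inter> S Z \<noteq> {}" by (auto simp: S_def T_def)
          moreover have "x \<in> T" if "K \<subseteq> S Z" using SK[OF x(2)] x that by blast
          ultimately show ?thesis using zK False x by auto
        qed
        finally show ?thesis .
      qed
    qed
    have "bij_betw f (Pow I) Zs"
      by (rule bij_betw_byWitness[where f' = g]) (use fZ gf fg in \<open>auto simp: g_def\<close>)
    then have "card Zs = card (Pow I)" using bij_betw_same_card by fastforce
    moreover have "finite I"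
      using finite_elements[OF _ part] by (simp add: I_def)
    ultimately show ?thesis using True unfolding Zs by (simp add: card_Pow loops_def I_def)
  qed
qed

text \<open>The empty pair is saturated for every diagram, so its entry is a pure power of 2 and
  isolates the number of loops; the remaining entries determine the diagram.\<close>

lemma diagram_comp_eqI:
  assumes "p \<in> partitions k l" "q \<in> partitions l m" "r \<in> partitions k m"
    and c: "\<And>X Y. X \<subseteq> {1..k} \<Longrightarrow> Y \<subseteq> {1..m} \<Longrightarrow>
      card {Z. Z \<subseteq> {1..l} \<and> saturated p X Z \<and> saturated q Z Y} = (if saturated r X Y then 2 ^ c else 0)"
  shows "diagram_comp q p = r" "loops q p = c"
proof -
  have eq: "(if saturated (diagram_comp q p) X Y then 2 ^ loops q p else 0) =
      (if saturated r X Y then 2 ^ c else (0::nat))" if "X \<subseteq> {1..k}" "Y \<subseteq> {1..m}" for X Y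
    using c[OF that] card_middle[OF assms(1,2) that] by simp
  show "loops q p = c" using eq[of "{}" "{}"] by simp
  show "diagram_comp q p = r"
  proof (rule partitions_eqI[OF diagram_comp_partitions[OF assms(1,2)] assms(3)])
    fix X Y assume "X \<subseteq> {1..k}" "Y \<subseteq> {1..m}"
    from eq[OF this] show "saturated (diagram_comp q p) X Y \<longleftrightarrow> saturated r X Y"
      by (simp split: if_splits)
  qed
qed

lemma diagram_comp_cong:
  assumes "p \<in> partitions k l" "q \<in> partitions l m" "p' \<in> partitions k l'" "q' \<in> partitions l' m"
    and "\<And>X Y. X \<subseteq> {1..k} \<Longrightarrow> Y \<subseteq> {1..m} \<Longrightarrow>
      card {Z. Z \<subseteq> {1..l} \<and> saturated p X Z \<and> saturated q Z Y} =
      card {Z. Z \<subseteq> {1..l'} \<and> saturated p' X Z \<and> saturated q' Z Y}"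
  shows "diagram_comp q p = diagram_comp q' p'" "loops q p = loops q' p'"
proof -
  have "card {Z. Z \<subseteq> {1..l} \<and> saturated p X Z \<and> saturated q Z Y} =
      (if saturated (diagram_comp q' p') X Y then 2 ^ loops q' p' else 0)"
    if "X \<subseteq> {1..k}" "Y \<subseteq> {1..m}" for X Y
    using assms(5)[OF that] card_middle[OF assms(3,4) that] by simp
  note * = diagram_comp_eqI[OF assms(1,2) diagram_comp_partitions[OF assms(3,4)] this]
  show "diagram_comp q p = diagram_comp q' p'" "loops q p = loops q' p'"
    using * by blast+
qed

lemma card_middle_sum:
  assumes "p \<in> partitions k l" "q \<in> partitions l m" "X \<subseteq> {1..k}" "Y \<subseteq> {1..m}"
  shows "(\<Sum>Z\<in>Pow {1..l}. of_bool (saturated p X Z) * of_bool (saturated q Z Y)) =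
    2 ^ loops q p * (of_bool (saturated (diagram_comp q p) X Y) :: nat)"
proof -
  have "(\<Sum>Z\<in>Pow {1..l}. of_bool (saturated p X Z) * of_bool (saturated q Z Y)) =
      (\<Sum>Z\<in>Pow {1..l}. (of_bool (saturated p X Z \<and> saturated q Z Y) :: nat))"
    by (intro sum.cong) auto
  also have "\<dots> = card {Z. Z \<subseteq> {1..l} \<and> saturated p X Z \<and> saturated q Z Y}"
    by (simp add: Pow_def Int_def)
  finally show ?thesis using card_middle[OF assms] by simp
qed

text \<open>Both sides come from the same threefold matrix product. Its entry at the empty labels
  compares the loop counts, after which all entries compare the diagrams; the components of a stack
  of three diagrams are never examined.\<close>

lemma diagram_comp_assoc:
  assumes p: "p \<in> partitions k l" and q: "q \<in> partitions l m" and r: "r \<in> partitions m n"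
  shows "diagram_comp (diagram_comp r q) p = diagram_comp r (diagram_comp q p)"
    and "loops r q + loops (diagram_comp r q) p = loops q p + loops r (diagram_comp q p)"
proof -
  let ?b = "\<lambda>p X Y. of_bool (saturated p X Y) :: nat"
  have qp: "diagram_comp q p \<in> partitions k m" and rq: "diagram_comp r q \<in> partitions l n"
    using diagram_comp_partitions assms by blast+
  have eq: "2 ^ (loops r q + loops (diagram_comp r q) p) * ?b (diagram_comp (diagram_comp r q) p) X Y =
      2 ^ (loops q p + loops r (diagram_comp q p)) * ?b (diagram_comp r (diagram_comp q p)) X Y"
    if X: "X \<subseteq> {1..k}" and Y: "Y \<subseteq> {1..n}" for X Y
  proof -
    have "2 ^ (loops r q + loops (diagram_comp r q) p) * ?b (diagram_comp (diagram_comp r q) p) X Y =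
        (\<Sum>Z\<in>Pow {1..l}. ?b p X Z * (2 ^ loops r q * ?b (diagram_comp r q) Z Y))"
      by (simp only: power_add mult.assoc card_middle_sum[OF p rq X Y, symmetric]
          sum_distrib_left mult.left_commute)
    also have "\<dots> = (\<Sum>Z\<in>Pow {1..l}. ?b p X Z * (\<Sum>W\<in>Pow {1..m}. ?b q Z W * ?b r W Y))"
      by (intro sum.cong refl) (simp only: card_middle_sum[OF q r _ Y] Pow_iff)
    also have "\<dots> = (\<Sum>Z\<in>Pow {1..l}. \<Sum>W\<in>Pow {1..m}. ?b p X Z * ?b q Z W * ?b r W Y)"
      by (simp only: sum_distrib_left mult.assoc)
    also have "\<dots> = (\<Sum>W\<in>Pow {1..m}. \<Sum>Z\<in>Pow {1..l}. ?b p X Z * ?b q Z W * ?b r W Y)"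
      by (rule sum.swap)
    also have "\<dots> = (\<Sum>W\<in>Pow {1..m}. (\<Sum>Z\<in>Pow {1..l}. ?b p X Z * ?b q Z W) * ?b r W Y)"
      by (simp only: sum_distrib_right)
    also have "\<dots> = (\<Sum>W\<in>Pow {1..m}. (2 ^ loops q p * ?b (diagram_comp q p) X W) * ?b r W Y)"
      by (intro sum.cong refl) (simp only: card_middle_sum[OF p q X] Pow_iff)
    also have "\<dots> = 2 ^ (loops q p + loops r (diagram_comp q p)) * ?b (diagram_comp r (diagram_comp q p)) X Y"
      by (simp only: power_add mult.assoc card_middle_sum[OF qp r X Y, symmetric] sum_distrib_left)
    finally show ?thesis .
  qed
  show "loops r q + loops (diagram_comp r q) p = loops q p + loops r (diagram_comp q p)"
    using eq[of "{}" "{}"] by simp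
  show "diagram_comp (diagram_comp r q) p = diagram_comp r (diagram_comp q p)"
  proof (rule partitions_eqI[OF diagram_comp_partitions[OF p rq] diagram_comp_partitions[OF qp r]])
    fix X Y assume "X \<subseteq> {1..k}" "Y \<subseteq> {1..n}"
    from eq[OF this] show "saturated (diagram_comp (diagram_comp r q) p) X Y \<longleftrightarrow>
        saturated (diagram_comp r (diagram_comp q p)) X Y"
      by (simp split: if_splits add: of_bool_def)
  qed
qed

section \<open>Reflection of diagrams\<close>

fun flip_point :: "point \<Rightarrow> point" where
  "flip_point (Upper i) = Lower i"
| "flip_point (Lower i) = Upper i"

definition flip :: "diagram \<Rightarrow> diagram" where
  "flip p = (`) flip_point ` p"

lemma flip_point_flip_point [simp]: "flip_point (flip_point x) = x"
  by (cases x) auto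

lemma flip_flip [simp]: "flip (flip p) = p"
  by (simp add: flip_def image_image)

lemma flip_partitions: "p \<in> partitions k l \<Longrightarrow> flip p \<in> partitions l k"
proof -
  assume p: "p \<in> partitions k l"
  have "inj_on flip_point A" for A by (metis flip_point_flip_point inj_on_inverseI)
  moreover have "flip_point ` points k l = points l k"
    by (auto simp: points_def image_Un image_image)
  moreover have "(`) flip_point ` p - {{}} = (`) flip_point ` p"
    using p partition_onD3 by (auto simp: partitions_def)
  ultimately show ?thesis
    using partition_on_inj_image[of "points k l" p flip_point] p
    by (auto simp: partitions_def flip_def)
qed

lemma saturated_flip: "saturated (flip p) Y X \<longleftrightarrow> saturated p X Y"
proof -
  have "flip_point b \<in> Upper ` Y \<union> Lower ` X \<longleftrightarrow> b \<in> Upper ` X \<union> Lower ` Y" for b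
    by (cases b) auto
  moreover have gen: "(f ` B \<subseteq> S \<or> f ` B \<inter> S = {}) \<longleftrightarrow> (B \<subseteq> T \<or> B \<inter> T = {})"
    if "\<And>b. f b \<in> S \<longleftrightarrow> b \<in> T" for f :: "point \<Rightarrow> point" and B S T
    using that by blast
  ultimately have "(flip_point ` B \<subseteq> Upper ` Y \<union> Lower ` X \<or> flip_point ` B \<inter> (Upper ` Y \<union> Lower ` X) = {})
    \<longleftrightarrow> (B \<subseteq> Upper ` X \<union> Lower ` Y \<or> B \<inter> (Upper ` X \<union> Lower ` Y) = {})" for B
    by (intro gen) simp
  then show ?thesis by (simp add: saturated_def flip_def)
qed

lemma flip_diagram_comp:
  assumes "p \<in> partitions k l" "q \<in> partitions l m"
  shows "diagram_comp (flip p) (flip q) = flip (diagram_comp q p)" "loops (flip p) (flip q) = loops q p"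
proof -
  have "card {Z. Z \<subseteq> {1..l} \<and> saturated (flip q) X Z \<and> saturated (flip p) Z Y} =
      (if saturated (flip (diagram_comp q p)) X Y then 2 ^ loops q p else 0)"
    if "X \<subseteq> {1..m}" "Y \<subseteq> {1..k}" for X Y
    using card_middle[OF assms that(2,1)] by (simp add: saturated_flip conj_commute)
  note * = diagram_comp_eqI[OF flip_partitions[OF assms(2)] flip_partitions[OF assms(1)]
      flip_partitions[OF diagram_comp_partitions[OF assms]] this]
  show "diagram_comp (flip p) (flip q) = flip (diagram_comp q p)" "loops (flip p) (flip q) = loops q p"
    using * by blast+
qed

lemma saturated_id_diagram:
  assumes "X \<subseteq> {1..k}" "Y \<subseteq> {1..k}"
  shows "saturated (id_diagram k) X Y \<longleftrightarrow> X = Y"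
  using assms unfolding saturated_def id_diagram_def by (auto simp: subset_iff image_iff) blast+

section \<open>Closure of non-crossing partitions under composition\<close>

text \<open>Non-crossing for a relation on points of a line instead of a set of blocks. It also
  applies to the intermediate stages of gluing, in which points of both diagrams occur and some have
  been removed.\<close>

definition noncrossing_rel :: "('a \<Rightarrow> nat) \<Rightarrow> 'a set \<Rightarrow> ('a \<Rightarrow> 'a \<Rightarrow> bool) \<Rightarrow> bool" where
  "noncrossing_rel pos S E \<longleftrightarrow>
     (\<forall>a\<in>S. \<forall>b\<in>S. \<forall>c\<in>S. \<forall>d\<in>S. pos a < pos b \<and> pos b < pos c \<and> pos c < pos d \<and> E a c \<and> E b d \<longrightarrow> E a b)"

definition merge :: "'a \<Rightarrow> 'a \<Rightarrow> ('a \<Rightarrow> 'a \<Rightarrow> bool) \<Rightarrow> 'a \<Rightarrow> 'a \<Rightarrow> bool" where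
  "merge x y E u v \<longleftrightarrow> E u v \<or> E u x \<and> E y v \<or> E u y \<and> E x v"

text \<open>\<open>x\<close> and \<open>y\<close> are neighbours, so a pair of remaining points
  encloses \<open>x\<close> exactly if it encloses \<open>y\<close>. A crossing made of links
  through \<open>x\<close> and \<open>y\<close> therefore comes from a crossing for \<open>E\<close>
  with \<open>x\<close> or \<open>y\<close> among its four points.\<close>

lemma noncrossing_merge:
  assumes E: "symp E" "transp E" and nc: "noncrossing_rel pos S E" and inj: "inj_on pos S"
    and xy: "x \<in> S" "y \<in> S" "pos x < pos y" "\<And>z. z \<in> S \<Longrightarrow> pos z \<le> pos x \<or> pos y \<le> pos z"
  shows "noncrossing_rel pos (S - {x, y}) (merge x y E)"
  unfolding noncrossing_rel_def
proof (intro ballI impI, elim conjE)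
  fix a b c d
  assume S: "a \<in> S - {x, y}" "b \<in> S - {x, y}" "c \<in> S - {x, y}" "d \<in> S - {x, y}"
    and o: "pos a < pos b" "pos b < pos c" "pos c < pos d"
    and ac: "merge x y E a c" and bd: "merge x y E b d"
  have sides: "pos z < pos x \<or> pos y < pos z" if "z \<in> S - {x, y}" for z
    using that xy inj unfolding inj_on_def by (metis DiffD1 DiffD2 insertCI le_neq_implies_less)
  have sym: "E v u" if "E u v" for u v using E(1) that by (rule sympD)
  have trans: "E u w" if "E u v" "E v w" for u v w using E(2) that by (rule transpD)
  have nc: "E u v" if "u \<in> S" "v \<in> S" "w \<in> S" "z \<in> S" "pos u < pos v" "pos v < pos w" "pos w < pos z" "E u w" "E v z"
    for u v w z using nc that unfolding noncrossing_rel_def by blast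
  define sep where "sep u v w \<longleftrightarrow> pos u < pos w \<and> pos w < pos v \<or> pos v < pos w \<and> pos w < pos u" for u v w
  have eqI: "u = v" if "u \<in> S" "v \<in> S" "pos u = pos v" for u v
    using inj that by (meson inj_onD)
  \<comment> \<open>A link from \<open>u\<close> to \<open>v\<close> with \<open>w\<close> inside
    and \<open>z\<close> outside crosses the link from \<open>w\<close> to \<open>z\<close>; the
    four cases are the possible orders of the points.\<close>
  have cross: "E u w" if h: "u \<in> S" "v \<in> S" "w \<in> S" "z \<in> S" "E u v" "E w z" "sep u v w" "\<not> sep u v z"
    for u v w z
  proof (cases "z = u \<or> z = v")
    case True
    then show ?thesis using h(5,6) sym trans by metis
  next
    case False
    then have "pos z \<noteq> pos u" "pos z \<noteq> pos v" using eqI h by auto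
    then consider "pos z < pos u" "pos u < pos w" "pos w < pos v" | "pos u < pos w" "pos w < pos v" "pos v < pos z"
      | "pos z < pos v" "pos v < pos w" "pos w < pos u" | "pos v < pos w" "pos w < pos u" "pos u < pos z"
      using h(7,8) unfolding sep_def by linarith
    then show ?thesis
    proof cases
      case 1 then show ?thesis using nc[of z u w v] h sym trans by metis
    next
      case 2 then show ?thesis using nc[of u w v z] h sym trans by metis
    next
      case 3 then show ?thesis using nc[of z v w u] h sym trans by metis
    next
      case 4 then show ?thesis using nc[of v w u z] h sym trans by metis
    qed
  qed
  have same: "sep u v x \<longleftrightarrow> sep u v y" if "u \<in> S - {x, y}" "v \<in> S - {x, y}" for u v
    using sides[OF that(1)] sides[OF that(2)] xy(3) unfolding sep_def by auto
  have S': "a \<in> S" "b \<in> S" "c \<in> S" "d \<in> S" using S by auto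
  have sep: "sep a c b" "\<not> sep a c d" "sep b d c" "\<not> sep b d a" using o by (auto simp: sep_def)
  \<comment> \<open>The link from \<open>a\<close> to \<open>c\<close> runs through the merged pair,
    the one from \<open>b\<close> to \<open>d\<close> is direct. Both merged points lie on the same
    side of \<open>b\<close> and \<open>d\<close>; if they lie between, the crossing is with the
    part from \<open>a\<close> to \<open>u\<close>, otherwise with the part from \<open>v\<close> to
    \<open>c\<close>. In \<open>mixed2\<close> the roles are exchanged.\<close>
  have mixed1: "E a b \<or> E a u \<and> E v b"
    if h: "E a u" "E v c" "E b d" "u \<in> S" "v \<in> S" "sep b d u \<longleftrightarrow> sep b d v" for u v
  proof (cases "sep b d u")
    case True
    then have "E b u" using cross[of b d u a] h S' sep sym by metis
    then show ?thesis using h sym trans by metis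
  next
    case False
    then have "E b c" using cross[of b d c v] h S' sep sym by metis
    then show ?thesis using h sym trans by metis
  qed
  have mixed2: "E a b \<or> E a v \<and> E u b"
    if h: "E a c" "E b u" "E v d" "u \<in> S" "v \<in> S" "sep a c u \<longleftrightarrow> sep a c v" for u v
  proof (cases "sep a c u")
    case True
    then have "E a v" using cross[of a c v d] h S' sep by metis
    then show ?thesis using h sym by metis
  next
    case False
    then show ?thesis using cross[of a c b u] h S' sep by metis
  qed
  show "merge x y E a b"
    using ac bd mixed1[of x y] mixed1[of y x] mixed2[of x y] mixed2[of y x] xy(1,2)
      same[OF S(1,3)] same[OF S(2,4)] cross[of a c b d] S' sep sym trans
    unfolding merge_def by (elim disjE conjE) metis+
qed

lemma noncrossingD:
  assumes "noncrossing k l p" "A \<in> p" "B \<in> p" "a \<in> A" "c \<in> A" "b \<in> B" "d \<in> B"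
    "position k l a < position k l b" "position k l b < position k l c" "position k l c < position k l d"
  shows "A = B"
  using assms unfolding noncrossing_def by blast

lemma symp_merge:
  assumes "symp E" shows "symp (merge x y E)"
proof (rule sympI)
  have sym: "E v u" if "E u v" for u v using assms that by (rule sympD)
  show "merge x y E v u" if "merge x y E u v" for u v
    using that sym unfolding merge_def by blast
qed

lemma transp_merge:
  assumes "symp E" "transp E" shows "transp (merge x y E)"
proof (rule transpI)
  have sym: "E v u" if "E u v" for u v using assms(1) that by (rule sympD)
  have trans: "E u w" if "E u v" "E v w" for u v w using assms(2) that by (rule transpD)
  show "merge x y E u w" if "merge x y E u v" "merge x y E v w" for u v w
    using that unfolding merge_def by (elim disjE conjE) (metis sym trans)+
qed

lemma inj_on_position: "inj_on (position k l) (points k l)"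
  by (auto simp: inj_on_def points_def)

lemma position_bounds: "x \<in> points k l \<Longrightarrow> 1 \<le> position k l x \<and> position k l x \<le> k + l"
  by (auto simp: points_def)

text \<open>Put the points of \<open>p\<close> and \<open>q\<close> side by side on a line. The lower point 1 of \<open>p\<close> is then adjacent to the
  upper point 1 of \<open>q\<close>; once these two are merged and removed, the points 2 are adjacent, and so on.\<close>

lemma noncrossing_diagram_comp:
  assumes p: "p \<in> NC k l" and q: "q \<in> NC l m"
  shows "diagram_comp q p \<in> NC k m"
proof -
  have pp: "p \<in> partitions k l" "q \<in> partitions l m" and nc: "noncrossing k l p" "noncrossing l m q"
    using p q by (auto simp: NC_def)
  have part: "partition_on (points k l) p" "partition_on (points l m) q"
    using pp by (auto simp: partitions_def)
  \<comment> \<open>The lower point \<open>j\<close> of \<open>p\<close> sits at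
    \<open>k + l + 1 - j\<close> and the upper point \<open>j\<close> of \<open>q\<close> at
    \<open>k + l + j\<close>. The pairs to be merged are thus nested, with the innermost pair at
    \<open>j = 1\<close>.\<close>
  define pos where "pos = case_sum (position k l) (\<lambda>x. k + l + position l m x)"
  define E0 where "E0 u v = (case (u, v) of (Inl a, Inl b) \<Rightarrow> \<exists>B\<in>p. a \<in> B \<and> b \<in> B
      | (Inr a, Inr b) \<Rightarrow> \<exists>B\<in>q. a \<in> B \<and> b \<in> B | _ \<Rightarrow> False)" for u v
  define E where "E = rec_nat E0 (\<lambda>j. merge (Inl (Lower (Suc j))) (Inr (Upper (Suc j))))"
  define S where "S = rec_nat (Inl ` points k l \<union> Inr ` points l m)
    (\<lambda>j S. S - {Inl (Lower (Suc j)), Inr (Upper (Suc j))})"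
  have E_0: "E 0 = E0" and E_Suc: "E (Suc j) = merge (Inl (Lower (Suc j))) (Inr (Upper (Suc j))) (E j)" for j
    by (simp_all add: E_def)
  have S_0: "S 0 = Inl ` points k l \<union> Inr ` points l m"
    and S_Suc: "S (Suc j) = S j - {Inl (Lower (Suc j)), Inr (Upper (Suc j))}" for j
    by (simp_all add: S_def)
  have S_mem: "x \<in> S j \<longleftrightarrow> x \<in> S 0 \<and> x \<notin> (\<lambda>i. Inl (Lower i)) ` {1..j} \<and> x \<notin> (\<lambda>i. Inr (Upper i)) ` {1..j}" for x j
    by (induction j) (auto simp: S_Suc atLeastAtMostSuc_conv)
  have inj: "inj_on pos (S j)" for j
  proof -
    have "inj_on pos (S 0)"
      unfolding S_0 inj_on_def
    proof (intro ballI impI)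
      fix x y assume "x \<in> Inl ` points k l \<union> Inr ` points l m" "y \<in> Inl ` points k l \<union> Inr ` points l m" "pos x = pos y"
      then show "x = y"
        using inj_on_position[of k l] inj_on_position[of l m] position_bounds[of _ k l] position_bounds[of _ l m]
        by (fastforce simp: pos_def inj_on_def)
    qed
    moreover have "S j \<subseteq> S 0" using S_mem by blast
    ultimately show ?thesis by (rule inj_on_subset)
  qed
  have same_block: "A = B" if "A \<in> r" "B \<in> r" "x \<in> A" "x \<in> B" "partition_on P r" for A B and r :: diagram and x P
    using that partition_onD2[OF that(5)] unfolding disjoint_def by blast
  have sym0: "symp E0"
    by (rule sympI) (auto simp: E0_def split: sum.splits)
  have trans0: "transp E0"
  proof (rule transpI)
    fix u v w assume uv: "E0 u v" "E0 v w"
    have tr: "\<exists>B\<in>r. a \<in> B \<and> c \<in> B" if h: "partition_on P r" "\<exists>B\<in>r. a \<in> B \<and> b \<in> B" "\<exists>B\<in>r. b \<in> B \<and> c \<in> B"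
      for P r and a b c :: point
    proof -
      obtain A B where AB: "A \<in> r" "a \<in> A" "b \<in> A" "B \<in> r" "b \<in> B" "c \<in> B" using h(2,3) by blast
      then have "A = B" using same_block[OF AB(1,4,3,5) h(1)] by simp
      then show ?thesis using AB by blast
    qed
    show "E0 u w"
    proof (cases v)
      case (Inl b)
      obtain a c where ac: "u = Inl a" "w = Inl c" using uv Inl by (cases u; cases w) (auto simp: E0_def)
      show ?thesis using uv unfolding E0_def Inl ac prod.case sum.case by (rule tr[OF part(1)])
    next
      case (Inr b)
      obtain a c where ac: "u = Inr a" "w = Inr c" using uv Inr by (cases u; cases w) (auto simp: E0_def)
      show ?thesis using uv unfolding E0_def Inr ac prod.case sum.case by (rule tr[OF part(2)])
    qed
  qed
  have nc0: "noncrossing_rel pos (S 0) E0"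
    unfolding noncrossing_rel_def
  proof (intro ballI impI, elim conjE)
    fix a b c d
    assume S: "a \<in> S 0" "b \<in> S 0" "c \<in> S 0" "d \<in> S 0"
      and o: "pos a < pos b" "pos b < pos c" "pos c < pos d" and e: "E0 a c" "E0 b d"
    have inl: "pos (Inl x) \<le> k + l" if "Inl x \<in> S 0" for x
      using that position_bounds[of x k l] by (auto simp: S_0 pos_def)
    have inr: "k + l < pos (Inr x)" if "Inr x \<in> S 0" for x
      using that position_bounds[of x l m] by (auto simp: S_0 pos_def)
    show "E0 a b"
    proof (cases "\<exists>c'. c = Inl c'")
      case True
      then obtain a' c' where ac: "a = Inl a'" "c = Inl c'" using e(1) by (auto simp: E0_def split: sum.splits)
      have "\<exists>b'. b = Inl b'"
      proof (cases b)
        case (Inr b') then show ?thesis using o(2) inr[of b'] inl[of c'] S ac by auto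
      qed auto
      then obtain b' d' where bd: "b = Inl b'" "d = Inl d'" using e(2) by (auto simp: E0_def split: sum.splits)
      obtain A B where AB: "A \<in> p" "B \<in> p" "a' \<in> A" "c' \<in> A" "b' \<in> B" "d' \<in> B"
        using e by (auto simp: E0_def ac bd)
      then have "A = B"
        using o by (intro noncrossingD[OF nc(1), of A B a' c' b' d']) (auto simp: pos_def ac bd)
      then show ?thesis using AB by (auto simp: E0_def ac bd)
    next
      case False
      then obtain a' c' where ac: "a = Inr a'" "c = Inr c'" using e(1) by (auto simp: E0_def split: sum.splits)
      have "\<exists>b'. b = Inr b'"
      proof (cases b)
        case (Inl b') then show ?thesis using o(1) inr[of a'] inl[of b'] S ac by auto
      qed auto
      then obtain b' d' where bd: "b = Inr b'" "d = Inr d'" using e(2) by (auto simp: E0_def split: sum.splits)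
      obtain A B where AB: "A \<in> q" "B \<in> q" "a' \<in> A" "c' \<in> A" "b' \<in> B" "d' \<in> B"
        using e by (auto simp: E0_def ac bd)
      then have "A = B"
        using o by (intro noncrossingD[OF nc(2), of A B a' c' b' d']) (auto simp: pos_def ac bd)
      then show ?thesis using AB by (auto simp: E0_def ac bd)
    qed
  qed
  have inv: "symp (E j) \<and> transp (E j)" for j
    by (induction j) (auto simp: E_0 E_Suc sym0 trans0 symp_merge transp_merge)
  have ncE: "noncrossing_rel pos (S j) (E j)" if "j \<le> l" for j
    using that
  proof (induction j)
    case 0 then show ?case using nc0 by (simp add: E_0)
  next
    case (Suc j)
    show ?case unfolding E_Suc S_Suc
    proof (rule noncrossing_merge)
      show "symp (E j)" "transp (E j)" using inv by auto
      show "noncrossing_rel pos (S j) (E j)" using Suc by simp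
      show "inj_on pos (S j)" by (rule inj)
      show "Inl (Lower (Suc j)) \<in> S j" "Inr (Upper (Suc j)) \<in> S j"
        using Suc.prems by (auto simp: S_mem S_0 points_def)
      show "pos (Inl (Lower (Suc j))) < pos (Inr (Upper (Suc j)))" by (simp add: pos_def)
      fix z assume z: "z \<in> S j"
      show "pos z \<le> pos (Inl (Lower (Suc j))) \<or> pos (Inr (Upper (Suc j))) \<le> pos z"
        using z Suc.prems by (subst (asm) S_mem) (force simp: S_0 points_def pos_def not_less_eq_eq)
    qed
  qed
  let ?R = "block_rel (stack_blocks q p)"
  \<comment> \<open>\<open>\<sigma>\<close> sends both copies of a middle point to the same point of
    the stack. Through it \<open>E_R\<close> and \<open>R_E\<close> identify \<open>E l\<close> with
    connectedness in the stack.\<close>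
  define \<sigma> where "\<sigma> = case_sum above below"
  have E_R: "(\<sigma> u, \<sigma> v) \<in> ?R\<^sup>+" if "E j u v" for j u v
    using that
  proof (induction j arbitrary: u v)
    case 0
    then have "(\<sigma> u, \<sigma> v) \<in> ?R"
      by (auto simp: E_0 E0_def \<sigma>_def stack_blocks_def split: sum.splits)
    then show ?case by blast
  next
    case (Suc j)
    have "\<sigma> (Inl (Lower (Suc j))) = \<sigma> (Inr (Upper (Suc j)))" by (simp add: \<sigma>_def)
    then show ?case using Suc unfolding E_Suc merge_def by (metis (no_types, lifting) trancl_trans)
  qed
  have E_mono: "E i u v \<Longrightarrow> i \<le> j \<Longrightarrow> E j u v" for i j u v
    by (induction j) (auto simp: E_Suc merge_def le_Suc_eq)
  have sym: "E j v u" if "E j u v" for j u v using inv that by (metis sympD)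
  have trans: "E j u w" if "E j u v" "E j v w" for j u v w using inv that by (metis transpD)
  have refl0: "E0 u u" if "u \<in> S 0" for u
    using that partition_onD1[OF part(1)] partition_onD1[OF part(2)] by (auto simp: S_0 E0_def)
  have link: "E l (Inl (Lower i)) (Inr (Upper i))" if i: "i \<in> {1..l}" for i
  proof -
    define j where "j = i - 1"
    have j: "i = Suc j" "j < l" using i by (auto simp: j_def)
    have "E j (Inl (Lower i)) (Inl (Lower i))" "E j (Inr (Upper i)) (Inr (Upper i))"
      using i by (auto intro!: E_mono[of 0 _ _ j, unfolded E_0] refl0 simp: S_0 points_def)
    then have "E (Suc j) (Inl (Lower i)) (Inr (Upper i))" by (simp add: E_Suc merge_def j(1))
    then show ?thesis using E_mono j by (meson Suc_leI)
  qed
  have glue: "E l u v" if "\<sigma> u = \<sigma> v" "u \<in> S 0" "v \<in> S 0" for u v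
  proof (cases "u = v")
    case True
    then show ?thesis using E_mono[of 0 u u l] refl0 that by (simp add: E_0)
  next
    case False
    have "(\<exists>i\<in>{1..l}. u = Inl (Lower i) \<and> v = Inr (Upper i)) \<or> (\<exists>i\<in>{1..l}. v = Inl (Lower i) \<and> u = Inr (Upper i))"
      using that False by (auto simp: S_0 points_def \<sigma>_def)
    then show ?thesis using link sym by blast
  qed
  have R_E: "E l u v" if "(s, s') \<in> ?R\<^sup>+" "\<sigma> u = s" "\<sigma> v = s'" "u \<in> S 0" "v \<in> S 0" for s s' u v
  proof -
    have step1: "E l u v" if h: "(s, s') \<in> ?R" "\<sigma> u = s" "\<sigma> v = s'" "u \<in> S 0" "v \<in> S 0" for s s' u v
    proof -
      obtain b where b: "b \<in> stack_blocks q p" "s \<in> b" "s' \<in> b" using h(1) by auto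
      obtain u' v' where "E0 u' v'" "\<sigma> u' = s" "\<sigma> v' = s'" "u' \<in> S 0" "v' \<in> S 0"
      proof -
        consider B where "B \<in> p" "b = above ` B" | B where "B \<in> q" "b = below ` B"
          using b by (auto simp: stack_blocks_def)
        then show ?thesis
        proof cases
          case 1
          then obtain a c where "a \<in> B" "c \<in> B" "s = above a" "s' = above c" using b by auto
          then show ?thesis using that[of "Inl a" "Inl c"] 1 partition_onD1[OF part(1)]
            by (auto simp: E0_def \<sigma>_def S_0)
        next
          case 2
          then obtain a c where "a \<in> B" "c \<in> B" "s = below a" "s' = below c" using b by auto
          then show ?thesis using that[of "Inr a" "Inr c"] 2 partition_onD1[OF part(2)]
            by (auto simp: E0_def \<sigma>_def S_0)
        qed
      qed
      then have "E l u' v'" "E l u u'" "E l v' v"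
        using glue[of u u'] glue[of v' v] E_mono[of 0 u' v' l] h by (auto simp: E_0)
      then show ?thesis using trans by blast
    qed
    show ?thesis using that
    proof (induction arbitrary: v rule: trancl_induct)
      case (base s')
      then show ?case by (rule step1)
    next
      case (step s' s'')
      have "s' \<in> \<Union> (stack_blocks q p)" using step.hyps(2) by auto
      then consider i where "s' = Top i" "i \<in> {1..k}" | i where "s' = Middle i" "i \<in> {1..l}"
        | i where "s' = Bottom i" "i \<in> {1..m}"
        unfolding Union_stack_blocks[OF pp] by blast
      then have "\<exists>w\<in>S 0. \<sigma> w = s'"
      proof cases
        case 1 then show ?thesis by (intro bexI[of _ "Inl (Upper i)"]) (auto simp: \<sigma>_def S_0 points_def)
      next
        case 2 then show ?thesis by (intro bexI[of _ "Inl (Lower i)"]) (auto simp: \<sigma>_def S_0 points_def)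
      next
        case 3 then show ?thesis by (intro bexI[of _ "Inr (Lower i)"]) (auto simp: \<sigma>_def S_0 points_def)
      qed
      then obtain w where "\<sigma> w = s'" "w \<in> S 0" by blast
      then show ?case using step step1 trans by blast
    qed
  qed
  have "noncrossing k m (diagram_comp q p)"
    unfolding noncrossing_def
  proof (intro notI, elim exE conjE bexE)
    fix a b c d A B
    assume o: "position k m a < position k m b" "position k m b < position k m c" "position k m c < position k m d"
      and AB: "A \<in> diagram_comp q p" "B \<in> diagram_comp q p" "A \<noteq> B" "a \<in> A" "c \<in> A" "b \<in> B" "d \<in> B"
    \<comment> \<open>What survives the \<open>l\<close> mergers are the outer points, in the same
      order as in the composite.\<close>
    define \<tau> where "\<tau> x = (case x of Upper i \<Rightarrow> Inl (Upper i) | Lower j \<Rightarrow> Inr (Lower j))" for x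
    have \<sigma>\<tau>: "\<sigma> (\<tau> x) = outer x" for x by (cases x) (auto simp: \<sigma>_def \<tau>_def)
    have "\<Union> (diagram_comp q p) = points k m"
      using diagram_comp_partitions[OF pp] partition_onD1 by (auto simp: partitions_def)
    then have pts: "a \<in> points k m" "b \<in> points k m" "c \<in> points k m" "d \<in> points k m" using AB by blast+
    have \<tau>S: "\<tau> x \<in> S l" if "x \<in> points k m" for x
      using that by (auto simp: S_mem S_0 points_def \<tau>_def)
    have pos_less: "pos (\<tau> x) < pos (\<tau> y)" if "position k m x < position k m y" "x \<in> points k m" "y \<in> points k m" for x y
      using that by (auto simp: points_def \<tau>_def pos_def)
    obtain K L where K: "A = outer -` K" "B = outer -` L" "K \<in> stack_components q p" "L \<in> stack_components q p"
      using AB by (auto simp: diagram_comp_def)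
    have rel: "(x, y) \<in> ?R\<^sup>+" if "x \<in> M" "y \<in> M" "M \<in> stack_components q p" for x y M
      using that equiv_block_rel[of "stack_blocks q p"] unfolding stack_components_def
      by (meson quotient_eq_iff)
    have SS: "S l \<subseteq> S 0" using S_mem by blast
    have ERK: "E l (\<tau> x) (\<tau> y)"
      if "M \<in> stack_components q p" "outer x \<in> M" "outer y \<in> M" "x \<in> points k m" "y \<in> points k m" for x y M
      using R_E[OF rel[OF that(2,3,1)] \<sigma>\<tau> \<sigma>\<tau>] subsetD[OF SS] \<tau>S that by blast
    have "E l (\<tau> a) (\<tau> c)" "E l (\<tau> b) (\<tau> d)"
      using AB K pts ERK[of K a c] ERK[of L b d] by auto
    then have "E l (\<tau> a) (\<tau> b)"
      using ncE[of l] o pts \<tau>S pos_less unfolding noncrossing_rel_def by blast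
    then have "(outer a, outer b) \<in> ?R\<^sup>+" using E_R[of l "\<tau> a" "\<tau> b"] by (simp add: \<sigma>\<tau>)
    moreover have "outer a \<in> K" "outer b \<in> L" using K AB by auto
    ultimately have "K = L"
      using quotient_eq_iff[OF equiv_block_rel K(3,4)[unfolded stack_components_def]] by blast
    then show False using AB K by simp
  qed
  then show ?thesis using diagram_comp_partitions[OF pp] by (simp add: NC_def)
qed

text \<open>Reflection reverses the line: corresponding positions add up to
  \<open>k + l + 1\<close>.\<close>

lemma flip_NC: "p \<in> NC k l \<Longrightarrow> flip p \<in> NC l k"
proof -
  assume p: "p \<in> NC k l"
  have part: "\<Union> p = points k l" using p partition_onD1 by (auto simp: NC_def partitions_def)
  have pos: "position l k (flip_point x) + position k l x = k + l + 1" if "x \<in> points k l" for x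
    using that by (auto simp: points_def)
  have "noncrossing l k (flip p)"
    unfolding noncrossing_def
  proof (intro notI, elim exE conjE bexE)
    fix a b c d A B
    assume o: "position l k a < position l k b" "position l k b < position l k c" "position l k c < position l k d"
      and AB: "A \<in> flip p" "B \<in> flip p" "A \<noteq> B" "a \<in> A" "c \<in> A" "b \<in> B" "d \<in> B"
    then obtain A' B' where A': "A' \<in> p" "B' \<in> p" "A = flip_point ` A'" "B = flip_point ` B'"
      by (auto simp: flip_def)
    obtain a' c' where a': "a = flip_point a'" "c = flip_point c'" "a' \<in> A'" "c' \<in> A'" using AB A' by auto
    obtain b' d' where b': "b = flip_point b'" "d = flip_point d'" "b' \<in> B'" "d' \<in> B'" using AB A' by auto
    have "a' \<in> points k l" "b' \<in> points k l" "c' \<in> points k l" "d' \<in> points k l" using a' b' A' part by blast+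
    from this[THEN pos] have "position k l d' < position k l c'" "position k l c' < position k l b'"
      "position k l b' < position k l a'"
      using o unfolding a'(1,2) b'(1,2) by linarith+
    moreover have "A' \<noteq> B'" using AB A' by auto
    ultimately show False using p A' a' b' unfolding NC_def noncrossing_def by blast
  qed
  then show ?thesis using p flip_partitions by (auto simp: NC_def)
qed

section \<open>Jones--Wenzl idempotents\<close>


text \<open>The value 0 at 0 is chosen so that, division by 0 being 0, \<open>ratio d 1 = d 1\<close>.\<close>

fun ratio :: "(nat \<Rightarrow> complex) \<Rightarrow> nat \<Rightarrow> complex" where
  "ratio d 0 = 0"
| "ratio d (Suc m) = d (Suc m) - 1 / ratio d m"

text \<open>Temperley--Lieb relations with loop values depending on the index. The multiplication
  will be the composition of arbitrary coefficient functions, on which the identity morphism does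
  not act as a unit; hence the unit laws are stated for \<open>e\<close> and the generators
  only.\<close>

locale jones_wenzl = vector_space sc for sc :: "complex \<Rightarrow> 'a::ab_group_add \<Rightarrow> 'a" +
  fixes mul :: "'a \<Rightarrow> 'a \<Rightarrow> 'a" (infixl "\<star>" 70)
    and e :: 'a and U :: "nat \<Rightarrow> 'a" and d :: "nat \<Rightarrow> complex" and M :: nat
  assumes assoc: "x \<star> y \<star> z = x \<star> (y \<star> z)"
    and add_left: "(x + y) \<star> z = x \<star> z + y \<star> z"
    and add_right: "x \<star> (y + z) = x \<star> y + x \<star> z"
    and sc_left: "sc c x \<star> y = sc c (x \<star> y)"
    and sc_right: "x \<star> sc c y = sc c (x \<star> y)"
    and ee: "e \<star> e = e"
    and eU: "1 \<le> i \<Longrightarrow> i \<le> M \<Longrightarrow> e \<star> U i = U i"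
    and Ue: "1 \<le> i \<Longrightarrow> i \<le> M \<Longrightarrow> U i \<star> e = U i"
    and UU: "1 \<le> i \<Longrightarrow> i \<le> M \<Longrightarrow> U i \<star> U i = sc (d i) (U i)"
    and UUU: "1 \<le> i \<Longrightarrow> Suc i \<le> M \<Longrightarrow> U (Suc i) \<star> (U i \<star> U (Suc i)) = U (Suc i)"
    and UU_commute: "1 \<le> i \<Longrightarrow> i + 2 \<le> j \<Longrightarrow> j \<le> M \<Longrightarrow> U i \<star> U j = U j \<star> U i"
begin

abbreviation r where "r \<equiv> ratio d"

lemma zero_left [simp]: "0 \<star> x = 0"
  using add_left[of 0 0 x] by simp

lemma zero_right [simp]: "x \<star> 0 = 0"
  using add_right[of x 0 0] by simp

lemma diff_left: "(x - y) \<star> z = x \<star> z - y \<star> z"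
  using add_left[of "x - y" y z] by (simp add: algebra_simps)

lemma diff_right: "x \<star> (y - z) = x \<star> y - x \<star> z"
  using add_right[of x "y - z" z] by (simp add: algebra_simps)

text \<open>\<open>p m\<close> is the idempotent on \<open>m\<close> strands and involves
  \<open>U 1\<close>, ..., \<open>U (m - 1)\<close>. Since \<open>1 / r 0 = 0\<close>, the first
  step gives \<open>p 1 = e\<close>, whatever \<open>U 0\<close> is.\<close>

fun p :: "nat \<Rightarrow> 'a" where
  "p 0 = e"
| "p (Suc m) = p m - sc (1 / r m) (p m \<star> (U m \<star> p m))"

lemma p_1 [simp]: "p (Suc 0) = e"
  by simp

lemma e_p: "m \<le> Suc M \<Longrightarrow> e \<star> p m = p m \<and> p m \<star> e = p m"
proof (induction m)
  case (Suc m)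
  then have IH: "e \<star> p m = p m" "p m \<star> e = p m" by auto
  have "e \<star> (p m \<star> x) = p m \<star> x" "x \<star> p m \<star> e = x \<star> p m" for x
    by (simp add: assoc[symmetric] IH) (simp add: assoc IH)
  then show ?case
    by (simp add: diff_left diff_right sc_left sc_right IH) (simp add: assoc[symmetric] IH)
qed (simp add: ee)

lemma p_commute:
  assumes "m \<le> Suc M" "z \<star> e = e \<star> z" "\<And>i. 1 \<le> i \<Longrightarrow> i < m \<Longrightarrow> z \<star> U i = U i \<star> z"
  shows "z \<star> p m = p m \<star> z"
  using assms
proof (induction m)
  case (Suc m)
  show ?case
  proof (cases m)
    case 0 then show ?thesis using Suc.prems by simp
  next
    case (Suc k)
    have pz: "z \<star> p m = p m \<star> z" using Suc.IH Suc.prems by simp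
    have Uz: "z \<star> U m = U m \<star> z" using Suc.prems Suc by simp
    have "z \<star> (p m \<star> (U m \<star> p m)) = p m \<star> (z \<star> (U m \<star> p m))"
      by (simp only: assoc[symmetric] pz)
    also have "\<dots> = p m \<star> (U m \<star> (z \<star> p m))" by (simp only: assoc[symmetric] Uz)
    also have "\<dots> = p m \<star> (U m \<star> p m) \<star> z" by (simp only: assoc pz)
    finally show ?thesis by (simp add: diff_left diff_right sc_left sc_right pz)
  qed
qed simp

text \<open>All claims are proved in one induction. The last one, the contraction of
  \<open>p m\<close> between two copies of \<open>U m\<close>, makes the correction term a multiple
  of an idempotent and produces the recursion of \<open>r\<close>.\<close>

lemma jones_wenzl:
  assumes "1 \<le> m" "m \<le> Suc M" "\<And>i. 1 \<le> i \<Longrightarrow> i < m \<Longrightarrow> r i \<noteq> 0"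
  shows "p m \<star> p m = p m" and "p m \<star> p (m - 1) = p m" and "p (m - 1) \<star> p m = p m"
    and "1 \<le> i \<Longrightarrow> i < m \<Longrightarrow> U i \<star> p m = 0" and "1 \<le> i \<Longrightarrow> i < m \<Longrightarrow> p m \<star> U i = 0"
    and "m \<le> M \<Longrightarrow> U m \<star> (p m \<star> U m) = sc (r m) (p (m - 1) \<star> U m)"
proof -
  have "p m \<star> p m = p m \<and> p m \<star> p (m - 1) = p m \<and> p (m - 1) \<star> p m = p m \<and>
    (\<forall>i. 1 \<le> i \<and> i < m \<longrightarrow> U i \<star> p m = 0 \<and> p m \<star> U i = 0) \<and>
    (m \<le> M \<longrightarrow> U m \<star> (p m \<star> U m) = sc (r m) (p (m - 1) \<star> U m))"
    using assms
  proof (induction m rule: nat_induct_at_least)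
    case base
    then show ?case by (auto simp: ee eU UU)
  next
    case (Suc m)
    let ?p = "p m" and ?U = "U m" and ?c = "1 / r m"
    define q where "q = p (m - 1)"
    define w where "w = ?p \<star> (?U \<star> ?p)"
    have m: "1 \<le> m" "m \<le> M" and r: "r m \<noteq> 0" using Suc by auto
    have IH: "?p \<star> ?p = ?p" "?p \<star> q = ?p" "q \<star> ?p = ?p"
      "\<And>i. 1 \<le> i \<Longrightarrow> i < m \<Longrightarrow> U i \<star> ?p = 0" "\<And>i. 1 \<le> i \<Longrightarrow> i < m \<Longrightarrow> ?p \<star> U i = 0"
      "?U \<star> (?p \<star> ?U) = sc (r m) (q \<star> ?U)"
      using Suc by (auto simp: q_def)
    have qU: "?U \<star> q = q \<star> ?U"
      unfolding q_def by (rule p_commute) (use m in \<open>auto simp: eU Ue intro!: UU_commute[symmetric]\<close>)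
    have pl: "?p \<star> (?p \<star> x) = ?p \<star> x" and pq: "?p \<star> (q \<star> x) = ?p \<star> x"
      and UpU: "?U \<star> (?p \<star> (?U \<star> x)) = sc (r m) (q \<star> (?U \<star> x))" for x
      using IH(1,2,6) by (metis assoc, metis assoc, metis assoc sc_left)
    have pw: "?p \<star> w = w" "w \<star> ?p = w" by (simp_all add: w_def assoc pl IH(1))
    \<comment> \<open>By the contraction of \<open>p m\<close>, \<open>w / r m\<close> is an
      idempotent below \<open>p m\<close>, so subtracting it from \<open>p m\<close> leaves an
      idempotent.\<close>
    have ww: "w \<star> w = sc (r m) w" by (simp add: w_def assoc pl UpU sc_right pq)
    have pS: "p (Suc m) = ?p - sc ?c w" by (simp add: w_def)
    have 1: "p (Suc m) \<star> p (Suc m) = p (Suc m)"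
      unfolding pS using r by (simp add: diff_left diff_right sc_left sc_right pw ww IH(1))
    have 2: "p (Suc m) \<star> ?p = p (Suc m)" "?p \<star> p (Suc m) = p (Suc m)"
      unfolding pS by (simp_all add: diff_left diff_right sc_left sc_right pw IH(1))
    have "?U \<star> w = sc (r m) (?U \<star> ?p)"
      unfolding w_def UpU by (simp add: assoc[symmetric] qU[symmetric]) (simp add: assoc IH(3))
    then have U1: "?U \<star> p (Suc m) = 0" unfolding pS using r by (simp add: diff_right sc_right)
    have "w \<star> ?U = sc (r m) (?p \<star> ?U)"
      unfolding w_def by (simp add: assoc IH(6) sc_right pq)
    then have U2: "p (Suc m) \<star> ?U = 0" unfolding pS using r by (simp add: diff_left sc_left)
    have 3: "U i \<star> p (Suc m) = 0 \<and> p (Suc m) \<star> U i = 0" if i: "1 \<le> i" "i < Suc m" for i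
    proof (cases "i = m")
      case True then show ?thesis using U1 U2 by simp
    next
      case False
      then have "i < m" using i by simp
      moreover have "U i \<star> w = U i \<star> ?p \<star> (?U \<star> ?p)" "w \<star> U i = ?p \<star> (?U \<star> (?p \<star> U i))"
        by (simp_all add: w_def assoc)
      ultimately show ?thesis unfolding pS using IH(4,5) i by (simp add: diff_left diff_right sc_left sc_right)
    qed
    \<comment> \<open>\<open>U (m + 1)\<close> commutes with \<open>p m\<close>, whose generators
      end at \<open>U (m - 1)\<close>. The two terms of \<open>p (m + 1)\<close> contribute
      \<open>d (m + 1)\<close> and, because \<open>U (m + 1) U m U (m + 1) = U (m + 1)\<close>, the
      summand \<open>- 1 / r m\<close>.\<close>
    have 4: "U (Suc m) \<star> (p (Suc m) \<star> U (Suc m)) = sc (r (Suc m)) (?p \<star> U (Suc m))" if M: "Suc m \<le> M"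
    proof -
      let ?V = "U (Suc m)"
      have pV: "?V \<star> ?p = ?p \<star> ?V"
        by (rule p_commute) (use m M in \<open>auto simp: eU Ue intro!: UU_commute[symmetric]\<close>)
      have "?V \<star> (?p \<star> ?V) = ?p \<star> (?V \<star> ?V)" by (simp only: assoc[symmetric] pV)
      then have a: "?V \<star> (?p \<star> ?V) = sc (d (Suc m)) (?p \<star> ?V)" using M by (simp add: UU sc_right)
      have "?V \<star> (w \<star> ?V) = ?V \<star> ?p \<star> (?U \<star> (?p \<star> ?V))" by (simp add: w_def assoc)
      also have "\<dots> = ?p \<star> (?V \<star> (?U \<star> (?V \<star> ?p)))" by (simp add: pV assoc)
      also have "\<dots> = ?p \<star> (?V \<star> (?U \<star> ?V) \<star> ?p)" by (simp add: assoc)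
      also have "\<dots> = ?p \<star> (?V \<star> ?p)" using UUU[OF m(1) M] by simp
      also have "\<dots> = ?p \<star> ?V" by (simp add: pV pl)
      finally show ?thesis unfolding pS
        by (simp add: diff_left diff_right sc_left sc_right a scale_left_diff_distrib)
    qed
    show ?case using 1 2 3 4 by simp
  qed
  then show "p m \<star> p m = p m" and "p m \<star> p (m - 1) = p m" and "p (m - 1) \<star> p m = p m"
    and "1 \<le> i \<Longrightarrow> i < m \<Longrightarrow> U i \<star> p m = 0" and "1 \<le> i \<Longrightarrow> i < m \<Longrightarrow> p m \<star> U i = 0"
    and "m \<le> M \<Longrightarrow> U m \<star> (p m \<star> U m) = sc (r m) (p (m - 1) \<star> U m)"
    by auto
qed

text \<open>Modulo left multiples of generators \<open>p m\<close> equals \<open>e\<close>. In one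
  application \<open>G\<close> consists of the elements whose product with a fixed morphism has
  coefficient 0 at a fixed diagram, in another it is an ideal of morphisms.\<close>

lemma p_cong_e:
  assumes "m \<le> Suc M" and G: "subspace G" "\<And>i z. 1 \<le> i \<Longrightarrow> i < m \<Longrightarrow> U i \<star> z \<in> G"
  shows "p m \<star> z - e \<star> z \<in> G"
  using assms(1) G(2)
proof (induction m arbitrary: z)
  case 0
  then show ?case using G(1) by (simp add: subspace_0)
next
  case (Suc m)
  show ?case
  proof (cases m)
    case 0 then show ?thesis using G(1) by (simp add: subspace_0)
  next
    case (Suc k)
    let ?w = "U m \<star> (p m \<star> z)"
    have "?w \<in> G" by (rule Suc.prems(2)) (use Suc in auto)
    moreover have "e \<star> U m = U m" by (rule eU) (use Suc.prems Suc in auto)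
    ultimately have w: "?w \<in> G" "e \<star> ?w = ?w" by (simp_all only: assoc[symmetric])
    have "p m \<star> ?w - e \<star> ?w \<in> G" "p m \<star> z - e \<star> z \<in> G" using Suc.IH Suc.prems by auto
    then have "p m \<star> ?w \<in> G" using subspace_add[OF G(1) _ w(1)] w(2) by fastforce
    then have "(p m \<star> z - e \<star> z) - sc (1 / r m) (p m \<star> ?w) \<in> G"
      using \<open>p m \<star> z - e \<star> z \<in> G\<close> G(1) subspace_diff subspace_scale by blast
    then show ?thesis by (simp add: diff_left sc_left assoc algebra_simps)
  qed
qed

lemma p_antiautomorphism:
  assumes "m \<le> Suc M" and "\<And>x y. st (x - y) = st x - st y" and "\<And>c x. st (sc c x) = sc c (st x)"
    and "\<And>x y. st (x \<star> y) = st y \<star> st x" and "st e = e" and "\<And>i. 1 \<le> i \<Longrightarrow> i \<le> M \<Longrightarrow> st (U i) = U i"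
  shows "st (p m) = p m"
  using assms(1)
proof (induction m)
  case (Suc m)
  then show ?case using assms(2-) by (cases m) (auto simp: assoc)
qed (simp add: assms)

end

section \<open>The category of non-crossing partitions\<close>

lemma finite_NC [simp]: "finite (NC k l)"
proof -
  have "finite (points k l)" by (simp add: points_def)
  then have "finite (partitions k l)"
    unfolding partitions_def by (rule finitely_many_partition_on)
  then show ?thesis by (rule rev_finite_subset) (auto simp: NC_def)
qed

lemma NC_partitions: "p \<in> NC k l \<Longrightarrow> p \<in> partitions k l"
  by (simp add: NC_def)

section \<open>Diagrams of maps between rows of points\<close>

definition graph :: "nat \<Rightarrow> nat \<Rightarrow> (nat \<Rightarrow> nat) \<Rightarrow> diagram" where
  "graph n m \<phi> = (\<lambda>j. insert (Lower j) (Upper ` {i\<in>{1..n}. \<phi> i = j})) ` {1..m}"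

text \<open>The blocks are the fibres of a function which, read along the order of the points, first
  increases and then decreases; this is why they do not cross.\<close>

lemma graph_NC:
  assumes mono: "mono_on {1..n} \<phi>" and range: "\<phi> ` {1..n} \<subseteq> {1..m}"
  shows "graph n m \<phi> \<in> NC n m"
proof -
  define \<kappa> where "\<kappa> x = (case x of Upper i \<Rightarrow> \<phi> i | Lower j \<Rightarrow> j)" for x
  have block: "x \<in> B \<Longrightarrow> y \<in> B \<Longrightarrow> B \<in> graph n m \<phi> \<Longrightarrow> \<kappa> x = \<kappa> y" for x y B
    by (auto simp: graph_def \<kappa>_def)
  have part: "partition_on (points n m) (graph n m \<phi>)"
    unfolding partition_on_def disjoint_def using range
    by (fastforce simp: graph_def points_def)
  have uni: "min (\<kappa> x) (\<kappa> z) \<le> \<kappa> y"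
    if "x \<in> points n m" "y \<in> points n m" "z \<in> points n m"
      "position n m x < position n m y" "position n m y < position n m z" for x y z
    using that mono range
    by (cases x; cases y; cases z)
      (auto simp: points_def \<kappa>_def mono_on_def min_le_iff_disj image_subset_iff)
  have "noncrossing n m (graph n m \<phi>)"
    unfolding noncrossing_def
  proof (intro notI, elim exE conjE bexE)
    fix a b c d A B
    assume o: "position n m a < position n m b" "position n m b < position n m c" "position n m c < position n m d"
      and AB: "A \<in> graph n m \<phi>" "B \<in> graph n m \<phi>" "A \<noteq> B" "a \<in> A" "c \<in> A" "b \<in> B" "d \<in> B"
    have pts: "a \<in> points n m" "b \<in> points n m" "c \<in> points n m" "d \<in> points n m"
      using AB partition_onD1[OF part] by blast+
    have eq: "\<kappa> a = \<kappa> c" "\<kappa> b = \<kappa> d" using block AB by blast+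
    have "\<kappa> a = \<kappa> b"
      using uni[OF pts(1-3) o(1,2)] uni[OF pts(2-4) o(2,3)] eq by auto
    have shape: "B = insert (Lower (\<kappa> x)) (Upper ` {i\<in>{1..n}. \<phi> i = \<kappa> x})" if "B \<in> graph n m \<phi>" "x \<in> B" for B x
      using that by (auto simp: graph_def \<kappa>_def)
    have "A = B" unfolding shape[OF AB(1,4)] shape[OF AB(2,6)] \<open>\<kappa> a = \<kappa> b\<close> ..
    then show False using AB by simp
  qed
  then show ?thesis using part by (simp add: NC_def partitions_def)
qed

text \<open>An upper point has the label of its image, so the matrix of the diagram is the preimage
  map on subsets. Composites of graphs and reflected graphs can thereby be computed with
  preimages.\<close>

lemma saturated_graph:
  assumes "\<phi> ` {1..n} \<subseteq> {1..m}" "X \<subseteq> {1..n}" "Y \<subseteq> {1..m}"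
  shows "saturated (graph n m \<phi>) X Y \<longleftrightarrow> X = {i\<in>{1..n}. \<phi> i \<in> Y}"
proof
  assume s: "saturated (graph n m \<phi>) X Y"
  have "i \<in> X \<longleftrightarrow> \<phi> i \<in> Y" if i: "i \<in> {1..n}" for i
  proof -
    let ?B = "insert (Lower (\<phi> i)) (Upper ` {k\<in>{1..n}. \<phi> k = \<phi> i})"
    have "?B \<in> graph n m \<phi>"
      unfolding graph_def by (rule image_eqI[of _ _ "\<phi> i"]) (use i assms(1) in \<open>auto simp: image_subset_iff\<close>)
    from s[unfolded saturated_def, rule_format, OF this]
    have "a \<in> Upper ` X \<union> Lower ` Y \<longleftrightarrow> b \<in> Upper ` X \<union> Lower ` Y" if "a \<in> ?B" "b \<in> ?B" for a b
      using that by (meson disjoint_iff subsetD)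
    from this[of "Upper i" "Lower (\<phi> i)"] i show ?thesis by auto
  qed
  then show "X = {i\<in>{1..n}. \<phi> i \<in> Y}" using assms(2) by blast
next
  assume "X = {i\<in>{1..n}. \<phi> i \<in> Y}"
  then show "saturated (graph n m \<phi>) X Y"
    by (auto simp: saturated_def graph_def)
qed

lemma id_diagram_graph: "id_diagram k = graph k k (\<lambda>i. i)"
proof -
  have "insert (Lower j) (Upper ` {i \<in> {1..k}. i = j}) = {Upper j, Lower j}" if "j \<in> {1..k}" for j
    using that by auto
  then have "graph k k (\<lambda>i. i) = (\<lambda>j. {Upper j, Lower j}) ` {1..k}"
    unfolding graph_def by (intro image_cong) auto
  then show ?thesis unfolding id_diagram_def by (auto simp: image_iff)
qed

lemma id_diagram_NC: "id_diagram k \<in> NC k k"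
  unfolding id_diagram_graph by (rule graph_NC) (auto simp: mono_on_def)

lemma diagram_comp_id:
  assumes "q \<in> partitions k l"
  shows "diagram_comp q (id_diagram k) = q" "loops q (id_diagram k) = 0"
proof -
  have "card {Z. Z \<subseteq> {1..k} \<and> saturated (id_diagram k) X Z \<and> saturated q Z Y} =
      (if saturated q X Y then 2 ^ 0 else 0)" if "X \<subseteq> {1..k}" "Y \<subseteq> {1..l}" for X Y
  proof -
    have "{Z. Z \<subseteq> {1..k} \<and> saturated (id_diagram k) X Z \<and> saturated q Z Y} =
        (if saturated q X Y then {X} else {})"
      using that saturated_id_diagram by auto
    then show ?thesis by simp
  qed
  note * = diagram_comp_eqI[OF NC_partitions[OF id_diagram_NC] assms assms this]
  show "diagram_comp q (id_diagram k) = q" "loops q (id_diagram k) = 0" using * by blast+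
qed

lemma flip_id_diagram: "flip (id_diagram k) = id_diagram k"
proof (rule partitions_eqI)
  show "id_diagram k \<in> partitions k k" "flip (id_diagram k) \<in> partitions k k"
    using id_diagram_NC NC_partitions flip_partitions by blast+
qed (auto simp: saturated_flip saturated_id_diagram)

lemma id_diagram_comp:
  assumes "q \<in> partitions k l"
  shows "diagram_comp (id_diagram l) q = q" "loops (id_diagram l) q = 0"
proof -
  have i: "id_diagram l \<in> partitions l l" using id_diagram_NC NC_partitions by blast
  show "diagram_comp (id_diagram l) q = q"
    using flip_diagram_comp(1)[OF assms i] diagram_comp_id(1)[OF flip_partitions[OF assms]]
    by (metis flip_flip flip_id_diagram)
  show "loops (id_diagram l) q = 0"
    using flip_diagram_comp(2)[OF assms i] diagram_comp_id(2)[OF flip_partitions[OF assms]]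
    by (simp add: flip_id_diagram)
qed

section \<open>Bilinear extension of the composition\<close>

definition bas :: "diagram \<Rightarrow> diagram \<Rightarrow> complex" where
  "bas p r = of_bool (r = p)"

abbreviation "rcmp t \<equiv> cmp (Rep0_NC t)"
abbreviation "rhom t \<equiv> hom (Rep0_NC t)"
abbreviation "rscl t \<equiv> scl (Rep0_NC t)"

lemma Rep0_obj [simp]: "obj (Rep0_NC t) = UNIV"
  and Rep0_hom: "rhom t k l = {f. \<forall>p. p \<notin> NC k l \<longrightarrow> f p = 0}"
  and Rep0_idm: "idm (Rep0_NC t) k = bas (id_diagram k)"
  and Rep0_scl: "rscl t = (\<lambda>c f p. c * f p)"
  by (auto simp: Rep0_NC_def bas_def fun_eq_iff)

lemma Rep0_cmp: "rcmp t k l m g f r =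
    (\<Sum>q\<in>NC l m. \<Sum>p\<in>NC k l. g q * f p * t ^ loops q p * of_bool (diagram_comp q p = r))"
  unfolding Rep0_NC_def lincat.simps by (intro sum.cong refl) (simp add: of_bool_def)

lemma Rep0_cmp_hom: "rcmp t k l m g f \<in> rhom t k m"
  unfolding Rep0_hom mem_Collect_eq Rep0_cmp
  by (intro allI impI sum.neutral ballI) (use noncrossing_diagram_comp in fastforce)

text \<open>Pairing a composite with an arbitrary weight \<open>w\<close> removes the Kronecker
  delta from its coefficients. In \<open>Rep0_cmp_assoc\<close> the weight contains the loops and
  the composite with the third factor, and the claim reduces to
  \<open>diagram_comp_assoc\<close>.\<close>

lemma Rep0_cmp_eval:
  "(\<Sum>r\<in>NC k m. rcmp t k l m g f r * w r) =
    (\<Sum>q\<in>NC l m. \<Sum>p\<in>NC k l. g q * f p * t ^ loops q p * w (diagram_comp q p))"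
proof -
  have "(\<Sum>r\<in>NC k m. rcmp t k l m g f r * w r) =
      (\<Sum>r\<in>NC k m. \<Sum>q\<in>NC l m. \<Sum>p\<in>NC k l. g q * f p * t ^ loops q p * of_bool (diagram_comp q p = r) * w r)"
    by (simp only: Rep0_cmp sum_distrib_right)
  also have "\<dots> = (\<Sum>q\<in>NC l m. \<Sum>r\<in>NC k m. \<Sum>p\<in>NC k l. g q * f p * t ^ loops q p * of_bool (diagram_comp q p = r) * w r)"
    by (rule sum.swap)
  also have "\<dots> = (\<Sum>q\<in>NC l m. \<Sum>p\<in>NC k l. \<Sum>r\<in>NC k m. g q * f p * t ^ loops q p * of_bool (diagram_comp q p = r) * w r)"
    by (intro sum.cong refl sum.swap)
  also have "\<dots> = (\<Sum>q\<in>NC l m. \<Sum>p\<in>NC k l. g q * f p * t ^ loops q p * w (diagram_comp q p))"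
  proof (intro sum.cong refl)
    fix q p assume "q \<in> NC l m" "p \<in> NC k l"
    then have c: "diagram_comp q p \<in> NC k m" using noncrossing_diagram_comp by blast
    have "(\<Sum>r\<in>NC k m. g q * f p * t ^ loops q p * of_bool (diagram_comp q p = r) * w r) =
        (\<Sum>r\<in>NC k m. if r = diagram_comp q p then g q * f p * t ^ loops q p * w r else 0)"
      by (intro sum.cong) auto
    then show "(\<Sum>r\<in>NC k m. g q * f p * t ^ loops q p * of_bool (diagram_comp q p = r) * w r) =
        g q * f p * t ^ loops q p * w (diagram_comp q p)"
      using c by simp
  qed
  finally show ?thesis .
qed

lemma Rep0_cmp_assoc:
  "rcmp t k l n (rcmp t l m n h g) f = rcmp t k m n h (rcmp t k l m g f)"
proof
  fix s
  have "rcmp t k l n (rcmp t l m n h g) f s =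
      (\<Sum>v\<in>NC l n. rcmp t l m n h g v *
        (\<Sum>p\<in>NC k l. f p * t ^ loops v p * of_bool (diagram_comp v p = s)))"
    by (simp only: Rep0_cmp[of _ _ _ _ _ f] sum_distrib_left mult.assoc)
  also have "\<dots> = (\<Sum>r\<in>NC m n. \<Sum>q\<in>NC l m. \<Sum>p\<in>NC k l. h r * g q * f p *
      t ^ (loops r q + loops (diagram_comp r q) p) * of_bool (diagram_comp (diagram_comp r q) p = s))"
    unfolding Rep0_cmp_eval by (simp add: sum_distrib_left power_add mult_ac)
  also have "\<dots> = (\<Sum>r\<in>NC m n. \<Sum>q\<in>NC l m. \<Sum>p\<in>NC k l. h r * g q * f p *
      t ^ (loops q p + loops r (diagram_comp q p)) * of_bool (diagram_comp r (diagram_comp q p) = s))"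
    by (intro sum.cong refl) (simp only: diagram_comp_assoc[OF NC_partitions NC_partitions NC_partitions])
  also have "\<dots> = (\<Sum>r\<in>NC m n. h r * (\<Sum>q\<in>NC l m. \<Sum>p\<in>NC k l. g q * f p * t ^ loops q p *
      (t ^ loops r (diagram_comp q p) * of_bool (diagram_comp r (diagram_comp q p) = s))))"
    by (simp add: sum_distrib_left power_add mult_ac)
  also have "\<dots> = (\<Sum>r\<in>NC m n. h r * (\<Sum>u\<in>NC k m. rcmp t k l m g f u *
      (t ^ loops r u * of_bool (diagram_comp r u = s))))"
    unfolding Rep0_cmp_eval ..
  also have "\<dots> = rcmp t k m n h (rcmp t k l m g f) s"
    by (simp only: Rep0_cmp[of _ _ _ _ h] sum_distrib_left mult.assoc)
  finally show "rcmp t k l n (rcmp t l m n h g) f s =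
    rcmp t k m n h (rcmp t k l m g f) s" .
qed

lemma Rep0_cmp_add_left: "rcmp t k l m (g + g') f = rcmp t k l m g f + rcmp t k l m g' f"
  and Rep0_cmp_add_right: "rcmp t k l m g (f + f') = rcmp t k l m g f + rcmp t k l m g f'"
  and Rep0_cmp_scl_left: "rcmp t k l m (rscl t c g) f = rscl t c (rcmp t k l m g f)"
  and Rep0_cmp_scl_right: "rcmp t k l m g (rscl t c f) = rscl t c (rcmp t k l m g f)"
  by (auto simp: fun_eq_iff Rep0_cmp Rep0_scl algebra_simps sum.distrib sum_distrib_left)

lemma Rep0_cmp_idm:
  assumes "f \<in> rhom t k l"
  shows "rcmp t k k l f (idm (Rep0_NC t) k) = f"
proof
  fix r
  have "rcmp t k k l f (idm (Rep0_NC t) k) r =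
      (\<Sum>q\<in>NC k l. \<Sum>p\<in>NC k k. if p = id_diagram k then f q * t ^ loops q p * of_bool (diagram_comp q p = r) else 0)"
    unfolding Rep0_cmp Rep0_idm by (intro sum.cong) (auto simp: bas_def)
  also have "\<dots> = (\<Sum>q\<in>NC k l. if q = r then f q else 0)"
    using id_diagram_NC by (intro sum.cong refl) (simp add: diagram_comp_id[OF NC_partitions])
  also have "\<dots> = f r" using assms by (simp add: Rep0_hom)
  finally show "rcmp t k k l f (idm (Rep0_NC t) k) r = f r" .
qed

lemma Rep0_idm_cmp:
  assumes "f \<in> rhom t k l"
  shows "rcmp t k l l (idm (Rep0_NC t) l) f = f"
proof
  fix r
  have "rcmp t k l l (idm (Rep0_NC t) l) f r =
      (\<Sum>q\<in>NC l l. if q = id_diagram l then \<Sum>p\<in>NC k l. f p * t ^ loops q p * of_bool (diagram_comp q p = r) else 0)"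
    unfolding Rep0_cmp Rep0_idm by (intro sum.cong) (auto simp: bas_def)
  also have "\<dots> = (\<Sum>q\<in>NC l l. if q = id_diagram l then \<Sum>p\<in>NC k l. if p = r then f p else 0 else 0)"
    by (intro sum.cong refl if_cong) (simp add: id_diagram_comp[OF NC_partitions])
  also have "\<dots> = f r" using assms id_diagram_NC by (simp add: Rep0_hom)
  finally show "rcmp t k l l (idm (Rep0_NC t) l) f r = f r" .
qed

lemma linear_category_Rep0: "linear_category (Rep0_NC t)"
proof (rule linear_category.intro)
  show vs: "vector_space (rscl t)"
    by standard (auto simp: Rep0_scl fun_eq_iff algebra_simps)
  show "module.subspace (rscl t) (rhom t X Y)" for X Y
  proof -
    interpret vector_space "rscl t" by (rule vs)
    show ?thesis by (rule subspaceI) (auto simp: Rep0_hom Rep0_scl)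
  qed
  show "idm (Rep0_NC t) X \<in> rhom t X X" for X
    using id_diagram_NC by (auto simp: Rep0_hom Rep0_idm bas_def)
qed (simp_all add: Rep0_cmp_hom Rep0_cmp_idm Rep0_idm_cmp Rep0_cmp_assoc Rep0_cmp_add_left Rep0_cmp_add_right
  Rep0_cmp_scl_left Rep0_cmp_scl_right)

section \<open>Temperley--Lieb generators\<close>


lemma saturated_diagram_comp:
  assumes "p \<in> partitions k l" "q \<in> partitions l m" "X \<subseteq> {1..k}" "Y \<subseteq> {1..m}"
  shows "saturated (diagram_comp q p) X Y \<longleftrightarrow> (\<exists>Z\<subseteq>{1..l}. saturated p X Z \<and> saturated q Z Y)"
proof -
  have "saturated (diagram_comp q p) X Y \<longleftrightarrow>
      card {Z. Z \<subseteq> {1..l} \<and> saturated p X Z \<and> saturated q Z Y} \<noteq> 0"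
    unfolding card_middle[OF assms] by simp
  also have "\<dots> \<longleftrightarrow> (\<exists>Z\<subseteq>{1..l}. saturated p X Z \<and> saturated q Z Y)"
    by (auto simp: card_eq_0_iff)
  finally show ?thesis .
qed

section \<open>Face and degeneracy diagrams\<close>

definition coface :: "nat \<Rightarrow> nat \<Rightarrow> nat" where
  "coface i j = (if j < i then j else Suc j)"

definition codegen :: "nat \<Rightarrow> nat \<Rightarrow> nat" where
  "codegen i j = (if j \<le> i then j else j - 1)"

definition coface_pre :: "nat \<Rightarrow> nat \<Rightarrow> nat set \<Rightarrow> nat set" where
  "coface_pre n i Y = {j\<in>{1..n}. coface i j \<in> Y}"

definition codegen_pre :: "nat \<Rightarrow> nat \<Rightarrow> nat set \<Rightarrow> nat set" where
  "codegen_pre n i Y = {j\<in>{1..Suc n}. codegen i j \<in> Y}"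

lemma coface_pre_subset: "coface_pre n i Y \<subseteq> {1..n}"
  by (auto simp: coface_pre_def)

lemma codegen_pre_subset: "codegen_pre n i Y \<subseteq> {1..Suc n}"
  by (auto simp: codegen_pre_def)

text \<open>Diagrams of the maps of the simplex category, with points numbered from 1.
  \<open>coface i\<close> omits the value \<open>i\<close>, so \<open>face n i\<close> has the
  singleton block of \<open>Lower i\<close>; \<open>codegen i\<close> takes the value
  \<open>i\<close> twice, so \<open>degen n i\<close> puts the upper points \<open>i\<close> and
  \<open>i + 1\<close> into one block.\<close>

definition face :: "nat \<Rightarrow> nat \<Rightarrow> diagram" where
  "face n i = graph n (Suc n) (coface i)"

definition degen :: "nat \<Rightarrow> nat \<Rightarrow> diagram" where
  "degen n i = graph (Suc n) n (codegen i)"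

lemma coface_range: "coface i ` {1..n} \<subseteq> {1..Suc n}"
  by (auto simp: coface_def)

lemma codegen_range: "1 \<le> i \<Longrightarrow> i \<le> n \<Longrightarrow> codegen i ` {1..Suc n} \<subseteq> {1..n}"
  by (auto simp: codegen_def)

lemma face_NC: "face n i \<in> NC n (Suc n)"
  unfolding face_def by (rule graph_NC[OF _ coface_range]) (auto simp: mono_on_def coface_def)

lemma degen_NC: "1 \<le> i \<Longrightarrow> i \<le> n \<Longrightarrow> degen n i \<in> NC (Suc n) n"
  unfolding degen_def by (rule graph_NC[OF _ codegen_range]) (auto simp: mono_on_def codegen_def)

lemma saturated_face:
  assumes "X \<subseteq> {1..n}" "Y \<subseteq> {1..Suc n}"
  shows "saturated (face n i) X Y \<longleftrightarrow> X = coface_pre n i Y"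
  unfolding face_def coface_pre_def by (rule saturated_graph[OF coface_range assms])

lemma saturated_degen:
  assumes "1 \<le> i" "i \<le> n" "X \<subseteq> {1..Suc n}" "Y \<subseteq> {1..n}"
  shows "saturated (degen n i) X Y \<longleftrightarrow> X = codegen_pre n i Y"
  unfolding degen_def codegen_pre_def by (rule saturated_graph[OF codegen_range assms(3,4)]) (use assms in auto)

text \<open>\<open>coface i\<close> is a bijection onto the points other than \<open>i\<close>, so
  \<open>X\<close> determines \<open>Y\<close> up to the membership of \<open>i\<close>. This free
  bit is the loop in \<open>face_cap\<close>.\<close>

lemma coface_preimage:
  assumes "X \<subseteq> {1..n}" "Y \<subseteq> {1..Suc n}" "1 \<le> i" "i \<le> Suc n"
  shows "X = coface_pre n i Y \<longleftrightarrow> Y - {i} = coface i ` X"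
proof -
  have inj: "coface i j = coface i j' \<longleftrightarrow> j = j'" for j j' by (auto simp: coface_def)
  have surj: "\<exists>j\<in>{1..n}. k = coface i j" if "k \<in> {1..Suc n}" "k \<noteq> i" for k
    using that assms(3,4) by (intro bexI[of _ "if k < i then k else k - 1"]) (auto simp: coface_def)
  have ne: "coface i j \<noteq> i" for j by (auto simp: coface_def)
  show ?thesis
  proof
    assume X: "X = coface_pre n i Y"
    show "Y - {i} = coface i ` X"
    proof (intro equalityI subsetI)
      fix k assume "k \<in> Y - {i}"
      then obtain j where "j \<in> {1..n}" "k = coface i j" "k \<in> Y" using surj[of k] assms(2) by blast
      then show "k \<in> coface i ` X" unfolding X coface_pre_def by blast
    next
      fix k assume "k \<in> coface i ` X"
      then obtain j where "k = coface i j" "coface i j \<in> Y" unfolding X coface_pre_def by blast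
      then show "k \<in> Y - {i}" using ne[of j] by simp
    qed
  next
    assume Y: "Y - {i} = coface i ` X"
    have "coface i j \<in> Y \<longleftrightarrow> j \<in> X" for j
    proof -
      have "coface i j \<in> Y \<longleftrightarrow> coface i j \<in> Y - {i}" using ne[of j] by simp
      also have "\<dots> \<longleftrightarrow> j \<in> X" unfolding Y by (simp add: image_iff inj)
      finally show ?thesis .
    qed
    then show "X = coface_pre n i Y" using assms(1) by (auto simp: coface_pre_def)
  qed
qed

lemma face_cap:
  assumes "1 \<le> i" "i \<le> Suc n"
  shows "diagram_comp (flip (face n i)) (face n i) = id_diagram n" "loops (flip (face n i)) (face n i) = 1"
proof -
  have "card {Z. Z \<subseteq> {1..Suc n} \<and> saturated (face n i) X Z \<and> saturated (flip (face n i)) Z Y} =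
      (if saturated (id_diagram n) X Y then 2 ^ 1 else 0)" if XY: "X \<subseteq> {1..n}" "Y \<subseteq> {1..n}" for X Y
  proof -
    have inj: "coface i ` X = coface i ` Y \<longleftrightarrow> X = Y"
      by (intro inj_image_eq_iff injI) (auto simp: coface_def split: if_splits)
    have sat: "saturated (face n i) W Z \<longleftrightarrow> Z - {i} = coface i ` W" if "W \<subseteq> {1..n}" "Z \<subseteq> {1..Suc n}" for W Z
      unfolding saturated_face[OF that] by (rule coface_preimage[OF that assms])
    have "{Z. Z \<subseteq> {1..Suc n} \<and> saturated (face n i) X Z \<and> saturated (flip (face n i)) Z Y} =
        {Z. Z \<subseteq> {1..Suc n} \<and> X = Y \<and> Z - {i} = coface i ` X}"
    proof -
      have "saturated (face n i) X Z \<and> saturated (flip (face n i)) Z Y \<longleftrightarrow> X = Y \<and> Z - {i} = coface i ` X"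
        if "Z \<subseteq> {1..Suc n}" for Z
        using sat[OF XY(1) that] sat[OF XY(2) that] inj unfolding saturated_flip by argo
      note * = this
      show ?thesis by (rule Collect_cong, rule conj_cong[OF refl], rule *)
    qed
    also have "\<dots> = (if X = Y then {coface i ` X, insert i (coface i ` X)} else {})"
    proof -
      have "coface i ` X \<subseteq> {1..Suc n} - {i}" using coface_range[of i n] XY by (auto simp: coface_def)
      then show ?thesis using assms by auto
    qed
    also have "card \<dots> = (if X = Y then 2 else 0)"
    proof -
      have "coface i ` W \<noteq> insert i (coface i ` W)" for W by (auto simp: coface_def)
      then show ?thesis by (auto simp: card_insert_if)
    qed
    finally show ?thesis using saturated_id_diagram[OF XY] by simp
  qed
  note * = diagram_comp_eqI[OF NC_partitions[OF face_NC] flip_partitions[OF NC_partitions[OF face_NC]]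
      NC_partitions[OF id_diagram_NC] this]
  show "diagram_comp (flip (face n i)) (face n i) = id_diagram n" "loops (flip (face n i)) (face n i) = 1"
    using * by blast+
qed

lemma degen_section:
  assumes "1 \<le> i" "i \<le> n"
  shows "diagram_comp (degen n i) (flip (degen n i)) = id_diagram n" "loops (degen n i) (flip (degen n i)) = 0"
proof -
  have "card {Z. Z \<subseteq> {1..Suc n} \<and> saturated (flip (degen n i)) X Z \<and> saturated (degen n i) Z Y} =
      (if saturated (id_diagram n) X Y then 2 ^ 0 else 0)" if XY: "X \<subseteq> {1..n}" "Y \<subseteq> {1..n}" for X Y
  proof -
    have "X = Y" if eq: "codegen_pre n i X = codegen_pre n i Y"
    proof -
      have "j \<in> X \<longleftrightarrow> j \<in> Y" if j: "j \<in> {1..n}" for j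
      proof -
        define k where "k = (if j \<le> i then j else Suc j)"
        have "k \<in> {1..Suc n}" "codegen i k = j" using j by (auto simp: k_def codegen_def)
        then show ?thesis using eq unfolding codegen_pre_def by blast
      qed
      then show ?thesis using XY by blast
    qed
    then have "{Z. Z \<subseteq> {1..Suc n} \<and> saturated (flip (degen n i)) X Z \<and> saturated (degen n i) Z Y} =
        (if X = Y then {codegen_pre n i X} else {})"
      using XY assms by (auto simp: saturated_degen saturated_flip codegen_pre_subset[unfolded One_nat_def] dest: codegen_pre_subset[THEN subsetD])
    then show ?thesis using saturated_id_diagram[OF XY] by simp
  qed
  note * = diagram_comp_eqI[OF flip_partitions[OF NC_partitions[OF degen_NC[OF assms]]]
      NC_partitions[OF degen_NC[OF assms]] NC_partitions[OF id_diagram_NC] this]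
  show "diagram_comp (degen n i) (flip (degen n i)) = id_diagram n" "loops (degen n i) (flip (degen n i)) = 0"
    using * by blast+
qed

text \<open>The simplicial identities: \<open>codegen i\<close> is a left inverse of
  \<open>coface i\<close> and of \<open>coface (i + 1)\<close>. In terms of strands they straighten
  a zigzag.\<close>

lemma degen_face:
  assumes "1 \<le> i" "i \<le> n" "j = i \<or> j = Suc i"
  shows "diagram_comp (degen n i) (face n j) = id_diagram n" "loops (degen n i) (face n j) = 0"
proof -
  have "card {Z. Z \<subseteq> {1..Suc n} \<and> saturated (face n j) X Z \<and> saturated (degen n i) Z Y} =
      (if saturated (id_diagram n) X Y then 2 ^ 0 else 0)" if XY: "X \<subseteq> {1..n}" "Y \<subseteq> {1..n}" for X Y
  proof -
    have "codegen i (coface j k) = k" for k using assms(3) by (auto simp: codegen_def coface_def)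
    then have "coface_pre n j (codegen_pre n i Y) = Y"
      using XY coface_range[of j n] by (auto simp: image_subset_iff coface_pre_def codegen_pre_def)
    then have "{Z. Z \<subseteq> {1..Suc n} \<and> saturated (face n j) X Z \<and> saturated (degen n i) Z Y} =
        (if X = Y then {codegen_pre n i Y} else {})"
      using XY assms(1,2) by (auto simp: saturated_degen saturated_face codegen_pre_subset[unfolded One_nat_def] dest: codegen_pre_subset[THEN subsetD])
    then show ?thesis using saturated_id_diagram[OF XY] by simp
  qed
  note * = diagram_comp_eqI[OF NC_partitions[OF face_NC]
      NC_partitions[OF degen_NC[OF assms(1,2)]] NC_partitions[OF id_diagram_NC] this]
  show "diagram_comp (degen n i) (face n j) = id_diagram n" "loops (degen n i) (face n j) = 0"
    using * by blast+
qed

text \<open>The Temperley--Lieb generators on twice as many strands: for odd \<open>k = 2 i - 1\<close> the point \<open>i\<close> is a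
  singleton above and below, for \<open>k = 2 i\<close> the points \<open>i\<close> and \<open>i + 1\<close> form one block with their
  lower copies. Both act on \<open>Suc n\<close> points, and \<open>k\<close> runs up to \<open>2 n + 1\<close>.\<close>

definition cupcap :: "nat \<Rightarrow> nat \<Rightarrow> diagram" where
  "cupcap n k = (if odd k then diagram_comp (face n (Suc k div 2)) (flip (face n (Suc k div 2)))
     else diagram_comp (flip (degen n (k div 2))) (degen n (k div 2)))"

lemma cupcap_odd: "cupcap n (2 * i - 1) = diagram_comp (face n i) (flip (face n i))" if "1 \<le> i"
  using that by (auto simp: cupcap_def)

lemma cupcap_even: "cupcap n (2 * i) = diagram_comp (flip (degen n i)) (degen n i)"
  by (simp add: cupcap_def)

lemma cupcap_cases:
  assumes "1 \<le> k" "k \<le> 2 * n + 1"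
  obtains (odd) i where "k = 2 * i - 1" "1 \<le> i" "i \<le> Suc n" "odd k"
  | (even) i where "k = 2 * i" "1 \<le> i" "i \<le> n" "even k"
proof (cases "odd k")
  case True
  then show ?thesis using assms by (intro that(1)[of "Suc k div 2"]) (auto elim!: oddE)
next
  case False
  then show ?thesis using assms by (intro that(2)[of "k div 2"]) (auto elim!: evenE)
qed

lemma cupcap_NC:
  assumes "1 \<le> k" "k \<le> 2 * n + 1"
  shows "cupcap n k \<in> NC (Suc n) (Suc n)"
  using assms
proof (cases rule: cupcap_cases)
  case (odd i)
  then show ?thesis
    using noncrossing_diagram_comp[OF flip_NC[OF face_NC] face_NC] by (simp only: cupcap_odd)
next
  case (even i)
  then show ?thesis
    using noncrossing_diagram_comp[OF degen_NC flip_NC[OF degen_NC]] by (simp only: cupcap_even)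
qed

lemma saturated_cupcap_odd:
  assumes i: "1 \<le> i" "i \<le> Suc n"
  shows "\<And>X Y. X \<subseteq> {1..Suc n} \<Longrightarrow> Y \<subseteq> {1..Suc n} \<Longrightarrow>
      saturated (cupcap n (2 * i - 1)) X Y \<longleftrightarrow> X - {i} = Y - {i}"
    and "loops (face n i) (flip (face n i)) = 0"
proof -
  have part: "flip (face n i) \<in> partitions (Suc n) n" "face n i \<in> partitions n (Suc n)"
    using face_NC NC_partitions flip_partitions by blast+
  have card: "card {Z. Z \<subseteq> {1..n} \<and> saturated (flip (face n i)) X Z \<and> saturated (face n i) Z Y} =
      (if X - {i} = Y - {i} then 1 else 0)" if XY: "X \<subseteq> {1..Suc n}" "Y \<subseteq> {1..Suc n}" for X Y
  proof -
    have pre: "coface i ` coface_pre n i X = X - {i}" if "X \<subseteq> {1..Suc n}" for X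
      using coface_preimage[OF coface_pre_subset[of n i X] that i, THEN iffD1, OF refl] by simp
    have "{Z. Z \<subseteq> {1..n} \<and> saturated (flip (face n i)) X Z \<and> saturated (face n i) Z Y} =
        (if X - {i} = Y - {i} then {coface_pre n i X} else {})"
    proof -
      have "coface_pre n i X = coface_pre n i Y \<longleftrightarrow> X - {i} = Y - {i}"
        using coface_preimage[OF coface_pre_subset XY(2) i, of i X] pre[OF XY(1)] by auto
      then show ?thesis
        using XY i by (auto simp: saturated_face saturated_flip coface_pre_subset[unfolded One_nat_def] dest: coface_pre_subset[THEN subsetD])
    qed
    then show ?thesis by simp
  qed
  show l: "loops (face n i) (flip (face n i)) = 0"
    using card_middle[OF part, of "{}" "{}"] card[of "{}" "{}"] by simp
  show "saturated (cupcap n (2 * i - 1)) X Y \<longleftrightarrow> X - {i} = Y - {i}"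
    if "X \<subseteq> {1..Suc n}" "Y \<subseteq> {1..Suc n}" for X Y
    using card_middle[OF part that] card[OF that] i unfolding cupcap_odd[OF i(1)] l by (simp split: if_splits)
qed

lemma saturated_cupcap_even:
  assumes i: "1 \<le> i" "i \<le> n"
  shows "\<And>X Y. X \<subseteq> {1..Suc n} \<Longrightarrow> Y \<subseteq> {1..Suc n} \<Longrightarrow>
      saturated (cupcap n (2 * i)) X Y \<longleftrightarrow> X = Y \<and> (i \<in> X \<longleftrightarrow> Suc i \<in> X)"
    and "loops (flip (degen n i)) (degen n i) = 0"
proof -
  have part: "flip (degen n i) \<in> partitions n (Suc n)" "degen n i \<in> partitions (Suc n) n"
    using degen_NC[OF i] NC_partitions flip_partitions by blast+
  have card: "card {Z. Z \<subseteq> {1..n} \<and> saturated (degen n i) X Z \<and> saturated (flip (degen n i)) Z Y} =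
      (if X = Y \<and> (i \<in> X \<longleftrightarrow> Suc i \<in> X) then 1 else 0)" if XY: "X \<subseteq> {1..Suc n}" "Y \<subseteq> {1..Suc n}" for X Y
  proof -
    let ?Z = "coface_pre n (Suc i) X"
    have 1: "Z = ?Z" if "Z \<subseteq> {1..n}" "X = codegen_pre n i Z" for Z
    proof -
      have "codegen i (coface (Suc i) j) = j" for j by (auto simp: codegen_def coface_def)
      then show ?thesis using that coface_range[of "Suc i" n]
        by (auto simp: image_subset_iff coface_pre_def codegen_pre_def)
    qed
    have 2: "i \<in> X \<longleftrightarrow> Suc i \<in> X" if "X = codegen_pre n i Z" for Z
      using that i by (auto simp: codegen_def codegen_pre_def)
    have 3: "X = codegen_pre n i ?Z" if "i \<in> X \<longleftrightarrow> Suc i \<in> X"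
    proof -
      have "codegen i j \<in> ?Z \<longleftrightarrow> j \<in> X" if j: "j \<in> {1..Suc n}" for j
      proof -
        have "codegen i j \<in> {1..n}" using j codegen_range[OF i] by blast
        moreover have "coface (Suc i) (codegen i j) = (if j = Suc i then i else j)"
          using j by (auto simp: codegen_def coface_def)
        ultimately show ?thesis using \<open>i \<in> X \<longleftrightarrow> Suc i \<in> X\<close> by (auto simp: coface_pre_def)
      qed
      then show ?thesis using XY unfolding codegen_pre_def by blast
    qed
    have "{Z. Z \<subseteq> {1..n} \<and> saturated (degen n i) X Z \<and> saturated (flip (degen n i)) Z Y} =
        {Z. Z \<subseteq> {1..n} \<and> X = codegen_pre n i Z \<and> X = Y}"
      using XY i by (auto simp: saturated_degen saturated_flip)
    also have "\<dots> = (if X = Y \<and> (i \<in> X \<longleftrightarrow> Suc i \<in> X) then {?Z} else {})"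
    proof (cases "X = Y \<and> (i \<in> X \<longleftrightarrow> Suc i \<in> X)")
      case True
      have "?Z \<subseteq> {1..n}" by (rule coface_pre_subset)
      then show ?thesis using 1 3 True by (auto simp del: mem_Collect_eq)
    next
      case False
      then show ?thesis using 2 by auto
    qed
    finally show ?thesis by auto
  qed
  show l: "loops (flip (degen n i)) (degen n i) = 0"
    using card_middle[OF part(2,1), of "{}" "{}"] card[of "{}" "{}"] by simp
  show "saturated (cupcap n (2 * i)) X Y \<longleftrightarrow> X = Y \<and> (i \<in> X \<longleftrightarrow> Suc i \<in> X)"
    if "X \<subseteq> {1..Suc n}" "Y \<subseteq> {1..Suc n}" for X Y
    using card_middle[OF part(2,1) that] card[OF that] unfolding cupcap_even l by (simp split: if_splits)
qed

section \<open>Basis vectors and the reflection of morphisms\<close>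

lemma bas_cmp:
  assumes "p \<in> NC k l" "q \<in> NC l m"
  shows "rcmp t k l m (bas q) (bas p) = rscl t (t ^ loops q p) (bas (diagram_comp q p))"
proof
  fix r
  have "rcmp t k l m (bas q) (bas p) r = (\<Sum>q'\<in>NC l m. if q' = q then
      \<Sum>p'\<in>NC k l. if p' = p then t ^ loops q' p' * of_bool (diagram_comp q' p' = r) else 0 else 0)"
    unfolding Rep0_cmp bas_def by (intro sum.cong refl) (auto intro!: sum.cong sum.neutral)
  also have "\<dots> = t ^ loops q p * of_bool (diagram_comp q p = r)"
    using assms by simp
  finally show "rcmp t k l m (bas q) (bas p) r =
      rscl t (t ^ loops q p) (bas (diagram_comp q p)) r"
    by (auto simp: Rep0_scl bas_def)
qed

lemma bas_hom: "p \<in> NC k l \<Longrightarrow> bas p \<in> rhom t k l"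
  by (auto simp: Rep0_hom bas_def)

lemma Rep0_cmp_expand_left:
  "rcmp t k l m g f r = (\<Sum>q\<in>NC l m. g q * rcmp t k l m (bas q) f r)"
proof -
  have "rcmp t k l m (bas q) f r =
      (\<Sum>p\<in>NC k l. f p * t ^ loops q p * of_bool (diagram_comp q p = r))" if "q \<in> NC l m" for q
  proof -
    have "rcmp t k l m (bas q) f r = (\<Sum>q'\<in>NC l m. if q' = q then
        \<Sum>p\<in>NC k l. f p * t ^ loops q' p * of_bool (diagram_comp q' p = r) else 0)"
      unfolding Rep0_cmp bas_def by (intro sum.cong refl) auto
    then show ?thesis using that by simp
  qed
  then show ?thesis unfolding Rep0_cmp[of t k l m g]
    by (simp add: sum_distrib_left mult.assoc)
qed

lemma Rep0_cmp_zeroI: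
  assumes "\<And>q. q \<in> NC l m \<Longrightarrow> rcmp t k l m (bas q) f = 0"
  shows "rcmp t k l m g f = 0"
proof
  fix r show "rcmp t k l m g f r = 0 r"
    unfolding Rep0_cmp_expand_left[of t k l m g f r] using assms by simp
qed

definition mirror :: "(diagram \<Rightarrow> complex) \<Rightarrow> diagram \<Rightarrow> complex" where
  "mirror f r = f (flip r)"

lemma mirror_bas: "mirror (bas p) = bas (flip p)"
  by (auto simp: mirror_def bas_def fun_eq_iff)

lemma mirror_cmp:
  "mirror (rcmp t k l m g f) = rcmp t m l k (mirror f) (mirror g)"
proof
  fix r
  have bij: "bij_betw flip (NC k l) (NC l k)" for k l
    by (rule bij_betw_byWitness[where f' = flip]) (auto simp: flip_NC)
  have "rcmp t m l k (mirror f) (mirror g) r =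
      (\<Sum>p\<in>NC k l. \<Sum>q\<in>NC l m. mirror f (flip p) * mirror g (flip q) * t ^ loops (flip p) (flip q) *
        of_bool (diagram_comp (flip p) (flip q) = r))"
    unfolding Rep0_cmp sum.reindex_bij_betw[OF bij[of k l], symmetric] sum.reindex_bij_betw[OF bij[of l m], symmetric] ..
  also have "\<dots> = (\<Sum>p\<in>NC k l. \<Sum>q\<in>NC l m. g q * f p * t ^ loops q p * of_bool (diagram_comp q p = flip r))"
  proof (intro sum.cong refl)
    fix p q assume "p \<in> NC k l" "q \<in> NC l m"
    note * = flip_diagram_comp[OF this[THEN NC_partitions]]
    have "flip (diagram_comp q p) = r \<longleftrightarrow> diagram_comp q p = flip r" by (metis flip_flip)
    then show "mirror f (flip p) * mirror g (flip q) * t ^ loops (flip p) (flip q) *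
        of_bool (diagram_comp (flip p) (flip q) = r) = g q * f p * t ^ loops q p * of_bool (diagram_comp q p = flip r)"
      by (simp add: mirror_def *)
  qed
  also have "\<dots> = mirror (rcmp t k l m g f) r"
    unfolding mirror_def Rep0_cmp by (rule sum.swap)
  finally show "mirror (rcmp t k l m g f) r = rcmp t m l k (mirror f) (mirror g) r" ..
qed

lemma flip_eq_iff: "flip p = q \<longleftrightarrow> p = flip q"
  by (metis flip_flip)

lemma mirror_diff: "mirror (f - g) = mirror f - mirror g"
  and mirror_scl: "mirror (rscl t c f) = rscl t c (mirror f)"
  and mirror_mirror [simp]: "mirror (mirror f) = f"
  by (auto simp: mirror_def Rep0_scl fun_eq_iff)

text \<open>The cup on the strands \<open>k\<close> and \<open>k + 1\<close>; its reflection is the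
  cap. By \<open>cupcap_up\<close> each generator factors through the object with \<open>n\<close>
  points, and the quadratic and cubic relations of the generators reduce to composites of a cup with
  a cap.\<close>

definition up :: "nat \<Rightarrow> nat \<Rightarrow> diagram" where
  "up n k = (if odd k then face n (Suc k div 2) else flip (degen n (k div 2)))"

lemma up_NC:
  assumes "1 \<le> k" "k \<le> 2 * n + 1"
  shows "up n k \<in> NC n (Suc n)"
  using assms
proof (cases rule: cupcap_cases)
  case (odd i) then show ?thesis by (simp add: up_def face_NC)
next
  case (even i) then show ?thesis by (simp add: up_def flip_NC degen_NC)
qed

lemma cupcap_up:
  assumes "1 \<le> k" "k \<le> 2 * n + 1"
  shows "diagram_comp (up n k) (flip (up n k)) = cupcap n k" "loops (up n k) (flip (up n k)) = 0"
proof -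
  show "diagram_comp (up n k) (flip (up n k)) = cupcap n k" by (simp add: up_def cupcap_def)
  show "loops (up n k) (flip (up n k)) = 0"
    using assms
  proof (cases rule: cupcap_cases)
    case (odd i)
    then have "up n k = face n i" by (simp add: up_def)
    then show ?thesis using saturated_cupcap_odd(2) odd by simp
  next
    case (even i)
    then have "up n k = flip (degen n i)" by (simp add: up_def)
    then show ?thesis using saturated_cupcap_even(2) even by simp
  qed
qed

lemma up_cap:
  assumes "1 \<le> k" "k \<le> 2 * n + 1"
  shows "diagram_comp (flip (up n k)) (up n k) = id_diagram n" "loops (flip (up n k)) (up n k) = of_bool (odd k)"
proof -
  have "diagram_comp (flip (up n k)) (up n k) = id_diagram n \<and> loops (flip (up n k)) (up n k) = of_bool (odd k)"
    using assms
  proof (cases rule: cupcap_cases)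
    case (odd i)
    then have "up n k = face n i" by (simp add: up_def)
    then show ?thesis using face_cap[of i n] odd by simp
  next
    case (even i)
    then have "up n k = flip (degen n i)" by (simp add: up_def)
    then show ?thesis using degen_section[of i n] even by simp
  qed
  then show "diagram_comp (flip (up n k)) (up n k) = id_diagram n" "loops (flip (up n k)) (up n k) = of_bool (odd k)"
    by auto
qed

text \<open>Of the two composites one is an instance of \<open>degen_face\<close>, with
  \<open>j = i\<close> for \<open>k = 2 i - 1\<close> and with \<open>j = i + 1\<close> for
  \<open>k = 2 i\<close>. The other is its reflection.\<close>

lemma up_zigzag:
  assumes "1 \<le> k" "Suc k \<le> 2 * n + 1"
  shows "diagram_comp (flip (up n (Suc k))) (up n k) = id_diagram n \<and> loops (flip (up n (Suc k))) (up n k) = 0"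
    and "diagram_comp (flip (up n k)) (up n (Suc k)) = id_diagram n \<and> loops (flip (up n k)) (up n (Suc k)) = 0"
proof -
  have k: "k \<le> 2 * n + 1" using assms by simp
  have part: "up n k \<in> partitions n (Suc n)" "flip (up n (Suc k)) \<in> partitions (Suc n) n"
    "up n (Suc k) \<in> partitions n (Suc n)" "flip (up n k) \<in> partitions (Suc n) n"
    using up_NC[of k n] up_NC[of "Suc k" n] assms NC_partitions flip_partitions by auto
  have "(diagram_comp (flip (up n (Suc k))) (up n k) = id_diagram n \<and> loops (flip (up n (Suc k))) (up n k) = 0) \<or>
    (diagram_comp (flip (up n k)) (up n (Suc k)) = id_diagram n \<and> loops (flip (up n k)) (up n (Suc k)) = 0)"
    using assms(1) k
  proof (cases rule: cupcap_cases)
    case (odd i)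
    then have "up n k = face n i" "up n (Suc k) = flip (degen n i)" by (auto simp: up_def)
    then show ?thesis using degen_face[of i n i] odd assms by auto
  next
    case (even i)
    then have "up n (Suc k) = face n (Suc i)" "up n k = flip (degen n i)" by (auto simp: up_def)
    then show ?thesis using degen_face[of i n "Suc i"] even assms by auto
  qed
  then show "diagram_comp (flip (up n (Suc k))) (up n k) = id_diagram n \<and> loops (flip (up n (Suc k))) (up n k) = 0"
    "diagram_comp (flip (up n k)) (up n (Suc k)) = id_diagram n \<and> loops (flip (up n k)) (up n (Suc k)) = 0"
    using flip_diagram_comp[OF part(1,2)] flip_diagram_comp[OF part(3,4)]
    by (auto simp: flip_id_diagram flip_eq_iff)
qed

lemma flip_cupcap:
  assumes "1 \<le> k" "k \<le> 2 * n + 1"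
  shows "flip (cupcap n k) = cupcap n k"
proof -
  have "up n k \<in> partitions n (Suc n)" using up_NC[OF assms] NC_partitions by blast
  from flip_diagram_comp(1)[OF flip_partitions[OF this] this] show ?thesis
    unfolding cupcap_up(1)[OF assms, symmetric] by simp
qed

text \<open>An odd generator frees one label, an even one identifies two neighbouring labels. Since
  the indices differ by at least 2, two freed points are distinct and a freed point is never one of
  the identified ones, so the order of the conditions does not matter.\<close>

lemma card_middle_cupcap_commute:
  assumes k: "1 \<le> k" "k + 2 \<le> k'" "k' \<le> 2 * n + 1" and XY: "X \<subseteq> {1..Suc n}" "Y \<subseteq> {1..Suc n}"
  shows "card {Z. Z \<subseteq> {1..Suc n} \<and> saturated (cupcap n k') X Z \<and> saturated (cupcap n k) Z Y} =
    card {Z. Z \<subseteq> {1..Suc n} \<and> saturated (cupcap n k) X Z \<and> saturated (cupcap n k') Z Y}"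
proof -
  \<comment> \<open>The middle row must agree with \<open>Y\<close> at \<open>i\<close> and with
    \<open>X\<close> elsewhere, which leaves at most one choice.\<close>
  have oo: "card {Z. Z \<subseteq> {1..Suc n} \<and> X - {i} = Z - {i} \<and> Z - {j} = Y - {j}} =
      (if X - {i, j} = Y - {i, j} then 1 else 0)" if "i \<noteq> j" for i j
  proof -
    have "{Z. Z \<subseteq> {1..Suc n} \<and> X - {i} = Z - {i} \<and> Z - {j} = Y - {j}} =
        (if X - {i, j} = Y - {i, j} then {(X - {i}) \<union> (Y \<inter> {i})} else {})"
    proof (cases "X - {i, j} = Y - {i, j}")
      case True
      have "X - {i} = Z - {i} \<and> Z - {j} = Y - {j} \<longleftrightarrow> Z = (X - {i}) \<union> (Y \<inter> {i})" for Z
        using True that by (auto simp: set_eq_iff)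
      moreover have "(X - {i}) \<union> (Y \<inter> {i}) \<subseteq> {1..Suc n}" using XY by auto
      ultimately show ?thesis using True by auto
    next
      case False
      have "X - {i, j} = Y - {i, j}" if "X - {i} = Z - {i}" "Z - {j} = Y - {j}" for Z
        using that by (auto simp: set_eq_iff)
      then show ?thesis using False by auto
    qed
    then show ?thesis by simp
  qed
  have oe: "card {Z. Z \<subseteq> {1..Suc n} \<and> X - {i} = Z - {i} \<and> Z = Y \<and> (j \<in> Z \<longleftrightarrow> Suc j \<in> Z)} =
      card {Z. Z \<subseteq> {1..Suc n} \<and> (X = Z \<and> (j \<in> X \<longleftrightarrow> Suc j \<in> X)) \<and> Z - {i} = Y - {i}}"
    if "i \<noteq> j" "i \<noteq> Suc j" for i j
  proof -
    have "{Z. Z \<subseteq> {1..Suc n} \<and> X - {i} = Z - {i} \<and> Z = Y \<and> (j \<in> Z \<longleftrightarrow> Suc j \<in> Z)} =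
        (if X - {i} = Y - {i} \<and> (j \<in> Y \<longleftrightarrow> Suc j \<in> Y) then {Y} else {})"
      using XY by auto
    moreover have "{Z. Z \<subseteq> {1..Suc n} \<and> (X = Z \<and> (j \<in> X \<longleftrightarrow> Suc j \<in> X)) \<and> Z - {i} = Y - {i}} =
        (if X - {i} = Y - {i} \<and> (j \<in> X \<longleftrightarrow> Suc j \<in> X) then {X} else {})"
      using XY by auto
    moreover have "(j \<in> Y \<longleftrightarrow> Suc j \<in> Y) \<longleftrightarrow> (j \<in> X \<longleftrightarrow> Suc j \<in> X)" if "X - {i} = Y - {i}"
      using that \<open>i \<noteq> j\<close> \<open>i \<noteq> Suc j\<close> by (metis Diff_iff insert_iff emptyE)
    ultimately show ?thesis by auto
  qed
  define R where "R a V W \<longleftrightarrow> (if odd a then V - {Suc a div 2} = W - {Suc a div 2}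
      else V = W \<and> (a div 2 \<in> V \<longleftrightarrow> Suc (a div 2) \<in> V))" for a :: nat and V W :: "nat set"
  have sat: "saturated (cupcap n a) V W \<longleftrightarrow> R a V W"
    if "1 \<le> a" "a \<le> 2 * n + 1" "V \<subseteq> {1..Suc n}" "W \<subseteq> {1..Suc n}" for a V W
    using that(1,2)
  proof (cases rule: cupcap_cases)
    case (odd i)
    then show ?thesis using saturated_cupcap_odd(1)[OF odd(2,3) that(3,4)] by (simp add: R_def)
  next
    case (even i)
    then show ?thesis using saturated_cupcap_even(1)[OF even(2,3) that(3,4)] by (simp add: R_def)
  qed
  have sat_set: "{Z. Z \<subseteq> {1..Suc n} \<and> saturated (cupcap n a) X Z \<and> saturated (cupcap n b) Z Y} =
      {Z. Z \<subseteq> {1..Suc n} \<and> R a X Z \<and> R b Z Y}"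
    if "1 \<le> a" "a \<le> 2 * n + 1" "1 \<le> b" "b \<le> 2 * n + 1" for a b
    using sat[OF that(1,2) XY(1)] sat[OF that(3,4) _ XY(2)]
    by (intro Collect_cong conj_cong refl) blast+
  have "card {Z. Z \<subseteq> {1..Suc n} \<and> R k' X Z \<and> R k Z Y} = card {Z. Z \<subseteq> {1..Suc n} \<and> R k X Z \<and> R k' Z Y}"
  proof (cases "odd k")
    case o: True
    show ?thesis
    proof (cases "odd k'")
      case True
      have ij: "Suc k div 2 \<noteq> Suc k' div 2" using o True k by (auto elim!: oddE)
      show ?thesis using o True oo[OF ij] oo[OF ij[symmetric]] by (simp add: R_def insert_commute)
    next
      case False
      have ij: "Suc k div 2 \<noteq> k' div 2" "Suc k div 2 \<noteq> Suc (k' div 2)" using o False k by (auto elim!: oddE evenE)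
      show ?thesis using o False oe[OF ij] by (simp add: R_def)
    qed
  next
    case e: False
    show ?thesis
    proof (cases "odd k'")
      case True
      have ij: "Suc k' div 2 \<noteq> k div 2" "Suc k' div 2 \<noteq> Suc (k div 2)" using e True k by (auto elim!: oddE evenE)
      show ?thesis using e True oe[OF ij] by (simp add: R_def)
    next
      case False
      show ?thesis using e False by (intro arg_cong[where f = card]) (auto simp: R_def)
    qed
  qed
  then show ?thesis using k by (subst (1 2) sat_set) auto
qed

lemma cupcap_commute:
  assumes "1 \<le> k" "k + 2 \<le> k'" "k' \<le> 2 * n + 1"
  shows "diagram_comp (cupcap n k) (cupcap n k') = diagram_comp (cupcap n k') (cupcap n k)"
    "loops (cupcap n k) (cupcap n k') = loops (cupcap n k') (cupcap n k)"
proof -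
  have "cupcap n k \<in> partitions (Suc n) (Suc n)" "cupcap n k' \<in> partitions (Suc n) (Suc n)"
    using assms cupcap_NC NC_partitions by auto
  from diagram_comp_cong[OF this(2,1) this(1,2) card_middle_cupcap_commute[OF assms]]
  show "diagram_comp (cupcap n k) (cupcap n k') = diagram_comp (cupcap n k') (cupcap n k)"
    "loops (cupcap n k) (cupcap n k') = loops (cupcap n k') (cupcap n k)" by auto
qed

section \<open>The Temperley--Lieb relations in the category\<close>

definition loop_weight :: "complex \<Rightarrow> nat \<Rightarrow> complex" where
  "loop_weight t k = (if odd k then t else 1)"

lemma bas_cupcap:
  assumes "1 \<le> k" "k \<le> 2 * n + 1"
  shows "bas (cupcap n k) = rcmp t (Suc n) n (Suc n) (bas (up n k)) (bas (flip (up n k)))"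
  using cupcap_up[OF assms] bas_cmp[OF flip_NC[OF up_NC] up_NC, OF assms assms, of t]
  by (simp add: Rep0_scl)

lemma bas_up_cap:
  assumes "1 \<le> k" "k \<le> 2 * n + 1"
  shows "rcmp t n (Suc n) n (bas (flip (up n k))) (bas (up n k)) =
    rscl t (loop_weight t k) (bas (id_diagram n))"
  using up_cap[OF assms] bas_cmp[OF up_NC flip_NC[OF up_NC], OF assms assms, of t]
  by (simp add: loop_weight_def)

lemma bas_up_zigzag:
  assumes "1 \<le> k" "Suc k \<le> 2 * n + 1"
  shows "rcmp t n (Suc n) n (bas (flip (up n k))) (bas (up n (Suc k))) = bas (id_diagram n)"
    and "rcmp t n (Suc n) n (bas (flip (up n (Suc k)))) (bas (up n k)) = bas (id_diagram n)"
proof -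
  have "up n k \<in> NC n (Suc n)" "up n (Suc k) \<in> NC n (Suc n)" using up_NC assms by auto
  then show "rcmp t n (Suc n) n (bas (flip (up n k))) (bas (up n (Suc k))) = bas (id_diagram n)"
    "rcmp t n (Suc n) n (bas (flip (up n (Suc k)))) (bas (up n k)) = bas (id_diagram n)"
    using up_zigzag[OF assms] bas_cmp[of "up n (Suc k)" n "Suc n" "flip (up n k)" n t]
      bas_cmp[of "up n k" n "Suc n" "flip (up n (Suc k))" n t]
    by (auto simp: flip_NC Rep0_scl)
qed

lemma jones_wenzl_Rep0:
  "jones_wenzl (rscl t) (rcmp t (Suc n) (Suc n) (Suc n)) (bas (id_diagram (Suc n)))
    (\<lambda>k. bas (cupcap n k)) (loop_weight t) (2 * n + 1)"
proof -
  interpret linear_category "Rep0_NC t" by (rule linear_category_Rep0)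
  let ?mul = "rcmp t (Suc n) (Suc n) (Suc n)" and ?c = "rcmp t" and ?U = "\<lambda>k. bas (cupcap n k)"
  note idm = Rep0_idm_cmp[unfolded Rep0_idm] Rep0_cmp_idm[unfolded Rep0_idm]
  have hU: "?U k \<in> rhom t (Suc n) (Suc n)" if "1 \<le> k" "k \<le> 2 * n + 1" for k
    using that by (intro bas_hom cupcap_NC)
  have h: "bas (up n k) \<in> rhom t n (Suc n)" "bas (flip (up n k)) \<in> rhom t (Suc n) n"
    if "1 \<le> k" "k \<le> 2 * n + 1" for k
    using that by (auto intro!: bas_hom up_NC flip_NC)
  show ?thesis
  proof (unfold_locales, goal_cases)
    case 6
    show ?case by (intro idm bas_hom id_diagram_NC)
  next
    case (7 i) then show ?case by (intro idm hU)
  next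
    case (8 i) then show ?case by (intro idm hU)
  next
    case (9 i)
    have "?mul (?U i) (?U i) = ?c (Suc n) n (Suc n) (bas (up n i))
        (?c (Suc n) n n (?c n (Suc n) n (bas (flip (up n i))) (bas (up n i))) (bas (flip (up n i))))"
      by (simp only: bas_cupcap[OF 9, of t] Rep0_cmp_assoc)
    also have "\<dots> = rscl t (loop_weight t i) (?U i)"
      using h[OF 9] by (simp only: bas_up_cap[OF 9] Rep0_cmp_scl_left Rep0_cmp_scl_right idm bas_cupcap[OF 9, of t])
    finally show ?case .
  next
    case (10 i)
    then have i: "i \<le> 2 * n + 1" "1 \<le> Suc i" by auto
    note b = bas_cupcap[OF 10(1) i(1), of t] bas_cupcap[OF i(2) 10(2), of t]
    have "?mul (?U (Suc i)) (?mul (?U i) (?U (Suc i))) = ?c (Suc n) n (Suc n) (bas (up n (Suc i)))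
        (?c (Suc n) n n (?c n (Suc n) n (bas (flip (up n (Suc i)))) (bas (up n i)))
          (?c (Suc n) n n (?c n (Suc n) n (bas (flip (up n i))) (bas (up n (Suc i)))) (bas (flip (up n (Suc i))))))"
      by (simp only: b Rep0_cmp_assoc)
    also have "\<dots> = ?U (Suc i)"
      using h[OF i(2) 10(2)] by (simp only: bas_up_zigzag[OF 10] idm b)
    finally show ?case .
  next
    case (11 i j)
    then have "cupcap n i \<in> NC (Suc n) (Suc n)" "cupcap n j \<in> NC (Suc n) (Suc n)"
      using cupcap_NC by auto
    then show ?case by (simp add: bas_cmp cupcap_commute[OF 11])
  qed (simp_all only: Rep0_cmp_assoc Rep0_cmp_add_left Rep0_cmp_add_right Rep0_cmp_scl_left Rep0_cmp_scl_right)
qed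

text \<open>The Jones--Wenzl idempotent on the first \<open>m\<close> of the \<open>2 n + 2\<close>
  strands of the object with \<open>n + 1\<close> points.\<close>

definition jw :: "complex \<Rightarrow> nat \<Rightarrow> nat \<Rightarrow> diagram \<Rightarrow> complex" where
  "jw t n = jones_wenzl.p (rscl t) (rcmp t (Suc n) (Suc n) (Suc n)) (bas (id_diagram (Suc n)))
    (\<lambda>k. bas (cupcap n k)) (loop_weight t)"

abbreviation nondeg :: "complex \<Rightarrow> nat \<Rightarrow> bool" where
  "nondeg t m \<equiv> \<forall>i. 1 \<le> i \<longrightarrow> i < m \<longrightarrow> ratio (loop_weight t) i \<noteq> 0"

text \<open>The ratio of index 1 is \<open>t\<close>, the weight of all odd generators, and
  \<open>1 \<le> k < m\<close> brings this index into the range of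
  \<open>nondeg t m\<close>.\<close>

lemma loop_weight_nonzero:
  assumes "nondeg t m" "1 \<le> k" "k < m"
  shows "loop_weight t k \<noteq> 0"
proof -
  have "ratio (loop_weight t) 1 \<noteq> 0" using assms by auto
  then show ?thesis by (simp add: loop_weight_def)
qed

lemma
  assumes "1 \<le> m" "m \<le> 2 * n + 2" "nondeg t m"
  shows jw_idem: "rcmp t (Suc n) (Suc n) (Suc n) (jw t n m) (jw t n m) = jw t n m"
    and jw_kill: "1 \<le> k \<Longrightarrow> k < m \<Longrightarrow> rcmp t (Suc n) (Suc n) (Suc n) (bas (cupcap n k)) (jw t n m) = 0"
    and jw_sandwich: "m \<le> 2 * n + 1 \<Longrightarrow> rcmp t (Suc n) (Suc n) (Suc n) (bas (cupcap n m))
        (rcmp t (Suc n) (Suc n) (Suc n) (jw t n m) (bas (cupcap n m))) =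
        rscl t (ratio (loop_weight t) m)
          (rcmp t (Suc n) (Suc n) (Suc n) (jw t n (m - 1)) (bas (cupcap n m)))"
proof -
  interpret J: jones_wenzl "rscl t" "rcmp t (Suc n) (Suc n) (Suc n)" "bas (id_diagram (Suc n))"
    "\<lambda>k. bas (cupcap n k)" "loop_weight t" "2 * n + 1" by (rule jones_wenzl_Rep0)
  have m: "m \<le> Suc (2 * n + 1)" using assms by simp
  show "rcmp t (Suc n) (Suc n) (Suc n) (jw t n m) (jw t n m) = jw t n m"
    using J.jones_wenzl(1)[OF assms(1) m] assms(3) by (simp add: jw_def)
  show "rcmp t (Suc n) (Suc n) (Suc n) (bas (cupcap n k)) (jw t n m) = 0" if "1 \<le> k" "k < m"
    using J.jones_wenzl(4)[OF assms(1) m _ that] assms(3) by (simp add: jw_def)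
  show "rcmp t (Suc n) (Suc n) (Suc n) (bas (cupcap n m))
        (rcmp t (Suc n) (Suc n) (Suc n) (jw t n m) (bas (cupcap n m))) =
        rscl t (ratio (loop_weight t) m)
          (rcmp t (Suc n) (Suc n) (Suc n) (jw t n (m - 1)) (bas (cupcap n m)))" if "m \<le> 2 * n + 1"
    using J.jones_wenzl(6)[OF assms(1) m _ that] assms(3) by (simp add: jw_def)
qed

lemma
  assumes "m \<le> 2 * n + 2"
  shows jw_hom: "jw t n m \<in> rhom t (Suc n) (Suc n)"
    and mirror_jw: "mirror (jw t n m) = jw t n m"
    and jw_cong_id: "module.subspace (rscl t) G \<Longrightarrow>
        (\<And>k z. 1 \<le> k \<Longrightarrow> k < m \<Longrightarrow> rcmp t (Suc n) (Suc n) (Suc n) (bas (cupcap n k)) z \<in> G) \<Longrightarrow>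
        jw t n m - bas (id_diagram (Suc n)) \<in> G"
proof -
  interpret J: jones_wenzl "rscl t" "rcmp t (Suc n) (Suc n) (Suc n)" "bas (id_diagram (Suc n))"
    "\<lambda>k. bas (cupcap n k)" "loop_weight t" "2 * n + 1" by (rule jones_wenzl_Rep0)
  have m: "m \<le> Suc (2 * n + 1)" using assms by simp
  show "jw t n m \<in> rhom t (Suc n) (Suc n)"
    using J.e_p[OF m] Rep0_cmp_hom unfolding jw_def by metis
  show "mirror (jw t n m) = jw t n m"
    unfolding jw_def
    by (rule J.p_antiautomorphism[OF m])
      (simp_all only: mirror_diff mirror_scl mirror_cmp mirror_bas flip_id_diagram flip_cupcap)
  show "jw t n m - bas (id_diagram (Suc n)) \<in> G"
    if "J.subspace G" "\<And>k z. 1 \<le> k \<Longrightarrow> k < m \<Longrightarrow> rcmp t (Suc n) (Suc n) (Suc n) (bas (cupcap n k)) z \<in> G"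
    using J.p_cong_e[OF m that(1), of "bas (id_diagram (Suc n))"] that(2) J.e_p[OF m] J.ee unfolding jw_def by simp
qed

text \<open>All terms of \<open>jw t n m\<close> except the identity contribute products beginning
  with a generator. If these have no coefficient at \<open>v\<close>, the coefficient of
  \<open>w\<close> at \<open>v\<close> survives; this is how morphisms are shown to be
  non-zero.\<close>

lemma jw_coeff:
  assumes m: "m \<le> 2 * n + 2" and w: "w \<in> rhom t j (Suc n)"
    and v: "\<And>k z. 1 \<le> k \<Longrightarrow> k < m \<Longrightarrow> rcmp t j (Suc n) (Suc n) (bas (cupcap n k)) z v = 0"
  shows "rcmp t j (Suc n) (Suc n) (jw t n m) w v = w v"
proof -
  interpret linear_category "Rep0_NC t" by (rule linear_category_Rep0)
  let ?G = "{g. rcmp t j (Suc n) (Suc n) g w v = 0}"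
  have "V.subspace ?G"
  proof (rule V.subspaceI)
    show "0 \<in> ?G" by (simp add: Rep0_cmp_expand_left[of _ _ _ _ 0])
    show "rscl t c g \<in> ?G" if "g \<in> ?G" for c g
      using that unfolding mem_Collect_eq Rep0_cmp_scl_left by (simp add: Rep0_scl)
  qed (simp add: Rep0_cmp_add_left)
  then have "jw t n m - bas (id_diagram (Suc n)) \<in> ?G"
    by (rule jw_cong_id[OF m]) (simp add: Rep0_cmp_assoc v)
  moreover have "rcmp t j (Suc n) (Suc n) (jw t n m - bas (id_diagram (Suc n))) w =
      rcmp t j (Suc n) (Suc n) (jw t n m) w - w"
    using Rep0_idm_cmp[OF w] jw_hom[OF m] w bas_hom[OF id_diagram_NC]
    by (simp add: cmp_diff_left Rep0_idm)
  ultimately show ?thesis by simp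
qed

section \<open>Caps\<close>

abbreviation linked :: "diagram \<Rightarrow> point \<Rightarrow> point \<Rightarrow> bool" where
  "linked p x y \<equiv> \<exists>B\<in>p. x \<in> B \<and> y \<in> B"

text \<open>The diagram has a cap on the strands \<open>k\<close> and \<open>k + 1\<close>. For odd
  \<open>k\<close> these are the two strands of one point, for even \<open>k\<close> the right
  strand of a point and the left strand of the next.\<close>

definition capped :: "diagram \<Rightarrow> nat \<Rightarrow> bool" where
  "capped q k \<longleftrightarrow> (if odd k then {Upper (Suc k div 2)} \<in> q
     else linked q (Upper (k div 2)) (Upper (Suc (k div 2))))"

lemma subset_or_disjoint_cong:
  "(\<And>b. b \<in> B \<Longrightarrow> b \<in> S \<longleftrightarrow> b \<in> T) \<Longrightarrow> (B \<subseteq> S \<or> B \<inter> S = {}) \<longleftrightarrow> (B \<subseteq> T \<or> B \<inter> T = {})"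
  by blast

lemma subset_or_disjointI:
  "(\<And>x y. x \<in> B \<Longrightarrow> y \<in> B \<Longrightarrow> x \<in> S \<Longrightarrow> y \<in> S) \<Longrightarrow> B \<subseteq> S \<or> B \<inter> S = {}"
  by blast

lemma same_block:
  assumes "p \<in> partitions k l" "A \<in> p" "B \<in> p" "x \<in> A" "x \<in> B"
  shows "A = B"
proof -
  have "disjoint p" using assms(1) partition_onD2 by (auto simp: partitions_def)
  then have "A \<noteq> B \<Longrightarrow> A \<inter> B = {}" using assms(2,3) by (meson disjointD)
  then show ?thesis using assms(4,5) by blast
qed

text \<open>A cap absorbs the generator at the same place, up to a loop. In labels: for odd
  \<open>k\<close> the middle label of the singleton point is free, which doubles the count; for
  even \<open>k\<close> the middle row is forced to be \<open>X\<close>.\<close>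

lemma capped_cupcap:
  assumes q: "q \<in> NC (Suc n) l" and k: "1 \<le> k" "k \<le> 2 * n + 1" and c: "capped q k"
  shows "diagram_comp q (cupcap n k) = q" "loops q (cupcap n k) = of_bool (odd k)"
proof -
  have part: "cupcap n k \<in> partitions (Suc n) (Suc n)" "q \<in> partitions (Suc n) l"
    using cupcap_NC[OF k] q NC_partitions by auto
  have "card {Z. Z \<subseteq> {1..Suc n} \<and> saturated (cupcap n k) X Z \<and> saturated q Z Y} =
      (if saturated q X Y then 2 ^ of_bool (odd k) else 0)" if XY: "X \<subseteq> {1..Suc n}" "Y \<subseteq> {1..l}" for X Y
    using k
  proof (cases rule: cupcap_cases)
    case (odd i)
    have iq: "{Upper i} \<in> q" using c odd by (simp add: capped_def)
    have only: "B = {Upper i}" if "B \<in> q" "Upper i \<in> B" for B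
      using same_block[OF part(2) that(1) iq that(2)] by simp
    have ins: "saturated q Z Y \<longleftrightarrow> saturated q W Y" if "Z - {i} = W - {i}" for Z W
    proof -
      have "B \<subseteq> Upper ` Z \<union> Lower ` Y \<or> B \<inter> (Upper ` Z \<union> Lower ` Y) = {}"
        if h: "B \<in> q" "B \<subseteq> Upper ` W \<union> Lower ` Y \<or> B \<inter> (Upper ` W \<union> Lower ` Y) = {}" "Z - {i} = W - {i}" for B Z W
      proof (cases "Upper i \<in> B")
        case True
        then show ?thesis using only[OF h(1)] by auto
      next
        case False
        then have "b \<in> Upper ` Z \<union> Lower ` Y \<longleftrightarrow> b \<in> Upper ` W \<union> Lower ` Y" if "b \<in> B" for b
          using that h(3) by (cases b) auto
        from subset_or_disjoint_cong[of B, OF this] show ?thesis using h(2) by simp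
      qed
      then show ?thesis using that unfolding saturated_def by metis
    qed
    have "{Z. Z \<subseteq> {1..Suc n} \<and> saturated (cupcap n k) X Z \<and> saturated q Z Y} =
        (if saturated q X Y then {X - {i}, insert i X} else {})"
    proof -
      have "Z \<subseteq> {1..Suc n} \<and> saturated (cupcap n k) X Z \<and> saturated q Z Y \<longleftrightarrow>
          saturated q X Y \<and> (Z = X - {i} \<or> Z = insert i X)" for Z
      proof -
        have "Z \<subseteq> {1..Suc n} \<and> saturated (cupcap n k) X Z \<and> saturated q Z Y \<longleftrightarrow>
            Z \<subseteq> {1..Suc n} \<and> X - {i} = Z - {i} \<and> saturated q X Y"
          using saturated_cupcap_odd(1)[OF odd(2,3) XY(1)] ins[of Z X] unfolding odd(1) by auto
        moreover have "Z \<subseteq> {1..Suc n} \<and> X - {i} = Z - {i} \<longleftrightarrow> Z = X - {i} \<or> Z = insert i X"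
        proof
          assume Z: "Z \<subseteq> {1..Suc n} \<and> X - {i} = Z - {i}"
          show "Z = X - {i} \<or> Z = insert i X"
          proof (cases "i \<in> Z")
            case True
            then have "Z = insert i (X - {i})" using Z by (simp add: insert_absorb)
            then show ?thesis by simp
          next
            case False
            then show ?thesis using Z by simp
          qed
        qed (use XY(1) odd(2,3) in auto)
        ultimately show ?thesis by blast
      qed
      then show ?thesis by auto
    qed
    moreover have "X - {i} \<noteq> insert i X" by auto
    ultimately show ?thesis using odd by simp
  next
    case (even i)
    obtain B where B: "B \<in> q" "Upper i \<in> B" "Upper (Suc i) \<in> B" using c even by (auto simp: capped_def)
    have "i \<in> X \<longleftrightarrow> Suc i \<in> X" if "saturated q X Y"
      using that B unfolding saturated_def by blast
    then have "{Z. Z \<subseteq> {1..Suc n} \<and> saturated (cupcap n k) X Z \<and> saturated q Z Y} =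
        (if saturated q X Y then {X} else {})"
      using saturated_cupcap_even(1)[OF even(2,3) XY(1)] XY(1) unfolding even(1) by auto
    then show ?thesis using even by simp
  qed
  note * = diagram_comp_eqI[OF part part(2) this]
  show "diagram_comp q (cupcap n k) = q" "loops q (cupcap n k) = of_bool (odd k)"
    using * by blast+
qed

lemma bas_capped:
  assumes q: "q \<in> NC (Suc n) l" and k: "1 \<le> k" "k \<le> 2 * n + 1" and c: "capped q k"
  shows "rcmp t (Suc n) (Suc n) l (bas q) (bas (cupcap n k)) = rscl t (loop_weight t k) (bas q)"
  using bas_cmp[OF cupcap_NC[OF k] q, of t] capped_cupcap[OF assms] by (simp add: loop_weight_def)

text \<open>\<open>q U k\<close> is \<open>q\<close> multiplied by the loop weight, which is not 0
  under \<open>nondeg t m\<close>, while \<open>U k\<close> kills the idempotent.\<close>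

lemma capped_jw:
  assumes q: "q \<in> NC (Suc n) l" and k: "1 \<le> k" "k < m" and c: "capped q k"
    and m: "m \<le> 2 * n + 2" "nondeg t m"
  shows "rcmp t (Suc n) (Suc n) l (bas q) (jw t n m) = 0"
proof -
  interpret linear_category "Rep0_NC t" by (rule linear_category_Rep0)
  have "1 \<le> m" using k by simp
  have "rscl t (loop_weight t k) (rcmp t (Suc n) (Suc n) l (bas q) (jw t n m)) =
      rcmp t (Suc n) (Suc n) l (rcmp t (Suc n) (Suc n) l (bas q) (bas (cupcap n k))) (jw t n m)"
    using k m by (simp add: bas_capped[OF q _ _ c] Rep0_cmp_scl_left)
  also have "\<dots> = 0"
    using jw_kill[OF \<open>1 \<le> m\<close> m k] bas_hom[OF q, of t] by (simp add: Rep0_cmp_assoc)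
  finally show ?thesis
    using loop_weight_nonzero[OF m(2) k] by (simp add: V.scale_eq_0_iff)
qed

section \<open>Diagrams without caps\<close>

lemma linked_ex: "p \<in> partitions k l \<Longrightarrow> x \<in> points k l \<Longrightarrow> \<exists>B\<in>p. x \<in> B"
  using partition_onD1 by (force simp: partitions_def)

lemma linked_trans:
  assumes "p \<in> partitions k l" "linked p x y" "linked p y z"
  shows "linked p x z"
proof -
  obtain A B where AB: "A \<in> p" "x \<in> A" "y \<in> A" "B \<in> p" "y \<in> B" "z \<in> B" using assms(2,3) by blast
  have "A = B" by (rule same_block[OF assms(1) AB(1,4,3,5)])
  then show ?thesis using AB by blast
qed

lemma other_point:
  assumes "p \<in> partitions k l" "x \<in> points k l" "{x} \<notin> p"
  shows "\<exists>y\<in>points k l. y \<noteq> x \<and> linked p x y"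
proof -
  obtain B where B: "B \<in> p" "x \<in> B" using linked_ex[OF assms(1,2)] by blast
  then have "B \<noteq> {x}" using assms(3) by auto
  then obtain y where "y \<in> B" "y \<noteq> x" using B(2) by blast
  moreover have "B \<subseteq> points k l" using B assms(1) partition_onD1 by (auto simp: partitions_def)
  ultimately show ?thesis using B by blast
qed

text \<open>Two linked upper points cannot be neighbours. A point next to the left one, strictly
  between them, is not a singleton, and by planarity its block stays strictly between the two; this
  yields a shorter link.\<close>

lemma uncapped_distinct:
  assumes q: "q \<in> NC N l"
    and adj: "\<And>i. 1 \<le> i \<Longrightarrow> Suc i \<le> N \<Longrightarrow> \<not> linked q (Upper i) (Upper (Suc i))"
    and sing: "\<And>i. 1 \<le> i \<Longrightarrow> i < N \<Longrightarrow> {Upper i} \<notin> q"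
    and ij: "1 \<le> i" "i < j" "j \<le> N"
  shows "\<not> linked q (Upper i) (Upper j)"
  using ij
proof (induction "j - i" arbitrary: i j rule: less_induct)
  case less
  have part: "q \<in> partitions N l" and nc: "noncrossing N l q" using q by (auto simp: NC_def)
  show ?case
  proof
    assume l: "linked q (Upper i) (Upper j)"
    then obtain A where A: "A \<in> q" "Upper i \<in> A" "Upper j \<in> A" by blast
    have "j \<noteq> Suc i" using l adj less.prems by auto
    then have i1: "Suc i < j" using less.prems by simp
    have "Upper (Suc i) \<in> points N l" using i1 less.prems by (auto simp: points_def)
    then obtain y where y: "y \<in> points N l" "y \<noteq> Upper (Suc i)" "linked q (Upper (Suc i)) y"
      using other_point[OF part, of "Upper (Suc i)"] sing[of "Suc i"] i1 less.prems by auto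
    then obtain B where B: "B \<in> q" "Upper (Suc i) \<in> B" "y \<in> B" by blast
    have neq: "A \<noteq> B" using A B adj[of i] i1 less.prems by auto
    have "y \<noteq> Upper i" "y \<noteq> Upper j"
      using neq same_block[OF part A(1) B(1)] A B by blast+
    then have py: "position N l y \<noteq> i" "position N l y \<noteq> j"
      using y(1) less.prems by (auto simp: points_def)
    have "\<not> position N l y > j"
      using noncrossingD[OF nc A(1) B(1) A(2,3) B(2,3)] neq i1 by auto
    moreover have "\<not> position N l y < i"
      using noncrossingD[OF nc B(1) A(1) B(3,2) A(2,3)] neq i1 by auto
    ultimately have "i < position N l y" "position N l y < j" using py by auto
    then obtain y' where y': "y = Upper y'" "i < y'" "y' < j"
      using y(1) less.prems by (auto simp: points_def)
    then have "Suc i < y'" using y(2) by (metis Suc_lessI)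
    then have "\<not> linked q (Upper (Suc i)) (Upper y')"
      using less.hyps[of y' "Suc i"] y' less.prems by auto
    then show False using y y' by blast
  qed
qed

text \<open>A point of \<open>I\<close> is not a singleton and is linked to no other upper point, so
  its block contains a lower point. Two upper points with the same lower point would be linked,
  hence the choice is injective.\<close>

lemma lower_points_enough:
  assumes q: "q \<in> partitions N l"
    and dist: "\<And>i j. 1 \<le> i \<Longrightarrow> i < j \<Longrightarrow> j \<le> N \<Longrightarrow> \<not> linked q (Upper i) (Upper j)"
    and I: "I \<subseteq> {1..N}" "\<And>i. i \<in> I \<Longrightarrow> {Upper i} \<notin> q"
  obtains f where "inj_on f I" "f ` I \<subseteq> {1..l}" "\<And>i. i \<in> I \<Longrightarrow> linked q (Upper i) (Lower (f i))"
proof -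
  have d: "\<not> linked q (Upper i) (Upper j)" if "i \<noteq> j" "i \<in> {1..N}" "j \<in> {1..N}" for i j
    using dist[of i j] dist[of j i] that by (cases "i < j") auto
  have "\<exists>j\<in>{1..l}. linked q (Upper i) (Lower j)" if i: "i \<in> I" for i
  proof -
    have "Upper i \<in> points N l" using i I by (auto simp: points_def)
    then obtain y where y: "y \<in> points N l" "y \<noteq> Upper i" "linked q (Upper i) y"
      using other_point[OF q _ I(2)[OF i]] by blast
    show ?thesis
    proof (cases y)
      case (Upper j)
      then show ?thesis using y d[of i j] i I(1) by (auto simp: points_def)
    next
      case (Lower j)
      then show ?thesis using y by (auto simp: points_def)
    qed
  qed
  then obtain f where f: "\<And>i. i \<in> I \<Longrightarrow> f i \<in> {1..l} \<and> linked q (Upper i) (Lower (f i))" by metis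
  have "inj_on f I"
  proof (rule inj_onI, rule ccontr)
    fix i j assume ij: "i \<in> I" "j \<in> I" "f i = f j" "i \<noteq> j"
    then have "linked q (Upper i) (Lower (f i))" "linked q (Lower (f i)) (Upper j)" using f by (metis, metis)
    from linked_trans[OF q this] show False using d ij I(1) by blast
  qed
  then show ?thesis using that[of f] f by blast
qed

lemma strict_mono_on_id:
  fixes f :: "nat \<Rightarrow> nat"
  assumes mono: "\<And>i j. 1 \<le> i \<Longrightarrow> i < j \<Longrightarrow> j \<le> N \<Longrightarrow> f i < f j"
    and range: "f ` {1..N} \<subseteq> {1..N}" and i: "i \<in> {1..N}"
  shows "f i = i"
proof -
  have ge: "i \<le> f i" if "1 \<le> i" "i \<le> N" for i
    using that
  proof (induction i rule: nat_induct_at_least)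
    case base then show ?case using range by (auto simp: image_subset_iff)
  next
    case (Suc i) then show ?case using mono[of i "Suc i"] by auto
  qed
  have "f (N - d) \<le> N - d" if "d < N" for d
    using that
  proof (induction d)
    case 0 then show ?case using range by (auto simp: image_subset_iff)
  next
    case (Suc d)
    have "f (N - Suc d) < f (N - d)" using mono[of "N - Suc d" "N - d"] Suc.prems by auto
    then show ?case using Suc by auto
  qed
  from this[of "N - i"] ge[of i] i show ?thesis by auto
qed

text \<open>Without caps every upper point is linked to a lower point of its own, which bounds the
  number of lower points. If there are equally many, the matching \<open>f\<close> increases because
  blocks do not cross, so it is the identity and the blocks are the vertical pairs.\<close>

lemma uncapped_id:
  assumes q: "q \<in> NC (Suc n) l" and unc: "\<And>k. 1 \<le> k \<Longrightarrow> k < 2 * n + 2 \<Longrightarrow> \<not> capped q k"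
  shows "Suc n \<le> l" and "l = Suc n \<Longrightarrow> q = id_diagram (Suc n)"
proof -
  have part: "q \<in> partitions (Suc n) l" and nc: "noncrossing (Suc n) l q" using q by (auto simp: NC_def)
  have adj: "\<not> linked q (Upper i) (Upper (Suc i))" if "1 \<le> i" "Suc i \<le> Suc n" for i
    using unc[of "2 * i"] that by (simp add: capped_def)
  have sing: "{Upper i} \<notin> q" if "1 \<le> i" "i \<le> Suc n" for i
    using unc[of "2 * i - 1"] that by (simp add: capped_def)
  have dist: "\<not> linked q (Upper i) (Upper j)" if "1 \<le> i" "i < j" "j \<le> Suc n" for i j
    by (rule uncapped_distinct[OF q adj sing that]) auto
  obtain f where f: "inj_on f {1..Suc n}" "f ` {1..Suc n} \<subseteq> {1..l}"
    "\<And>i. i \<in> {1..Suc n} \<Longrightarrow> linked q (Upper i) (Lower (f i))"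
    using lower_points_enough[OF part dist, of "{1..Suc n}"] sing by auto
  show "Suc n \<le> l" using card_inj_on_le[OF f(1,2)] by simp
  show "q = id_diagram (Suc n)" if l: "l = Suc n"
  proof -
    have fmono: "f i < f j" if "1 \<le> i" "i < j" "j \<le> Suc n" for i j
    proof (rule ccontr)
      assume "\<not> f i < f j"
      moreover have "f i \<noteq> f j" using inj_onD[OF f(1), of i j] that by auto
      ultimately have "f j < f i" by simp
      have "linked q (Upper i) (Lower (f i))" "linked q (Upper j) (Lower (f j))" using f(3) that by auto
      then obtain A B where AB: "A \<in> q" "Upper i \<in> A" "Lower (f i) \<in> A" "B \<in> q" "Upper j \<in> B" "Lower (f j) \<in> B"
        by blast
      have r: "f i \<in> {1..l}" "f j \<in> {1..l}" using f(2) that by (auto simp: image_subset_iff)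
      have "A = B"
        by (rule noncrossingD[OF nc AB(1,4,2,3,5,6)]) (use that \<open>f j < f i\<close> r in auto)
      then show False using dist[OF that] AB by blast
    qed
    have fid: "f i = i" if "i \<in> {1..Suc n}" for i
      by (rule strict_mono_on_id[OF fmono _ that]) (use f(2) l in auto)
    then have link: "linked q (Upper i) (Lower i)" if "i \<in> {1..Suc n}" for i
      using f(3)[OF that] that by simp
    show ?thesis
    proof (rule partitions_eqI)
      show "q \<in> partitions (Suc n) (Suc n)" using part l by simp
      show "id_diagram (Suc n) \<in> partitions (Suc n) (Suc n)" using id_diagram_NC NC_partitions by blast
      fix X Y assume XY: "X \<subseteq> {1..Suc n}" "Y \<subseteq> {1..Suc n}"
      have "saturated q X Y \<longleftrightarrow> X = Y"
      proof
        assume s: "saturated q X Y"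
        have "i \<in> X \<longleftrightarrow> i \<in> Y" if i: "i \<in> {1..Suc n}" for i
        proof -
          obtain B where "B \<in> q" "Upper i \<in> B" "Lower i \<in> B" using link[OF i] by blast
          then show ?thesis using s unfolding saturated_def by blast
        qed
        then show "X = Y" using XY by blast
      next
        assume "X = Y"
        show "saturated q X Y"
          unfolding saturated_def
        proof
          fix B assume B: "B \<in> q"
          have sub: "B \<subseteq> points (Suc n) l" using B part partition_onD1 by (auto simp: partitions_def)
          \<comment> \<open>\<open>g\<close> is the column of a point. Every point is linked to the
            upper point of its column, and upper points of different columns are not linked.\<close>
          define g where "g x = (case x of Upper i \<Rightarrow> i | Lower i \<Rightarrow> i)" for x
          have gl: "linked q (Upper (g x)) x" "g x \<in> {1..Suc n}" if "x \<in> points (Suc n) l" for x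
          proof -
            show "g x \<in> {1..Suc n}" using that l by (auto simp: g_def points_def)
            show "linked q (Upper (g x)) x"
            proof (cases x)
              case (Upper i)
              have "linked q x x" using linked_ex[OF part that] by blast
              then show ?thesis by (simp only: Upper g_def point.case)
            next
              case (Lower i)
              have "i \<in> {1..Suc n}" using that l Lower by (auto simp: points_def)
              from link[OF this] show ?thesis by (simp only: Lower g_def point.case)
            qed
          qed
          have "g x = g y" if xy: "x \<in> B" "y \<in> B" for x y
          proof (rule ccontr)
            assume "g x \<noteq> g y"
            have pts: "x \<in> points (Suc n) l" "y \<in> points (Suc n) l" using xy sub by auto
            have "linked q x y" using xy B by blast
            then have "linked q (Upper (g x)) y" using linked_trans[OF part gl(1)[OF pts(1)]] by blast
            moreover have "linked q y (Upper (g y))" using gl(1)[OF pts(2)] by blast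
            ultimately have 1: "linked q (Upper (g x)) (Upper (g y))" by (rule linked_trans[OF part])
            then have 2: "linked q (Upper (g y)) (Upper (g x))" by blast
            consider "g x < g y" | "g y < g x" using \<open>g x \<noteq> g y\<close> by linarith
            then show False
              using dist[of "g x" "g y"] dist[of "g y" "g x"] 1 2 gl(2)[OF pts(1)] gl(2)[OF pts(2)] by cases auto
          qed
          moreover have "x \<in> Upper ` X \<union> Lower ` Y \<longleftrightarrow> g x \<in> X" for x
            using \<open>X = Y\<close> by (cases x) (auto simp: g_def)
          ultimately show "B \<subseteq> Upper ` X \<union> Lower ` Y \<or> B \<inter> (Upper ` X \<union> Lower ` Y) = {}"
            by (intro subset_or_disjointI) metis
        qed
      qed
      then show "saturated q X Y \<longleftrightarrow> saturated (id_diagram (Suc n)) X Y"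
        using saturated_id_diagram[OF XY] by simp
    qed
  qed
qed

section \<open>The generic case\<close>


text \<open>The idempotent on all \<open>2 N\<close> strands of the object with \<open>N\<close>
  points. The case 0 is separate because \<open>jw\<close> covers only objects with at least one
  point.\<close>

definition jwf :: "complex \<Rightarrow> nat \<Rightarrow> diagram \<Rightarrow> complex" where
  "jwf t N = (case N of 0 \<Rightarrow> bas (id_diagram 0) | Suc n \<Rightarrow> jw t n (2 * n + 2))"

lemma NC_0_0: "q \<in> NC 0 0 \<Longrightarrow> q = id_diagram 0"
  by (auto simp: NC_def partitions_def points_def partition_on_empty id_diagram_def)

lemma jwf_hom: "jwf t N \<in> rhom t N N"
  by (cases N) (auto simp: jwf_def intro!: jw_hom bas_hom id_diagram_NC)

lemma mirror_jwf: "mirror (jwf t N) = jwf t N"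
  by (cases N) (auto simp: jwf_def mirror_jw mirror_bas flip_id_diagram)

lemma mirror_0 [simp]: "mirror 0 = 0"
  by (auto simp: mirror_def)

context
  fixes t :: complex
  assumes nondeg: "\<And>i. 1 \<le> i \<Longrightarrow> ratio (loop_weight t) i \<noteq> 0"
begin

lemma jwf_idem: "rcmp t N N N (jwf t N) (jwf t N) = jwf t N"
proof (cases N)
  case 0
  then show ?thesis using Rep0_idm_cmp[OF bas_hom[OF id_diagram_NC[of 0]], of t] by (simp add: jwf_def Rep0_idm)
next
  case (Suc n)
  then show ?thesis using jw_idem[where m = "2 * n + 2" and n = n and t = t] nondeg by (simp add: jwf_def)
qed

text \<open>A diagram with a cap is killed, and one without caps has at least as many lower as upper
  points, with equality only for the identity. Both the orthogonality and the one-dimensional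
  endomorphism algebras come from this.\<close>

lemma bas_jwf:
  assumes q: "q \<in> NC N l"
  shows "rcmp t N N l (bas q) (jwf t N) = 0 \<or> N \<le> l \<and> (l = N \<longrightarrow> q = id_diagram N)"
proof (cases N)
  case 0
  then show ?thesis using NC_0_0 q by auto
next
  case (Suc n)
  show ?thesis
  proof (cases "\<exists>k. 1 \<le> k \<and> k < 2 * n + 2 \<and> capped q k")
    case True
    then obtain k where k: "1 \<le> k" "k < 2 * n + 2" "capped q k" by blast
    have "rcmp t (Suc n) (Suc n) l (bas q) (jw t n (2 * n + 2)) = 0"
      by (rule capped_jw[OF _ k]) (use q Suc nondeg in auto)
    then show ?thesis by (simp add: jwf_def Suc)
  next
    case False
    then show ?thesis using uncapped_id[of q n l] q Suc by auto
  qed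
qed

lemma cmp_jwf_lower:
  assumes "l < N"
  shows "rcmp t N N l g (jwf t N) = 0"
proof (rule Rep0_cmp_zeroI)
  fix q assume "q \<in> NC N l"
  from bas_jwf[OF this] assms show "rcmp t N N l (bas q) (jwf t N) = 0" by auto
qed

lemma cmp_jwf_end: "rcmp t N N N g (jwf t N) = rscl t (g (id_diagram N)) (jwf t N)"
proof
  fix r
  have "rcmp t N N N g (jwf t N) r =
      (\<Sum>q\<in>NC N N. g q * rcmp t N N N (bas q) (jwf t N) r)"
    by (rule Rep0_cmp_expand_left)
  also have "\<dots> = (\<Sum>q\<in>NC N N. if q = id_diagram N then g q * jwf t N r else 0)"
  proof (intro sum.cong refl)
    fix q assume "q \<in> NC N N"
    then show "g q * rcmp t N N N (bas q) (jwf t N) r = (if q = id_diagram N then g q * jwf t N r else 0)"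
      using bas_jwf[of q N N] Rep0_idm_cmp[OF jwf_hom[of t N]] by (auto simp: Rep0_idm)
  qed
  also have "\<dots> = rscl t (g (id_diagram N)) (jwf t N) r"
    using id_diagram_NC by (simp add: Rep0_scl)
  finally show "rcmp t N N N g (jwf t N) r = rscl t (g (id_diagram N)) (jwf t N) r" .
qed

end

text \<open>In a composite with the generator \<open>k\<close> at the bottom the label of the
  isolated lower point is free, or the labels of the two joined lower points agree. The pair
  \<open>(X, Y)\<close> witnesses that \<open>v\<close> violates this, so \<open>v\<close> does not
  arise as such a composite.\<close>

lemma cupcap_coeff:
  assumes v: "v \<in> NC j (Suc n)" and k: "1 \<le> k" "k \<le> 2 * n + 1"
    and XY: "X \<subseteq> {1..j}" "Y \<subseteq> {1..Suc n}"
    and odd: "odd k \<Longrightarrow> saturated v X Y \<and> \<not> saturated v X (Y - {Suc k div 2})"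
    and even: "even k \<Longrightarrow> saturated v X Y \<and> k div 2 \<in> Y \<and> Suc (k div 2) \<notin> Y"
  shows "rcmp t j (Suc n) (Suc n) (bas (cupcap n k)) z v = 0"
proof -
  have "diagram_comp (cupcap n k) p \<noteq> v" if p: "p \<in> NC j (Suc n)" for p
  proof
    assume vp: "diagram_comp (cupcap n k) p = v"
    have sat: "saturated v X Y' \<longleftrightarrow> (\<exists>Z\<subseteq>{1..Suc n}. saturated p X Z \<and> saturated (cupcap n k) Z Y')"
      if "Y' \<subseteq> {1..Suc n}" for Y'
      unfolding vp[symmetric]
      by (rule saturated_diagram_comp[OF NC_partitions[OF p] NC_partitions[OF cupcap_NC[OF k]] XY(1) that])
    show False
      using k
    proof (cases rule: cupcap_cases)
      case o: (odd i)
      have "saturated v X Y" "\<not> saturated v X (Y - {i})" using odd o by auto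
      moreover have "saturated (cupcap n k) Z Y \<longleftrightarrow> saturated (cupcap n k) Z (Y - {i})" if "Z \<subseteq> {1..Suc n}" for Z
        using saturated_cupcap_odd(1)[OF o(2,3) that, of Y] saturated_cupcap_odd(1)[OF o(2,3) that, of "Y - {i}"] XY(2)
        unfolding o(1) by auto
      ultimately show False using sat[of Y] sat[of "Y - {i}"] XY(2) by blast
    next
      case e: (even i)
      have "saturated v X Y" "i \<in> Y" "Suc i \<notin> Y" using even e by auto
      then show False
        using sat[OF XY(2)] saturated_cupcap_even(1)[OF e(2,3) _ XY(2)] unfolding e(1) by blast
    qed
  qed
  note * = this
  show ?thesis
    unfolding Rep0_cmp
  proof (intro sum.neutral ballI)
    fix q p assume "q \<in> NC (Suc n) (Suc n)" "p \<in> NC j (Suc n)"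
    then show "bas (cupcap n k) q * z p * t ^ loops q p * of_bool (diagram_comp q p = v) = 0"
      using *[of p] by (cases "q = cupcap n k") (auto simp: bas_def)
  qed
qed

text \<open>The identity diagram is not a left multiple of a generator, so by
  \<open>jw_coeff\<close> the idempotent inherits its coefficient from the identity; in particular
  it is not 0.\<close>

lemma jwf_id_diagram: "jwf t N (id_diagram N) = 1"
proof (cases N)
  case 0 then show ?thesis by (simp add: jwf_def bas_def)
next
  case (Suc n)
  have h: "bas (id_diagram (Suc n)) \<in> rhom t (Suc n) (Suc n)" by (rule bas_hom[OF id_diagram_NC])
  have "rcmp t (Suc n) (Suc n) (Suc n) (jw t n (2 * n + 2)) (bas (id_diagram (Suc n))) (id_diagram (Suc n)) =
      bas (id_diagram (Suc n)) (id_diagram (Suc n))"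
  proof (rule jw_coeff[OF _ h])
    fix k z assume k: "1 \<le> k" "k < 2 * n + 2"
    \<comment> \<open>For even \<open>k\<close> the quotient \<open>Suc k div 2\<close> equals
      \<open>k div 2\<close>, so one labelling serves both parities.\<close>
    show "rcmp t (Suc n) (Suc n) (Suc n) (bas (cupcap n k)) z (id_diagram (Suc n)) = 0"
      by (rule cupcap_coeff[OF id_diagram_NC, where X = "{Suc k div 2}" and Y = "{Suc k div 2}"])
        (use k in \<open>auto simp: saturated_id_diagram\<close>)
  qed simp
  then show ?thesis
    using Rep0_cmp_idm[OF jw_hom[where m = "2 * n + 2" and n = n and t = t]] by (simp add: Suc jwf_def Rep0_idm bas_def)
qed

text \<open>The ideal condition is proved by induction on the number of points: the identity of
  \<open>n + 1\<close> points differs from \<open>jw t n (2 n + 2)\<close> by left multiples of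
  generators, and these factor through the object with \<open>n\<close> points.\<close>

theorem semisimple_Rep_S_plus:
  assumes nondeg: "\<And>i. 1 \<le> i \<Longrightarrow> ratio (loop_weight t) i \<noteq> 0"
  shows "semisimple_category (Rep_S_plus t)"
proof -
  interpret R: linear_category "Rep0_NC t" by (rule linear_category_Rep0)
  let ?C = "Rep0_NC t" and ?I = "idempotent_completion (Rep0_NC t)"
  interpret I: linear_category ?I by (rule linear_category_idempotent_completion[OF linear_category_Rep0])
  define V where "V n = (n, jwf t n)" for n
  have IH: "hom ?I (X, e) (Y, e') = {f \<in> hom ?C X Y. cmp ?C X X Y f e = f \<and> cmp ?C X Y Y e' f = f}" for X e Y e'
    by (simp add: idempotent_completion_def)
  have Icmp: "cmp ?I (X, e) (Y, e') (Z, e'') = cmp ?C X Y Z" for X e Y e' Z e''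
    by (simp add: idempotent_completion_def)
  have Iobj: "(X, e) \<in> obj ?I \<longleftrightarrow> e \<in> hom ?C X X \<and> cmp ?C X X X e e = e" for X e
    by (simp add: idempotent_completion_def)
  have Iscl: "scl ?I = scl ?C" by (simp add: idempotent_completion_def)
  have idm: "bas (id_diagram n) \<in> hom ?C n n" for n by (rule bas_hom[OF id_diagram_NC])
  note idl = Rep0_idm_cmp[unfolded Rep0_idm] and idr = Rep0_cmp_idm[unfolded Rep0_idm]
  have Vobj: "V n \<in> obj ?I" for n
    unfolding V_def Iobj using jwf_hom jwf_idem[OF nondeg] by blast
  define E where "E n = (n, bas (id_diagram n))" for n
  have Eobj: "E n \<in> obj ?I" for n unfolding E_def Iobj using idm idl by blast
  have EE: "hom ?I (E m) (E n) = hom ?C m n" for m n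
    unfolding E_def IH using idl idr by blast
  have Ecmp: "cmp ?I (E l) (E m) (E n) = cmp ?C l m n" for l m n by (simp add: E_def Icmp)
  have fac: "factors ?I V (E N) (E N) (bas (id_diagram N))" for N
  proof (induction N)
    case 0
    have "bas (id_diagram 0) \<in> hom ?I (V 0) (E 0)" "bas (id_diagram 0) \<in> hom ?I (E 0) (V 0)"
      using idm idl by (auto simp: V_def E_def IH jwf_def)
    note * = factors.step[of ?I V "E 0" "E 0" 0 _ 0, OF factors.zero this]
    have "0 + cmp ?I (E 0) (V 0) (E 0) (bas (id_diagram 0)) (bas (id_diagram 0)) = bas (id_diagram 0)"
      using idl[OF idm, of 0] by (simp add: V_def E_def Icmp)
    then show ?case using * by (simp only:)
  next
    case (Suc n)
    let ?G = "{g. factors ?I V (E (Suc n)) (E (Suc n)) g}"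
    have "R.V.subspace ?G"
    proof (rule R.V.subspaceI)
      show "0 \<in> ?G" by (simp only: mem_Collect_eq factors.zero)
      show "x + y \<in> ?G" if "x \<in> ?G" "y \<in> ?G" for x y using I.factors_add that by blast
      fix c g assume g: "g \<in> ?G"
      then have h: "g \<in> hom ?C (Suc n) (Suc n)"
        using I.factors_hom[of V "E (Suc n)" "E (Suc n)" g] Eobj Vobj by (auto simp: EE)
      have "factors ?I V (E (Suc n)) (E (Suc n)) (cmp ?I (E (Suc n)) (E (Suc n)) (E (Suc n)) (scl ?C c (bas (id_diagram (Suc n))))
          (cmp ?I (E (Suc n)) (E (Suc n)) (E (Suc n)) g (bas (id_diagram (Suc n)))))"
        using g Eobj Vobj idm R.hom_scl[OF _ _ idm] by (intro I.factors_cmp) (auto simp: EE)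
      then show "scl ?C c g \<in> ?G" using h by (simp add: Ecmp idl idr Rep0_cmp_scl_left)
    qed
    moreover have "cmp ?C (Suc n) (Suc n) (Suc n) (bas (cupcap n k)) z \<in> ?G" if k: "1 \<le> k" "k < 2 * n + 2" for k z
    proof -
      have k': "1 \<le> k" "k \<le> 2 * n + 1" using k by auto
      let ?y = "cmp ?C (Suc n) (Suc n) n (bas (flip (up n k))) z"
      have y: "?y \<in> hom ?C (Suc n) n" by (rule Rep0_cmp_hom)
      have "factors ?I V (E (Suc n)) (E (Suc n)) (cmp ?I (E (Suc n)) (E n) (E (Suc n)) (bas (up n k))
          (cmp ?I (E (Suc n)) (E n) (E n) (bas (id_diagram n)) ?y))"
        using Suc Eobj Vobj y bas_hom[OF up_NC[OF k'], of t] by (intro I.factors_cmp) (auto simp: EE)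
      then show ?thesis
        by (simp add: Ecmp idl[OF y] bas_cupcap[OF k', of t] Rep0_cmp_assoc)
    qed
    ultimately have "jw t n (2 * n + 2) - bas (id_diagram (Suc n)) \<in> ?G"
      by (intro jw_cong_id) auto
    moreover have "jw t n (2 * n + 2) \<in> ?G"
    proof -
      have "jwf t (Suc n) \<in> hom ?I (V (Suc n)) (E (Suc n))" "jwf t (Suc n) \<in> hom ?I (E (Suc n)) (V (Suc n))"
        using jwf_hom jwf_idem[OF nondeg] idl idr by (auto simp: V_def E_def IH)
      note * = factors.step[of ?I V "E (Suc n)" "E (Suc n)" 0 _ "Suc n", OF factors.zero this]
      have "0 + cmp ?I (E (Suc n)) (V (Suc n)) (E (Suc n)) (jwf t (Suc n)) (jwf t (Suc n)) = jw t n (2 * n + 2)"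
        using jwf_idem[OF nondeg, of "Suc n"] by (simp add: V_def E_def Icmp jwf_def)
      then show ?thesis using * by (simp only: mem_Collect_eq)
    qed
    ultimately have "jw t n (2 * n + 2) - (jw t n (2 * n + 2) - bas (id_diagram (Suc n))) \<in> ?G"
      using R.V.subspace_diff \<open>R.V.subspace ?G\<close> by blast
    then show ?case by simp
  qed
  have "semisimple_category (karoubi_envelope ?C)"
  proof (rule semisimple_karoubi_envelopeI[where V = V])
    show "linear_category ?C" by (rule linear_category_Rep0)
    show "range V \<subseteq> obj ?I" using Vobj by blast
    show "snd (V n) \<noteq> 0" for n
    proof
      assume "snd (V n) = 0"
      then have "jwf t n (id_diagram n) = 0" by (simp add: V_def)
      then show False by (simp add: jwf_id_diagram)
    qed
    show "factors ?I V (X, idm ?C X) (X, idm ?C X) (idm ?C X)" for X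
      using fac[of X] by (simp add: E_def Rep0_idm)
  next
    fix m n f assume mn: "m \<noteq> n" and f: "f \<in> hom ?I (V m) (V n)"
    then have f: "f \<in> hom ?C m n" "cmp ?C m m n f (jwf t m) = f" "cmp ?C m n n (jwf t n) f = f"
      by (auto simp: V_def IH)
    show "f = 0"
    proof (cases "n < m")
      case True
      then show ?thesis using cmp_jwf_lower[OF nondeg True] f by metis
    next
      case False
      then have "m < n" using mn by simp
      \<comment> \<open>Since \<open>mirror\<close> fixes the idempotents, a morphism from fewer to
        more points is treated through its reflection.\<close>
      have "mirror f = cmp ?C n n m (mirror f) (jwf t n)"
        using f(3) mirror_cmp[of t m n n "jwf t n" f] by (simp add: mirror_jwf)
      also have "\<dots> = 0" by (rule cmp_jwf_lower[OF nondeg \<open>m < n\<close>])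
      finally have "mirror (mirror f) = 0" by simp
      then show ?thesis by simp
    qed
  next
    fix n f assume "f \<in> hom ?I (V n) (V n)"
    then have "cmp ?C n n n f (jwf t n) = f" by (auto simp: V_def IH)
    then show "\<exists>c. f = scl ?C c (snd (V n))" using cmp_jwf_end[OF nondeg, of n f] by (metis V_def snd_conv)
  qed
  then show ?thesis by (simp add: Rep_S_plus_def)
qed

section \<open>The exceptional values\<close>


lemma jw_1: "jw t n (Suc 0) = bas (id_diagram (Suc n))"
proof -
  interpret J: jones_wenzl "rscl t" "rcmp t (Suc n) (Suc n) (Suc n)" "bas (id_diagram (Suc n))"
    "\<lambda>k. bas (cupcap n k)" "loop_weight t" "2 * n + 1" by (rule jones_wenzl_Rep0)
  show ?thesis unfolding jw_def by (rule J.p_1)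
qed

text \<open>Since the ratio vanishes, so does the contraction of \<open>jw t n m\<close> between two
  generators \<open>U m\<close>. Capping and cupping these generators from outside closes one loop
  each, with value \<open>loop_weight t m\<close>, and the two non-zero factors can be
  cancelled.\<close>

lemma cap_jw_up:
  assumes m: "1 \<le> m" "m \<le> 2 * n + 1" "nondeg t m" "ratio (loop_weight t) m = 0" and w: "loop_weight t m \<noteq> 0"
  shows "rcmp t n (Suc n) n (bas (flip (up n m)))
    (rcmp t n (Suc n) (Suc n) (jw t n m) (bas (up n m))) = 0"
proof -
  interpret linear_category "Rep0_NC t" by (rule linear_category_Rep0)
  let ?c = "rcmp t" and ?u = "bas (up n m)" and ?u' = "bas (flip (up n m))" and ?U = "bas (cupcap n m)"
  let ?S = "Suc n" and ?w = "loop_weight t m"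
  have h: "?u \<in> rhom t n ?S" "?u' \<in> rhom t ?S n"
    using m up_NC flip_NC bas_hom by auto
  note idm = Rep0_idm_cmp[unfolded Rep0_idm] Rep0_cmp_idm[unfolded Rep0_idm]
  have "?c ?S ?S n ?u' ?U = ?c ?S n n (?c n ?S n ?u' ?u) ?u'"
    by (simp only: bas_cupcap[OF m(1,2), of t] Rep0_cmp_assoc)
  then have 1: "?c ?S ?S n ?u' ?U = rscl t ?w ?u'"
    by (simp only: bas_up_cap[OF m(1,2)] Rep0_cmp_scl_left idm h)
  have "?c n ?S ?S ?U ?u = ?c n n ?S ?u (?c n ?S n ?u' ?u)"
    by (simp only: bas_cupcap[OF m(1,2), of t] Rep0_cmp_assoc)
  then have 2: "?c n ?S ?S ?U ?u = rscl t ?w ?u"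
    by (simp only: bas_up_cap[OF m(1,2)] Rep0_cmp_scl_right idm h)
  have "?c ?S ?S ?S ?U (?c ?S ?S ?S (jw t n m) ?U) = 0"
    using jw_sandwich[OF m(1) _ m(3,2)] m by simp
  then have "0 = ?c n ?S n ?u' (?c n ?S ?S (?c ?S ?S ?S ?U (?c ?S ?S ?S (jw t n m) ?U)) ?u)"
    using h by simp
  also have "\<dots> = ?c n ?S n (?c ?S ?S n ?u' ?U) (?c n ?S ?S (jw t n m) (?c n ?S ?S ?U ?u))"
    by (simp only: Rep0_cmp_assoc)
  also have "\<dots> = rscl t (?w * ?w) (?c n ?S n ?u' (?c n ?S ?S (jw t n m) ?u))"
    by (simp only: 1 2 Rep0_cmp_scl_left Rep0_cmp_scl_right V.scale_scale)
  finally show ?thesis using w by (simp add: V.scale_eq_0_iff)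
qed

lemma not_semisimpleI:
  assumes x: "x \<in> rhom t a b" "x \<noteq> 0" and ann: "\<And>q. q \<in> NC b a \<Longrightarrow> rcmp t a b a (bas q) x = 0"
  shows "\<not> semisimple_category (Rep_S_plus t)"
proof
  assume "semisimple_category (Rep_S_plus t)"
  then obtain g where "rcmp t a b a g x \<noteq> 0"
    using semisimple_karoubi_envelopeD[OF _ linear_category_Rep0 _ _ x] by (auto simp: Rep_S_plus_def)
  then show False using Rep0_cmp_zeroI[OF ann] by blast
qed

text \<open>Let \<open>m\<close> be the first zero of the ratios. The annihilated morphism is the Jones--Wenzl idempotent
  with a cup attached to its last strand. Closing that strand yields 0, and any other diagram puts a
  cap on the idempotent. For even \<open>m\<close> one more strand has to be bent, since the cup joining the points
  \<open>Suc n\<close> and \<open>Suc (Suc n)\<close> must be nested inside another one to leave only \<open>n\<close> free points.\<close>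

lemma not_semisimple_odd:
  assumes m: "m = 2 * n + 1" "nondeg t m" "ratio (loop_weight t) m = 0"
  shows "\<not> semisimple_category (Rep_S_plus t)"
proof (rule not_semisimpleI)
  interpret linear_category "Rep0_NC t" by (rule linear_category_Rep0)
  let ?c = "rcmp t" and ?u = "bas (up n m)" and ?u' = "bas (flip (up n m))" and ?U = "bas (cupcap n m)"
  let ?S = "Suc n" and ?w = "loop_weight t m" and ?x = "rcmp t n (Suc n) (Suc n) (jw t n m) (bas (up n m))"
  have m': "1 \<le> m" "m \<le> 2 * n + 1" "m \<le> 2 * n + 2" using m by auto
  have upNC: "up n m \<in> NC n ?S" using up_NC[OF m'(1,2)] .
  show "?x \<in> rhom t n ?S" by (rule Rep0_cmp_hom)
  have "?x (up n m) = ?u (up n m)"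
  proof (rule jw_coeff[OF m'(3) bas_hom[OF upNC]])
    fix k z assume k: "1 \<le> k" "k < m"
    have up: "up n m = face n (Suc n)" using m by (simp add: up_def)
    have i: "odd k \<Longrightarrow> Suc k div 2 \<le> n \<and> 1 \<le> Suc k div 2" "even k \<Longrightarrow> k div 2 \<le> n \<and> 1 \<le> k div 2"
      using k m by (auto elim!: oddE evenE)
    \<comment> \<open>The point at which the generator acts, the left one of two for even
      \<open>k\<close>. It is never the isolated lower point \<open>n + 1\<close> of the cup, so the
      label \<open>{i}\<close> in both rows is saturated.\<close>
    define i where "i = (if odd k then Suc k div 2 else k div 2)"
    have i': "1 \<le> i" "i \<le> n" using i by (auto simp: i_def)
    have pre: "coface_pre n (Suc n) Y = Y \<inter> {1..n}" for Y by (auto simp: coface_pre_def coface_def)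
    have sat: "saturated (up n m) {i} Y \<longleftrightarrow> {i} = Y \<inter> {1..n}" if "Y \<subseteq> {1..Suc n}" for Y
      unfolding up pre[symmetric] by (rule saturated_face) (use i' that in auto)
    show "?c n ?S ?S (bas (cupcap n k)) z (up n m) = 0"
      by (rule cupcap_coeff[OF upNC, where X = "{i}" and Y = "{i}"])
        (use k m i' sat[of "{i}"] sat[of "{}"] in \<open>auto simp: i_def\<close>)
  qed
  then show "?x \<noteq> 0" by (auto simp: bas_def)
  fix q assume q: "q \<in> NC ?S n"
  show "?c n ?S n (bas q) ?x = 0"
  proof (cases "\<exists>k. 1 \<le> k \<and> k < m \<and> capped q k")
    case True
    then obtain k where k: "1 \<le> k" "k < m" "capped q k" by blast
    have "?c ?S ?S n (bas q) (jw t n m) = 0" by (rule capped_jw[OF q k m'(3) m(2)])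
    then show ?thesis using bas_hom[OF upNC, of t] by (simp add: Rep0_cmp_assoc[symmetric])
  next
    case unc: False
    \<comment> \<open>Otherwise \<open>q\<close> would have no cap at all, and
      \<open>uncapped_id\<close> would demand \<open>n + 1\<close> lower points where there are
      \<open>n\<close>.\<close>
    have c: "capped q m"
    proof (rule ccontr)
      assume "\<not> capped q m"
      then have "\<not> capped q k" if "1 \<le> k" "k < 2 * n + 2" for k
        using unc that m(1) by (cases "k = m") auto
      from uncapped_id(1)[OF q this] show False by simp
    qed
    show ?thesis
    proof (cases "?w = 0")
      case False
      have "?c n ?S n ?u' ?x = 0" by (rule cap_jw_up[OF m'(1,2) m(2,3) False])
      moreover have "rscl t ?w (?c n ?S n (bas q) ?x) = ?c n ?S n (?c ?S ?S n (bas q) ?U) ?x"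
        using bas_capped[OF q m'(1,2) c] by (simp add: Rep0_cmp_scl_left)
      moreover have "?c n ?S n (?c ?S ?S n (bas q) ?U) ?x = ?c n n n (?c n ?S n (bas q) ?u) (?c n ?S n ?u' ?x)"
        by (simp only: bas_cupcap[OF m'(1,2), of t] Rep0_cmp_assoc)
      ultimately have "rscl t ?w (?c n ?S n (bas q) ?x) = 0"
        using Rep0_cmp_hom by simp
      then show ?thesis using False by (simp add: V.scale_eq_0_iff)
    next
      case True
      then have "m = 1" using loop_weight_nonzero[OF m(2), of 1] m(1) by (cases "m = 1") (auto simp: loop_weight_def)
      then have n: "n = 0" using m by simp
      have one: "r = {{Upper 1}}" if "r \<in> NC (Suc 0) 0" for r
      proof -
        have r: "partition_on {Upper 1} r" using that by (auto simp: NC_def partitions_def points_def)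
        then have "B = {Upper 1}" if "B \<in> r" for B
          using that partition_onD1[OF r] partition_onD3[OF r] by (metis Sup_upper subset_singletonD)
        moreover have "r \<noteq> {}" using partition_onD1[OF r] by auto
        ultimately show ?thesis by blast
      qed
      have "q = flip (up n m)" using one[of q] one[of "flip (up n m)"] q flip_NC[OF upNC] n by simp
      then have "?c n ?S n (bas q) ?u = 0" using bas_up_cap[OF m'(1,2), of t] True by simp
      moreover have "?x = ?u"
        using Rep0_idm_cmp[OF bas_hom[OF upNC], of t] \<open>m = 1\<close> by (simp add: jw_1 Rep0_idm)
      ultimately show ?thesis by simp
    qed
  qed
qed

lemma not_semisimple_even:
  assumes m: "m = 2 * Suc n" "nondeg t m" "ratio (loop_weight t) m = 0"
  shows "\<not> semisimple_category (Rep_S_plus t)"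
proof (rule not_semisimpleI)
  interpret linear_category "Rep0_NC t" by (rule linear_category_Rep0)
  let ?N = "Suc n" let ?S = "Suc ?N"
  let ?c = "rcmp t" and ?u = "bas (up ?N m)" and ?u' = "bas (flip (up ?N m))" and ?U = "bas (cupcap ?N m)"
  \<comment> \<open>\<open>a\<close> adds the isolated lower point \<open>n + 1\<close>, which
    \<open>up\<close> then doubles: \<open>v\<close> consists of \<open>n\<close> vertical pairs and
    the block of the lower points \<open>n + 1\<close> and \<open>n + 2\<close>.\<close>
  define a where "a = up n (2 * n + 1)"
  let ?x = "?c n ?S ?S (jw t ?N m) (?c n ?N ?S ?u (bas a))"
  have m': "1 \<le> m" "m \<le> 2 * ?N + 1" "m \<le> 2 * ?N + 2" using m by auto
  have upNC: "up ?N m \<in> NC ?N ?S" "a \<in> NC n ?N" using up_NC[OF m'(1,2)] up_NC[of "2 * n + 1" n] by (auto simp: a_def)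
  \<comment> \<open>This makes any power of \<open>t\<close> in the composite of \<open>up\<close>
    and \<open>a\<close> harmless, so the loops there need not be counted.\<close>
  have t: "t \<noteq> 0" using loop_weight_nonzero[OF m(2), of 1] m(1) by (simp add: loop_weight_def)
  define v where "v = diagram_comp (up ?N m) a"
  have v: "v \<in> NC n ?S" unfolding v_def by (rule noncrossing_diagram_comp[OF upNC(2,1)])
  show "?x \<in> rhom t n ?S" by (rule Rep0_cmp_hom)
  have "?x v = ?c n ?N ?S ?u (bas a) v"
  proof (rule jw_coeff[OF m'(3) Rep0_cmp_hom])
    fix k z assume k: "1 \<le> k" "k < m"
    have a: "a = face n ?N" by (simp add: a_def up_def)
    have up: "up ?N m = flip (degen ?N ?N)" using m by (simp add: up_def)
    have pre: "coface_pre n ?N Z = Z \<inter> {1..n}" for Z by (auto simp: coface_pre_def coface_def)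
    have sat: "saturated v X Y \<longleftrightarrow> (\<exists>Z\<subseteq>{1..?N}. X = Z \<inter> {1..n} \<and> Y = codegen_pre ?N ?N Z)"
      if XY: "X \<subseteq> {1..n}" "Y \<subseteq> {1..?S}" for X Y
    proof -
      have "saturated a X Z \<and> saturated (up ?N m) Z Y \<longleftrightarrow> X = Z \<inter> {1..n} \<and> Y = codegen_pre ?N ?N Z"
        if "Z \<subseteq> {1..?N}" for Z
        using saturated_face[OF XY(1) that, of ?N] saturated_degen[OF _ _ XY(2) that, of ?N]
        unfolding a up saturated_flip pre by auto
      then show ?thesis
        unfolding v_def saturated_diagram_comp[OF NC_partitions[OF upNC(2)] NC_partitions[OF upNC(1)] XY] by blast
    qed
    have both: "?N \<in> Y \<longleftrightarrow> ?S \<in> Y" if "Y = codegen_pre ?N ?N Z" for Y Z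
      using that by (auto simp: codegen_pre_def codegen_def)
    have below: "j \<in> Y \<longleftrightarrow> j \<in> Z" if "Y = codegen_pre ?N ?N Z" "j \<in> {1..n}" for j Y Z
      using that by (auto simp: codegen_pre_def codegen_def)
    define i where "i = (if odd k then Suc k div 2 else k div 2)"
    have i: "1 \<le> i" "i \<le> ?N" "even k \<Longrightarrow> i \<le> n" using k m by (auto simp: i_def elim!: oddE evenE)
    show "?c n ?S ?S (bas (cupcap ?N k)) z v = 0"
    proof (cases "i \<le> n")
      case True
      have s: "saturated v {i} {i}"
        by (subst sat) (use True i in \<open>auto intro!: exI[of _ "{i}"] simp: codegen_pre_def codegen_def split: if_splits\<close>)
      have ns: "\<not> saturated v {i} {}"
      proof
        assume "saturated v {i} {}"
        then obtain Z where "{i} = Z \<inter> {1..n}" "{} = codegen_pre ?N ?N Z" using sat[of "{i}" "{}"] True i by auto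
        then show False using below[of "{}" Z i] True i by auto
      qed
      show ?thesis
        by (rule cupcap_coeff[OF v, where X = "{i}" and Y = "{i}"])
          (use k m' m True i s ns in \<open>auto simp: i_def\<close>)
    next
      case False
      then have iN: "i = ?N" "odd k" using i by auto
      \<comment> \<open>The generator \<open>2 n + 1\<close> frees the label of the lower point
        \<open>n + 1\<close> alone, whereas in \<open>v\<close> that label is tied to the label of
        \<open>n + 2\<close>.\<close>
      have s: "saturated v {} {?N, ?S}"
        by (subst sat) (auto intro!: exI[of _ "{?N}"] simp: codegen_pre_def codegen_def split: if_splits)
      have ns: "\<not> saturated v {} {?S}"
      proof
        assume "saturated v {} {?S}"
        then obtain Z where "{?S} = codegen_pre ?N ?N Z" using sat[of "{}" "{?S}"] by auto
        from both[OF this] show False by auto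
      qed
      have "{?N, ?S} - {?N} = {?S}" by auto
      then show ?thesis
        using iN s ns k m' m
        by (intro cupcap_coeff[OF v, where X = "{}" and Y = "{?N, ?S}"]) (auto simp: i_def)
    qed
  qed
  also have "\<dots> \<noteq> 0"
    using t by (simp add: bas_cmp[OF upNC(2,1)] Rep0_scl bas_def v_def)
  finally show "?x \<noteq> 0" by auto
  fix q assume q: "q \<in> NC ?S n"
  show "?c n ?S n (bas q) ?x = 0"
  proof (cases "\<exists>k. 1 \<le> k \<and> k < m \<and> capped q k")
    case True
    then obtain k where k: "1 \<le> k" "k < m" "capped q k" by blast
    have "?c n ?S n (bas q) ?x = ?c n ?S n (?c ?S ?S n (bas q) (jw t ?N m)) (?c n ?N ?S ?u (bas a))"
      by (simp only: Rep0_cmp_assoc)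
    also have "?c ?S ?S n (bas q) (jw t ?N m) = 0" by (rule capped_jw[OF q k m'(3) m(2)])
    also have "?c n ?S n 0 (?c n ?N ?S ?u (bas a)) = 0"
      by (rule cmp_zero_left) (simp_all add: Rep0_cmp_hom)
    finally show ?thesis .
  next
    case unc: False
    \<comment> \<open>Without caps up to \<open>m\<close> the first \<open>n + 1\<close> upper
      points lie in distinct blocks and are not singletons, so they would need \<open>n + 1\<close>
      lower points. The last upper point may still be a singleton, which
      \<open>uncapped_distinct\<close> allows.\<close>
    have c: "capped q m"
    proof (rule ccontr)
      assume nc: "\<not> capped q m"
      have unc: "\<not> capped q k" if "1 \<le> k" "k \<le> m" for k
        using nc unc that by (cases "k = m") auto
      have adj: "\<not> linked q (Upper i) (Upper (Suc i))" if "1 \<le> i" "Suc i \<le> ?S" for i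
        using unc[of "2 * i"] that m(1) by (simp add: capped_def)
      have sing: "{Upper i} \<notin> q" if "1 \<le> i" "i < ?S" for i
        using unc[of "2 * i - 1"] that m(1) by (simp add: capped_def)
      have part: "q \<in> partitions ?S n" using q by (rule NC_partitions)
      obtain f where f: "inj_on f {1..?N}" "f ` {1..?N} \<subseteq> {1..n}"
        "\<And>i. i \<in> {1..?N} \<Longrightarrow> linked q (Upper i) (Lower (f i))"
        using lower_points_enough[OF part uncapped_distinct[OF q adj sing], of "{1..?N}"] sing by auto
      from card_inj_on_le[OF f(1,2)] show False by simp
    qed
    have w: "loop_weight t m = 1" using m by (simp add: loop_weight_def)
    have "?c n ?S n (bas q) ?x = ?c n ?S n (?c ?S ?S n (bas q) ?U) ?x"
      using bas_capped[OF q m'(1,2) c, of t] w by simp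
    also have "\<dots> = ?c n ?N n (?c ?N ?S n (bas q) ?u)
        (?c n ?N ?N (?c ?N ?S ?N ?u' (?c ?N ?S ?S (jw t ?N m) ?u)) (bas a))"
      by (simp only: bas_cupcap[OF m'(1,2), of t] Rep0_cmp_assoc)
    also have "\<dots> = 0"
      using cap_jw_up[OF m'(1,2) m(2,3)] w Rep0_cmp_hom bas_hom[OF upNC(2), of t] by simp
    finally show ?thesis .
  qed
qed

theorem not_semisimple_Rep_S_plus:
  assumes "1 \<le> m" "ratio (loop_weight t) m = 0"
  shows "\<not> semisimple_category (Rep_S_plus t)"
proof -
  define k where "k = (LEAST i. 1 \<le> i \<and> ratio (loop_weight t) i = 0)"
  have k: "1 \<le> k \<and> ratio (loop_weight t) k = 0"
    unfolding k_def by (rule LeastI[of _ m]) (use assms in auto)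
  have "nondeg t k"
    using not_less_Least[of _ "\<lambda>i. 1 \<le> i \<and> ratio (loop_weight t) i = 0"] unfolding k_def by auto
  show ?thesis
  proof (cases "odd k")
    case True
    then obtain n where "k = 2 * n + 1" by (elim oddE)
    then show ?thesis using not_semisimple_odd \<open>nondeg t k\<close> k by blast
  next
    case False
    then obtain b where "k = 2 * b" by (auto elim: evenE)
    then have "k = 2 * Suc (b - 1)" using k by (cases b) auto
    then show ?thesis using not_semisimple_even \<open>nondeg t k\<close> k by blast
  qed
qed

section \<open>Zeros of the ratios\<close>

text \<open>For \<open>t = (q + 1/q)\<^sup>2\<close> and \<open>w = q\<^sup>2\<close> the ratio is \<open>[m + 1] / [m]\<close> in quantum integers, times \<open>q + 1/q\<close>
  for odd and divided by it for even \<open>m\<close>.\<close>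


lemma ratio_formula:
  fixes t w :: complex
  assumes w: "w \<noteq> 0" "w \<noteq> 1" and t: "t = w + 1 / w + 2"
    and m: "1 \<le> m" "nondeg t m"
  shows "w ^ m \<noteq> 1 \<and> ratio (loop_weight t) m =
    (if odd m then (w + 1) * (w ^ Suc m - 1) / (w * (w ^ m - 1)) else (w ^ Suc m - 1) / ((w + 1) * (w ^ m - 1)))"
  using m
proof (induction m rule: nat_induct_at_least)
  case base
  have "t * (w * (w - 1)) = (w + 1) * (w ^ 2 - 1)"
    unfolding t using w by (simp add: field_simps power2_eq_square)
  then have "t = (w + 1) * (w ^ 2 - 1) / (w * (w - 1))"
    using w by (simp add: field_simps)
  then show ?case using w by (simp add: loop_weight_def numeral_2_eq_2)
next
  case (Suc m)
  have r: "ratio (loop_weight t) m \<noteq> 0" using Suc by auto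
  have IH: "w ^ m \<noteq> 1" "ratio (loop_weight t) m =
    (if odd m then (w + 1) * (w ^ Suc m - 1) / (w * (w ^ m - 1)) else (w ^ Suc m - 1) / ((w + 1) * (w ^ m - 1)))"
    using Suc by auto
  \<comment> \<open>For odd \<open>m\<close> both are factors of the numerator of a non-zero ratio.
    For even \<open>m\<close> the factor \<open>w + 1\<close> stands in the denominator, and
    division by 0 would make the ratio 0.\<close>
  have w1: "w + 1 \<noteq> 0" "w ^ Suc m \<noteq> 1" using r IH by (auto split: if_splits)
  define a where "a = w ^ m"
  have a: "a \<noteq> 1" "w * a \<noteq> 1" using IH(1) w1 by (auto simp: a_def)
  have nz: "a - 1 \<noteq> 0" "w * a - 1 \<noteq> 0" using a by auto
  show ?case
  proof (cases "odd m")
    case True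
    have "ratio (loop_weight t) (Suc m) = 1 - w * (a - 1) / ((w + 1) * (w * a - 1))"
      using True IH(2) by (simp add: loop_weight_def a_def)
    also have "\<dots> = ((w + 1) * (w * a - 1) - w * (a - 1)) / ((w + 1) * (w * a - 1))"
      using w1 nz by (simp add: diff_divide_distrib)
    also have "(w + 1) * (w * a - 1) - w * (a - 1) = w * (w * a) - 1" by (simp add: algebra_simps)
    finally show ?thesis using True w1 by (simp add: a_def)
  next
    case False
    have "t = (w + 1) * (w + 1) / w" unfolding t using w by (simp add: field_simps)
    then have "ratio (loop_weight t) (Suc m) = (w + 1) * (w + 1) / w - (w + 1) * (a - 1) / (w * a - 1)"
      using False IH(2) by (simp add: loop_weight_def a_def)
    also have "\<dots> = (w + 1) * ((w + 1) * (w * a - 1) - w * (a - 1)) / (w * (w * a - 1))"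
      using w nz by (simp add: divide_simps) (simp add: algebra_simps)
    also have "(w + 1) * (w * a - 1) - w * (a - 1) = w * (w * a) - 1" by (simp add: algebra_simps)
    finally show ?thesis using False w1 by (simp add: a_def)
  qed
qed

text \<open>The value \<open>t = 4\<close> belongs to \<open>w = 1\<close>, where the quotients of
  quantum integers degenerate to \<open>(m + 1) / m\<close>, times 2 or 1/2, and never
  vanish.\<close>

lemma ratio_four:
  assumes "1 \<le> m"
  shows "ratio (loop_weight 4) m =
    (if odd m then 2 * of_nat (Suc m) / of_nat m else of_nat (Suc m) / (2 * of_nat m))"
  using assms
proof (induction m rule: nat_induct_at_least)
  case (Suc m)
  have nz: "(of_nat m :: complex) \<noteq> 0" "1 + (of_nat m :: complex) \<noteq> 0"
    using Suc by (auto simp flip: of_nat_Suc)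
  moreover have "2 + (of_nat m :: complex) * 2 \<noteq> 0" using nz(2) by (simp add: add_eq_0_iff algebra_simps)
  ultimately show ?case using Suc by (auto simp: loop_weight_def divide_simps) (auto simp: algebra_simps)
qed (simp add: loop_weight_def)

text \<open>The double angle formula, with \<open>cis (2 x)\<close> for \<open>x = j pi / l\<close>:
  the sum is \<open>2 cos (2 x) + 2\<close>, and halving the angle of the root of unity gives the
  angle in the theorem.\<close>

lemma cis_weight:
  "cis (2 * pi * real j / real l) + 1 / cis (2 * pi * real j / real l) + 2 =
    complex_of_real (4 * (cos (real j * pi / real l))\<^sup>2)"
proof -
  define x where "x = real j * pi / real l"
  have x: "2 * pi * real j / real l = 2 * x" by (simp add: x_def)
  have "1 / cis (2 * x) = cis (- (2 * x))" by (simp add: cis_inverse[symmetric] inverse_eq_divide)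
  moreover have "cis (2 * x) + cis (- (2 * x)) + 2 = complex_of_real (2 * cos (2 * x) + 2)"
    by (simp add: complex_eq_iff)
  moreover have "2 * cos (2 * x) + 2 = 4 * (cos x)\<^sup>2" by (simp add: cos_double_cos)
  ultimately show ?thesis unfolding x x_def[symmetric] by simp
qed

text \<open>At the first zero \<open>m\<close> the factor \<open>w ^ Suc m - 1\<close> of the
  numerator vanishes, so \<open>w\<close> is a root of unity with exponent \<open>l = m + 1\<close>.
  Conversely an \<open>l\<close>-th root of unity other than 1 forces a zero, at the latest at index
  \<open>l - 1\<close>.\<close>

lemma ratio_zero_iff:
  "(\<exists>m\<ge>1. ratio (loop_weight t) m = 0) \<longleftrightarrow>
    t \<in> {complex_of_real (4 * (cos (real j * pi / real l))\<^sup>2) | j l :: nat. l \<ge> 2 \<and> j \<in> {1..l - 1}}"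
proof
  assume "\<exists>m\<ge>1. ratio (loop_weight t) m = 0"
  then have ex: "\<exists>m. 1 \<le> m \<and> ratio (loop_weight t) m = 0" by blast
  define m where "m = (LEAST i. 1 \<le> i \<and> ratio (loop_weight t) i = 0)"
  have m: "1 \<le> m" "ratio (loop_weight t) m = 0" using LeastI_ex[OF ex] unfolding m_def by auto
  have nd: "nondeg t m"
    using not_less_Least[of _ "\<lambda>i. 1 \<le> i \<and> ratio (loop_weight t) i = 0"] unfolding m_def by auto
  \<comment> \<open>The quadratic formula for \<open>w * w - (t - 2) * w + 1 = 0\<close>, which is
    \<open>t = w + 1 / w + 2\<close>.\<close>
  define x where "x = (t - 2) + csqrt ((t - 2)\<^sup>2 - 4)"
  define w where "w = x / 2"
  have "2 * w = x" by (simp add: w_def)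
  then have "2 * w - (t - 2) = csqrt ((t - 2)\<^sup>2 - 4)" by (simp add: x_def)
  then have "(2 * w - (t - 2))\<^sup>2 = (t - 2)\<^sup>2 - 4" by simp
  then have "4 * (w\<^sup>2 - (t - 2) * w + 1) = 0" by (simp add: power2_eq_square algebra_simps)
  then have quad: "w\<^sup>2 - (t - 2) * w + 1 = 0" by (simp only: mult_eq_0_iff) simp
  then have w0: "w \<noteq> 0" by auto
  have t: "t = w + 1 / w + 2"
  proof -
    have "w * (w + 1 / w + 2 - t) = 0" using quad w0 by (simp add: power2_eq_square algebra_simps)
    then show ?thesis using w0 by simp
  qed
  have w1: "w \<noteq> 1"
  proof
    assume "w = 1"
    then have "t = 4" using t by simp
    then have "ratio (loop_weight t) m \<noteq> 0" using ratio_four[OF m(1)] m(1) by (auto simp flip: of_nat_Suc)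
    then show False using m by simp
  qed
  note f = ratio_formula[OF w0 w1 t m(1) nd]
  have wm: "w ^ Suc m = 1"
  proof (rule ccontr)
    assume ne: "w ^ Suc m \<noteq> 1"
    \<comment> \<open>The remaining factor of the numerator for odd \<open>m\<close>, or a vanishing
      denominator for even \<open>m\<close>. It means \<open>w = - 1\<close> and
      \<open>t = 0\<close>; then the first zero is \<open>m = 1\<close>, and
      \<open>w ^ 2 = 1\<close> after all.\<close>
    then have "w + 1 = 0" using f m(2) w0 by (auto split: if_splits)
    then have wn: "w = - 1" by (simp add: eq_neg_iff_add_eq_0)
    then have "t = 0" using t by simp
    then have "ratio (loop_weight t) 1 = 0" by (simp add: loop_weight_def)
    then have "m = 1" using nd m(1) by (cases "m = 1") auto
    then show False using ne wn by simp
  qed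
  then have "w \<in> {z. z ^ Suc m = 1}" by simp
  then obtain j where j: "j < Suc m" "w = cis (2 * pi * real j / real (Suc m))"
    using bij_betw_roots_unity[of "Suc m"] unfolding bij_betw_def by auto
  have "j \<noteq> 0" using j(2) w1 by (intro notI) simp
  then show "t \<in> {complex_of_real (4 * (cos (real j * pi / real l))\<^sup>2) | j l :: nat. l \<ge> 2 \<and> j \<in> {1..l - 1}}"
    unfolding mem_Collect_eq
  proof (intro exI conjI)
    show "t = complex_of_real (4 * (cos (real j * pi / real (Suc m)))\<^sup>2)"
      using cis_weight[of j "Suc m"] t by (simp only: j(2))
  qed (use j(1) m(1) in auto)
next
  assume "t \<in> {complex_of_real (4 * (cos (real j * pi / real l))\<^sup>2) | j l :: nat. l \<ge> 2 \<and> j \<in> {1..l - 1}}"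
  then obtain j l :: nat where j: "j \<in> {1..l - 1}" and l2: "l \<ge> 2"
    and t: "t = complex_of_real (4 * (cos (real j * pi / real l))\<^sup>2)" by blast
  have l: "l \<ge> 2" "1 \<le> j" "j < l" using j l2 by auto
  define w where "w = cis (2 * pi * real j / real l)"
  have bij: "bij_betw (\<lambda>k. cis (2 * pi * real k / real l)) {..<l} {z. z ^ l = 1}"
    by (rule bij_betw_roots_unity) (use l in simp)
  have wl: "w ^ l = 1" using bij l unfolding bij_betw_def w_def by blast
  have w1: "w \<noteq> 1"
  proof
    assume "w = 1"
    then have "cis (2 * pi * real j / real l) = cis (2 * pi * real 0 / real l)" by (simp add: w_def)
    then have "j = 0" using bij l unfolding bij_betw_def by (meson inj_onD lessThan_iff not_less_zero gr_zeroI less_le_trans less_trans zero_less_one)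
    then show False using l by simp
  qed
  have tw: "t = w + 1 / w + 2" using cis_weight[of j l] by (simp add: w_def t)
  show "\<exists>m\<ge>1. ratio (loop_weight t) m = 0"
  proof (rule ccontr)
    assume none: "\<not> (\<exists>m\<ge>1. ratio (loop_weight t) m = 0)"
    then have nd: "nondeg t k" for k by auto
    \<comment> \<open>If no ratio vanished, the formula would hold at index \<open>l - 1\<close>,
      where its numerator contains \<open>w ^ l - 1 = 0\<close>.\<close>
    have "1 \<le> l - 1" using l by simp
    from ratio_formula[OF _ w1 tw this nd] have "ratio (loop_weight t) (l - 1) = 0"
      using wl l by (auto simp: w_def)
    then show False using none \<open>1 \<le> l - 1\<close> by blast
  qed
qed

theorem proposition3p12:
  fixes t :: complex
  shows "semisimple_category (Rep_S_plus t) \<longleftrightarrow>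
    t \<notin> {complex_of_real (4 * (cos (real j * pi / real l))\<^sup>2) | j l :: nat.
          l \<ge> 2 \<and> j \<in> {1..l - 1}}"
proof -
  have "semisimple_category (Rep_S_plus t) \<longleftrightarrow> \<not> (\<exists>m\<ge>1. ratio (loop_weight t) m = 0)"
    using semisimple_Rep_S_plus[of t] not_semisimple_Rep_S_plus[of _ t] by blast
  then show ?thesis unfolding ratio_zero_iff .
qed

end
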